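(* Let $k\ge 2$ and let $G_1,\dots,G_k$ be finite connected graphs such that for no $i\neq j$ is $G_i$ isomorphic to a subgraph of $G_j$; let $A=\bigsqcup_{i=1}^kG_i$. Then there exists a tree-like gluing $H_A$ of $G_1,\dots,G_k$ with $H_A$ not isomorphic to any $G_i$, and for every constant $p\in(0,1)$ and every integer $q>1$, the distribution of $N(A)$ modulo $q$ in $G(n,p)$ is $2^{-\Omega(n)}$-close to uniform on $\mathbb{Z}_q$.
   Context: A \emph{gluing} of connected graphs $G_1,\dots,G_k$ is a connected graph $H$ with subgraphs $H_1,\dots,H_k$ such that $H_i\cong G_i$, $\bigcup V(H_i)=V(H)$, $\bigcup E(H_i)=E(H)$ (a \emph{decomposition}); $H$ is \emph{uniquely decomposable} if it has exactly one decomposition. The \emph{structure graph} $T(H)$ of a uniquely decomposable $H$ has vertex set $[k]$ and an edge $\{i,j\}$ whenever $H_i$ and $H_j$ share a vertex; $H$ is \emph{tree-like} if uniquely decomposable and $T(H)$ is a tree. $N(A)$ is the number of (not necessarily induced) subgraphs of $G(n,p)$ isomorphic to $A$; "$2^{-\Omega(n)}$-close" means total variation distance at most $2^{-cn}$ for some constant $c>0$ and all large $n$. *)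

theory Defs
  imports "HOL-Probability.Probability"
begin

text \<open>A finite simple graph: a pair (vertex set, edge set), edges being 2-element subsets.\<close>
type_synonym 'a ugraph = "'a set \<times> 'a set set"

definition verts :: "'a ugraph \<Rightarrow> 'a set" where "verts G = fst G"
definition edges :: "'a ugraph \<Rightarrow> 'a set set" where "edges G = snd G"

definition wf_graph :: "'a ugraph \<Rightarrow> bool" where
  "wf_graph G \<longleftrightarrow> finite (verts G) \<and> (\<forall>e\<in>edges G. e \<subseteq> verts G \<and> card e = 2)"

definition adj_rel :: "'a ugraph \<Rightarrow> ('a \<times> 'a) set" where
  "adj_rel G = {(u, v). {u, v} \<in> edges G}"

definition connected_graph :: "'a ugraph \<Rightarrow> bool" where
  "connected_graph G \<longleftrightarrow> wf_graph G \<and> verts G \<noteq> {} \<and>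
     (\<forall>u\<in>verts G. \<forall>v\<in>verts G. (u, v) \<in> (adj_rel G)\<^sup>*)"

text \<open>(Not necessarily induced) subgraph.\<close>
definition subgraph :: "'a ugraph \<Rightarrow> 'a ugraph \<Rightarrow> bool" where
  "subgraph S G \<longleftrightarrow> wf_graph S \<and> verts S \<subseteq> verts G \<and> edges S \<subseteq> edges G"

definition graph_iso :: "'a ugraph \<Rightarrow> 'b ugraph \<Rightarrow> bool" where
  "graph_iso G H \<longleftrightarrow> (\<exists>f. bij_betw f (verts G) (verts H) \<and>
     (\<forall>u\<in>verts G. \<forall>v\<in>verts G. {u, v} \<in> edges G \<longleftrightarrow> {f u, f v} \<in> edges H))"

text \<open>G is isomorphic to a subgraph of H.\<close>
definition iso_subgraph :: "'a ugraph \<Rightarrow> 'b ugraph \<Rightarrow> bool" where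
  "iso_subgraph G H \<longleftrightarrow> (\<exists>S. subgraph S H \<and> graph_iso G S)"

text \<open>Cycles and trees.\<close>
definition acyclic_graph :: "'a ugraph \<Rightarrow> bool" where
  "acyclic_graph G \<longleftrightarrow> \<not> (\<exists>cs. length cs \<ge> 3 \<and> distinct cs \<and> set cs \<subseteq> verts G \<and>
      (\<forall>i < length cs. {cs ! i, cs ! ((i + 1) mod length cs)} \<in> edges G))"

definition is_tree :: "'a ugraph \<Rightarrow> bool" where
  "is_tree G \<longleftrightarrow> connected_graph G \<and> acyclic_graph G"

text \<open>Disjoint union of G 0, ..., G (k-1), on tagged vertices (i, v).\<close>
definition disj_union :: "nat \<Rightarrow> (nat \<Rightarrow> 'a ugraph) \<Rightarrow> (nat \<times> 'a) ugraph" where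
  "disj_union k G =
     ({(i, v) | i v. i < k \<and> v \<in> verts (G i)},
      {{(i, u), (i, v)} | i u v. i < k \<and> {u, v} \<in> edges (G i)})"

text \<open>Decomposition of H into copies Hs 0, ..., Hs (k-1) of G 0, ..., G (k-1).\<close>
definition decomposition :: "nat \<Rightarrow> (nat \<Rightarrow> 'a ugraph) \<Rightarrow> 'b ugraph \<Rightarrow> (nat \<Rightarrow> 'b ugraph) \<Rightarrow> bool" where
  "decomposition k G H Hs \<longleftrightarrow>
     (\<forall>i<k. subgraph (Hs i) H \<and> graph_iso (Hs i) (G i)) \<and>
     (\<Union>i<k. verts (Hs i)) = verts H \<and> (\<Union>i<k. edges (Hs i)) = edges H"

definition gluing :: "nat \<Rightarrow> (nat \<Rightarrow> 'a ugraph) \<Rightarrow> 'b ugraph \<Rightarrow> bool" where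
  "gluing k G H \<longleftrightarrow> connected_graph H \<and> (\<exists>Hs. decomposition k G H Hs)"

text \<open>Exactly one decomposition (decompositions are k-tuples, i.e. functions on {0..<k}).\<close>
definition uniquely_decomposable :: "nat \<Rightarrow> (nat \<Rightarrow> 'a ugraph) \<Rightarrow> 'b ugraph \<Rightarrow> bool" where
  "uniquely_decomposable k G H \<longleftrightarrow>
     (\<exists>Hs. decomposition k G H Hs \<and>
        (\<forall>Hs'. decomposition k G H Hs' \<longrightarrow> (\<forall>i<k. Hs' i = Hs i)))"

definition structure_graph :: "nat \<Rightarrow> (nat \<Rightarrow> 'b ugraph) \<Rightarrow> nat ugraph" where
  "structure_graph k Hs =
     ({..<k}, {{i, j} | i j. i < k \<and> j < k \<and> i \<noteq> j \<and> verts (Hs i) \<inter> verts (Hs j) \<noteq> {}})"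

definition tree_like :: "nat \<Rightarrow> (nat \<Rightarrow> 'a ugraph) \<Rightarrow> 'b ugraph \<Rightarrow> bool" where
  "tree_like k G H \<longleftrightarrow> uniquely_decomposable k G H \<and>
     (\<forall>Hs. decomposition k G H Hs \<longrightarrow> is_tree (structure_graph k Hs))"

text \<open>Number of subgraphs of G isomorphic to A.\<close>
definition subgraph_count :: "'b ugraph \<Rightarrow> 'a ugraph \<Rightarrow> nat" where
  "subgraph_count A G = card {S. subgraph S G \<and> graph_iso S A}"

text \<open>Erdos--Renyi random graph G(n,p) on vertex set {0..<n}.\<close>
definition all_pairs :: "nat \<Rightarrow> nat set set" where
  "all_pairs n = {e. e \<subseteq> {..<n} \<and> card e = 2}"

definition Gnp :: "nat \<Rightarrow> real \<Rightarrow> nat ugraph pmf" where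
  "Gnp n p = map_pmf (\<lambda>f. ({..<n}, {e \<in> all_pairs n. f e}))
               (Pi_pmf (all_pairs n) False (\<lambda>_. bernoulli_pmf p))"

text \<open>Total variation distance of a nat-valued distribution from uniform on {0..<q}.\<close>
definition tv_from_uniform :: "nat pmf \<Rightarrow> nat \<Rightarrow> real" where
  "tv_from_uniform X q = (1/2) * ((\<Sum>r<q. \<bar>pmf X r - 1 / real q\<bar>) + measure_pmf.prob X {r. r \<ge> q})"

end

theory Submission
  imports Defs
begin

text \<open>
  Glue the graphs in a chain, joining the end of a diametral pair of \<open>G i\<close> to the start of one of
  \<open>G (i + 1)\<close>. The distance to the start of the chain shows that in any decomposition the pieces occupy
  consecutive level intervals, whose lengths are their diameters. Hence the lowest piece either lies inside
  \<open>G 0\<close> or contains it, and since no \<open>G i\<close> embeds into another one it is \<open>G 0\<close> itself; peeling it off gives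
  uniqueness by induction.

  For the distribution, the cluster expansion writes the number of copies of the disjoint union as a sum
  over connected edge sets \<open>U\<close>, weighted by Ursell functions, plus a polynomial in sums of the same kind
  for proper subfamilies of the \<open>G i\<close>. The chain has weight $\pm 1$ and too many edges to occur in the proper
  subfamilies, so expanding a character of the polynomial into characters of the sums leaves only characters
  of connected weighted counts that do not vanish modulo \<open>q\<close>. On linearly many vertex-disjoint copies of a
  connected edge set of maximal size with nonzero weight, such a count is a sum of disjoint monomials of top
  degree plus terms of lower degree, and its bias is bounded by the Cauchy--Schwarz argument of Babai, Nisan
  and Szegedy.
\<close>

section \<open>Averages over random subsets\<close>

text \<open>The obstacle is that \<open>A\<close> is disconnected. On vertex-disjoint blocks the
  pieces of a copy of \<open>A\<close> may lie in different blocks and produce top-degree monomials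
  that mix them, so no block can be isolated. A connected edge set cannot mix blocks, which is why
  the count is rewritten through connected weights. The price is a nonlinear remainder; modulo
  \<open>q\<close>, however, it is a function of finitely many residues, hence a linear combination
  of characters. Multiplying characters adds weights, so the remainder only alters weights of edge
  sets with fewer edges than the chain. Since \<open>q\<close> may be composite, the weight of the
  chain must survive multiplication by every \<open>a\<close> with 0 < \<open>a\<close> <
  \<open>q\<close>; the values 1 and -1 guarantee this, and they rest on uniqueness of the
  decomposition. Diametral pairs are chosen because a copy of \<open>G i\<close> never spans more
  levels than its diameter, while the chain has exactly as many as the diameters add up to, so that
  no slack is left.\<close>

definition subset_weight :: "real \<Rightarrow> 'e set \<Rightarrow> 'e set \<Rightarrow> real" where
  "subset_weight p M S = (\<Prod>e\<in>M. if e \<in> S then p else 1 - p)"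

text \<open>A finite sum instead of an expectation over a pmf: no integrability conditions arise,
  and real and complex values share one set of lemmas. \<open>expectation_random_subset\<close>
  connects it with the random graph.\<close>

definition avg :: "real \<Rightarrow> 'e set \<Rightarrow> ('e set \<Rightarrow> 'v::real_vector) \<Rightarrow> 'v" where
  "avg p M f = (\<Sum>S\<in>Pow M. subset_weight p M S *\<^sub>R f S)"

lemma avg_cong: "(\<And>S. S \<subseteq> M \<Longrightarrow> f S = g S) \<Longrightarrow> avg p M f = avg p M g"
  unfolding avg_def by (intro sum.cong) auto

lemma avg_empty [simp]: "avg p {} f = f {}"
  by (simp add: avg_def subset_weight_def)

lemma avg_insert:
  assumes "finite M" "e \<notin> M"
  shows "avg p (insert e M) f = p *\<^sub>R avg p M (\<lambda>S. f (insert e S)) + (1 - p) *\<^sub>R avg p M f"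
proof -
  have w1: "subset_weight p (insert e M) (insert e S) = p * subset_weight p M S" if "S \<subseteq> M" for S
    unfolding subset_weight_def using assms that
    by (subst prod.insert) (auto intro!: prod.cong)
  have w2: "subset_weight p (insert e M) S = (1 - p) * subset_weight p M S" if "S \<subseteq> M" for S
    unfolding subset_weight_def using assms that by (subst prod.insert) auto
  have inj: "inj_on (insert e) (Pow M)"
    using assms(2) by (auto simp: inj_on_def)
  have "avg p (insert e M) f = (\<Sum>S\<in>Pow M. subset_weight p (insert e M) S *\<^sub>R f S)
      + (\<Sum>S\<in>insert e ` Pow M. subset_weight p (insert e M) S *\<^sub>R f S)"
    unfolding avg_def Pow_insert using assms by (intro sum.union_disjoint) auto
  also have "(\<Sum>S\<in>insert e ` Pow M. subset_weight p (insert e M) S *\<^sub>R f S)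
      = p *\<^sub>R avg p M (\<lambda>S. f (insert e S))"
    unfolding avg_def sum.reindex[OF inj] by (auto simp: scaleR_sum_right w1 intro!: sum.cong)
  also have "(\<Sum>S\<in>Pow M. subset_weight p (insert e M) S *\<^sub>R f S) = (1 - p) *\<^sub>R avg p M f"
    unfolding avg_def by (auto simp: scaleR_sum_right w2 intro!: sum.cong)
  finally show ?thesis by simp
qed

lemma avg_const: "finite M \<Longrightarrow> avg p M (\<lambda>_. c) = c"
  by (induction M rule: finite_induct) (auto simp: avg_insert simp flip: scaleR_add_left)

lemma avg_add: "avg p M (\<lambda>S. f S + g S) = avg p M f + avg p M g"
  by (simp add: avg_def scaleR_add_right sum.distrib)

lemma avg_sum: "avg p M (\<lambda>S. \<Sum>i\<in>I. f i S) = (\<Sum>i\<in>I. avg p M (f i))"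
  unfolding avg_def by (simp add: scaleR_sum_right) (rule sum.swap)

lemma avg_mult_left: "avg p M (\<lambda>S. c * f S) = c * avg p M f" for c :: "'v::real_algebra"
  by (simp add: avg_def sum_distrib_left)

lemma avg_swap: "avg p A (\<lambda>S. avg p B (f S)) = avg p B (\<lambda>T. avg p A (\<lambda>S. f S T))"
  unfolding avg_def by (simp add: scaleR_sum_right) (subst sum.swap, simp add: mult.commute)

lemma avg_union:
  assumes "finite A" "finite B" "A \<inter> B = {}"
  shows "avg p (A \<union> B) f = avg p A (\<lambda>S. avg p B (\<lambda>T. f (S \<union> T)))"
  using assms
proof (induction A arbitrary: f rule: finite_induct)
  case (insert a A)
  then show ?case by (simp add: avg_insert)
qed simp

text \<open>Independence of the coordinates \<open>e j\<close>, with a separate function for each;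
  used at both ends of the Cauchy-Schwarz induction.\<close>

lemma avg_prod:
  fixes h :: "'j \<Rightarrow> bool \<Rightarrow> 'v::real_normed_field"
  assumes "finite J" "inj_on e J"
  shows "avg p (e ` J) (\<lambda>S. \<Prod>j\<in>J. h j (e j \<in> S)) =
    (\<Prod>j\<in>J. of_real p * h j True + of_real (1 - p) * h j False)"
  using assms
proof (induction J rule: finite_induct)
  case (insert j J)
  let ?f = "\<lambda>S. \<Prod>i\<in>insert j J. h i (e i \<in> S)"
  have *: "e j \<notin> e ` J" "inj_on e J" using insert by (auto simp: inj_on_def)
  have "avg p (e ` J) (\<lambda>S. ?f (insert (e j) S))
      = avg p (e ` J) (\<lambda>S. h j True * (\<Prod>i\<in>J. h i (e i \<in> S)))"
  proof (intro avg_cong)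
    fix S assume "S \<subseteq> e ` J"
    have "(\<Prod>i\<in>J. h i (e i \<in> insert (e j) S)) = (\<Prod>i\<in>J. h i (e i \<in> S))"
      using *(1) by (intro prod.cong) (auto simp: image_iff)
    then show "?f (insert (e j) S) = h j True * (\<Prod>i\<in>J. h i (e i \<in> S))"
      using insert(1,2) by simp
  qed
  moreover have "avg p (e ` J) ?f = avg p (e ` J) (\<lambda>S. h j False * (\<Prod>i\<in>J. h i (e i \<in> S)))"
  proof (intro avg_cong)
    fix S assume "S \<subseteq> e ` J"
    then have "e j \<notin> S" using *(1) by auto
    then show "?f S = h j False * (\<Prod>i\<in>J. h i (e i \<in> S))" using insert(1,2) by simp
  qed
  moreover have "avg p (e ` insert j J) ?f = p *\<^sub>R avg p (e ` J) (\<lambda>S. ?f (insert (e j) S)) + (1 - p) *\<^sub>R avg p (e ` J) ?f"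
    unfolding image_insert using insert(1) * by (intro avg_insert) auto
  ultimately show ?case
    using insert(1,2,3) * by (simp add: avg_mult_left scaleR_conv_of_real ring_distribs mult.assoc)
qed simp

context
  fixes p :: real
  assumes p: "0 \<le> p" "p \<le> 1"
begin

lemma subset_weight_nonneg: "0 \<le> subset_weight p M S"
  unfolding subset_weight_def using p by (auto intro!: prod_nonneg)

lemma norm_avg_le: "norm (avg p M f) \<le> avg p M (\<lambda>S. norm (f S))" for f :: "'e set \<Rightarrow> 'v::real_normed_vector"
  unfolding avg_def
  by (rule order_trans[OF norm_sum]) (simp add: subset_weight_nonneg)

lemma avg_mono: "(\<And>S. S \<subseteq> M \<Longrightarrow> f S \<le> g S) \<Longrightarrow> avg p M f \<le> avg p M g" for f :: "'e set \<Rightarrow> real"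
  unfolding avg_def by (intro sum_mono) (auto intro!: mult_left_mono subset_weight_nonneg)

lemma avg_nonneg: "(\<And>S. S \<subseteq> M \<Longrightarrow> 0 \<le> f S) \<Longrightarrow> 0 \<le> avg p M f" for f :: "'e set \<Rightarrow> real"
  unfolding avg_def by (intro sum_nonneg) (auto intro!: mult_nonneg_nonneg subset_weight_nonneg)

text \<open>Nonnegativity of the variance.\<close>

lemma avg_square_le:
  fixes f :: "'e set \<Rightarrow> real"
  assumes "finite M"
  shows "(avg p M f)\<^sup>2 \<le> avg p M (\<lambda>S. (f S)\<^sup>2)"
proof -
  define m where "m = avg p M f"
  have "0 \<le> avg p M (\<lambda>S. (f S - m)\<^sup>2)" by (intro avg_nonneg) auto
  also have "\<dots> = avg p M (\<lambda>S. (f S)\<^sup>2 + ((- 2 * m) * f S + m\<^sup>2))"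
    by (intro avg_cong) (simp add: power2_eq_square algebra_simps)
  also have "\<dots> = avg p M (\<lambda>S. (f S)\<^sup>2) - m\<^sup>2"
    by (simp only: avg_add avg_mult_left avg_const[OF assms] flip: m_def)
       (simp add: power2_eq_square)
  finally show ?thesis by (simp add: m_def)
qed

text \<open>Iterated squaring; powers of two are the only exponents that repeated Cauchy-Schwarz
  produces.\<close>

lemma avg_power_le:
  fixes f :: "'e set \<Rightarrow> real"
  assumes "finite M" "\<And>S. S \<subseteq> M \<Longrightarrow> 0 \<le> f S"
  shows "avg p M f ^ (2 ^ d) \<le> avg p M (\<lambda>S. f S ^ (2 ^ d))"
proof (induction d)
  case (Suc d)
  have "avg p M f ^ (2 ^ Suc d) = (avg p M f ^ (2 ^ d))\<^sup>2" by (simp add: mult.commute flip: power_mult)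
  also have "\<dots> \<le> (avg p M (\<lambda>S. f S ^ (2 ^ d)))\<^sup>2"
    using Suc assms by (intro power_mono) (auto intro!: zero_le_power avg_nonneg)
  also have "\<dots> \<le> avg p M (\<lambda>S. (f S ^ (2 ^ d))\<^sup>2)" by (rule avg_square_le[OF assms(1)])
  finally show ?case by (simp add: mult.commute flip: power_mult)
qed simp

end

section \<open>Characters\<close>

definition zchar :: "nat \<Rightarrow> int \<Rightarrow> complex" where
  "zchar q x = cis (2 * pi * of_int x / of_nat q)"

lemma zchar_0 [simp]: "zchar q 0 = 1"
  by (simp add: zchar_def)

lemma norm_zchar [simp]: "norm (zchar q x) = 1"
  by (simp add: zchar_def)

lemma zchar_add: "zchar q (x + y) = zchar q x * zchar q y"
  by (simp add: zchar_def cis_mult add_divide_distrib ring_distribs)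

lemma zchar_sum: "zchar q (\<Sum>i\<in>I. f i) = (\<Prod>i\<in>I. zchar q (f i))"
  by (induction I rule: infinite_finite_induct) (auto simp: zchar_add)

lemma cnj_zchar: "cnj (zchar q x) = zchar q (- x)"
  by (simp add: zchar_def cis_cnj)

lemma zchar_eq_1:
  assumes "q > 0" 
  shows "zchar q x = 1 \<longleftrightarrow> int q dvd x"
proof -
  have "zchar q x = 1 \<longleftrightarrow> (\<exists>n::int. 2 * pi * of_int x / of_nat q = of_int (2 * n) * pi)"
    unfolding zchar_def cis_conv_exp by (simp add: exp_eq_1)
  also have "\<dots> \<longleftrightarrow> (\<exists>n::int. x = n * int q)"
  proof -
    have "2 * pi * of_int x / of_nat q = of_int (2 * n) * pi \<longleftrightarrow> x = n * int q" for n
    proof -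
      have "2 * pi * of_int x / of_nat q = of_int (2 * n) * pi \<longleftrightarrow> (of_int x :: real) = of_int (n * int q)"
        using assms by (auto simp: field_simps)
      then show ?thesis by (simp only: of_int_eq_iff)
    qed
    then show ?thesis by simp
  qed
  finally show ?thesis by (auto simp: dvd_def mult.commute)
qed

lemma zchar_cong: "q > 0 \<Longrightarrow> x mod int q = y mod int q \<Longrightarrow> zchar q x = zchar q y"
  using zchar_add[of q "x - y" y] zchar_eq_1[of q "x - y"]
  by (simp add: mod_eq_dvd_iff)

lemma zchar_orthogonal:
  assumes "q > 0"
  shows "(\<Sum>a<q. zchar q (int a * x)) = of_nat q * of_bool (int q dvd x)"
proof -
  have pw: "zchar q (int a * x) = zchar q x ^ a" for a
    by (induction a) (auto simp: zchar_add ring_distribs)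
  show ?thesis
  proof (cases "int q dvd x")
    case True
    then show ?thesis using assms by (simp add: pw zchar_eq_1[THEN iffD2])
  next
    case False
    have "(\<Sum>a<q. zchar q x ^ a) = (zchar q x ^ q - 1) / (zchar q x - 1)"
      using False assms zchar_eq_1 by (intro geometric_sum) auto
    also have "zchar q x ^ q = 1"
      using assms by (simp flip: pw add: zchar_eq_1)
    finally show ?thesis using False by (simp add: pw)
  qed
qed

text \<open>The norm is that of the mean of the character at \<open>x\<close> times a Bernoulli
  variable; the closed form shows that it drops below 1 as soon as the cosine does.\<close>

lemma norm_biased_zchar:
  "(norm (of_real (1 - p) + of_real p * zchar q x))\<^sup>2 = 1 - 2 * p * (1 - p) * (1 - cos (2 * pi * of_int x / of_nat q))"
proof -
  define t where "t = 2 * pi * of_int x / of_nat q"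
  have "(norm (of_real (1 - p) + of_real p * zchar q x))\<^sup>2 = ((1 - p) + p * cos t)\<^sup>2 + (p * sin t)\<^sup>2"
    unfolding zchar_def t_def[symmetric] by (simp add: cmod_power2)
  also have "\<dots> = ((1 - p) + p * cos t)\<^sup>2 + p\<^sup>2 * (1 - (cos t)\<^sup>2)"
    by (simp add: power_mult_distrib sin_squared_eq)
  also have "\<dots> = 1 - 2 * p * (1 - p) * (1 - cos t)"
    by (simp add: power2_eq_square algebra_simps)
  finally show ?thesis by (simp add: t_def)
qed

text \<open>Uniformity in \<open>x\<close> comes from periodicity: only the finitely many nonzero
  residues matter, so a maximum of values below 1 will do.\<close>

lemma zchar_gap:
  assumes "0 < p" "p < 1" "q > 0"
  obtains \<rho> where "0 \<le> \<rho>" "\<rho> < 1" 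
    "\<And>x. \<not> int q dvd x \<Longrightarrow> (norm (of_real (1 - p) + of_real p * zchar q x))\<^sup>2 \<le> \<rho>"
proof -
  define f where "f x = (norm (of_real (1 - p) + of_real p * zchar q x))\<^sup>2" for x
  \<comment> \<open>The inserted 0 keeps the set nonempty for \<open>q = 1\<close> and makes the
    maximum nonnegative.\<close>
  define X where "X = insert 0 (f ` {1..<int q})"
  have f1: "f x < 1" if nd: "\<not> int q dvd x" for x
  proof -
    have "Re (zchar q x) \<noteq> 1"
    proof
      assume R: "Re (zchar q x) = 1"
      have "(norm (zchar q x))\<^sup>2 = 1" by simp
      then have "Im (zchar q x) = 0" using R by (simp only: cmod_power2) simp
      then have "zchar q x = 1" using R by (simp add: complex_eq_iff)
      then show False using nd zchar_eq_1 assms by auto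
    qed
    then have "cos (2 * pi * of_int x / of_nat q) < 1"
      using cos_le_one[of "2 * pi * of_int x / of_nat q"] unfolding zchar_def by (simp add: less_le)
    then show ?thesis unfolding f_def norm_biased_zchar
      using assms by (simp add: mult_pos_pos)
  qed
  have "\<rho> < 1" if "\<rho> \<in> X" for \<rho>
    using that f1 by (auto simp: X_def zdvd_not_zless)
  then have "Max X < 1" by (simp add: X_def)
  moreover have "0 \<le> Max X" by (simp add: X_def)
  moreover have "f x \<le> Max X" if "\<not> int q dvd x" for x
  proof -
    have "x mod int q \<in> {1..<int q}" 
      using that assms by (auto simp: dvd_eq_mod_eq_0) (metis int_one_le_iff_zero_less order_le_less of_nat_0_less_iff pos_mod_sign)
    moreover have "f x = f (x mod int q)"
      unfolding f_def using assms zchar_cong[of q x "x mod int q"] by simp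
    ultimately have "f x \<in> X" unfolding X_def by blast
    then show ?thesis by (intro Max_ge) (auto simp: X_def)
  qed
  ultimately show ?thesis using that unfolding f_def by blast
qed

section \<open>Bias of block polynomials by repeated Cauchy-Schwarz\<close>

lemma avg_of_real: "of_real (avg p M f) = avg p M (\<lambda>S. of_real (f S) :: complex)"
  by (simp add: avg_def scaleR_conv_of_real)

lemma avg_cnj: "cnj (avg p M f) = avg p M (\<lambda>S. cnj (f S))"
  by (simp add: avg_def scaleR_conv_of_real)

lemma norm_avg_squared:
  "complex_of_real ((norm (avg p M f))\<^sup>2) = avg p M (\<lambda>S. avg p M (\<lambda>T. f S * cnj (f T)))"
proof -
  have "complex_of_real ((norm (avg p M f))\<^sup>2) = avg p M f * cnj (avg p M f)"
    by (simp add: complex_norm_square del: of_real_power)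
  also have "\<dots> = avg p M f * avg p M (\<lambda>T. cnj (f T))" by (simp add: avg_cnj)
  also have "\<dots> = avg p M (\<lambda>S. f S * avg p M (\<lambda>T. cnj (f T)))"
    by (simp add: avg_def sum_distrib_right)
  finally show ?thesis by (simp add: avg_mult_left)
qed

text \<open>One Cauchy-Schwarz step doubles a variable into two independent copies and multiplies
  the weight of its block by their difference. The copies differ with probability 2p(1 - p) and then
  leave the weight unchanged up to sign; otherwise the block disappears and its factor is 1.
  Averaging gives the recursion.\<close>

primrec box_const :: "real \<Rightarrow> real \<Rightarrow> nat \<Rightarrow> real" where
  "box_const p \<rho> 0 = \<rho>"
| "box_const p \<rho> (Suc d) = 1 - 2 * p * (1 - p) * (1 - box_const p \<rho> d)"

lemma bernoulli_variance_bounds: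
  fixes p :: real
  assumes "0 < p" "p < 1"
  shows "0 < 2 * p * (1 - p)" "2 * p * (1 - p) < 1"
proof -
  show "0 < 2 * p * (1 - p)" using assms by simp
  have "0 \<le> (1 - 2 * p)\<^sup>2" by simp
  then show "2 * p * (1 - p) < 1" by (simp add: power2_eq_square algebra_simps)
qed

lemma box_const_bounds:
  assumes "0 < p" "p < 1" "0 \<le> \<rho>" "\<rho> < 1"
  shows "0 \<le> box_const p \<rho> d \<and> box_const p \<rho> d < 1"
proof (induction d)
  case (Suc d)
  note b = bernoulli_variance_bounds[OF assms(1,2)]
  have "2 * p * (1 - p) * (1 - box_const p \<rho> d) \<le> 1 * 1"
    using Suc b assms by (intro mult_mono) auto
  moreover have "0 < 2 * p * (1 - p) * (1 - box_const p \<rho> d)"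
    using Suc b(1) by (intro mult_pos_pos[of "2 * p * (1 - p)"]) linarith+
  ultimately show ?case by simp
qed (use assms in auto)

text \<open>The Cauchy--Schwarz argument of Babai, Nisan and Szegedy for $d+1$ players, the $t$-th of whom
  sees everything except the variables \<open>e j t\<close>.\<close>
lemma box_bias:
  assumes p: "0 < p" "p < 1" and q: "q > 0" and J: "finite J"
    and \<rho>: "0 \<le> \<rho>" "\<rho> < 1"
      "\<And>x. \<not> int q dvd x \<Longrightarrow> (norm (of_real (1 - p) + of_real p * zchar q x))\<^sup>2 \<le> \<rho>"
    and e: "inj_on (\<lambda>(j, t). e j t) (J \<times> {..d})"
    and g: "\<And>t S. t \<le> d \<Longrightarrow> norm (g t S) \<le> 1"
      "\<And>t S. t \<le> d \<Longrightarrow> g t (S - (\<lambda>j. e j t) ` J) = g t S"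
  shows "norm (avg p (\<Union>t\<le>d. (\<lambda>j. e j t) ` J)
      (\<lambda>S. zchar q (\<Sum>j\<in>J. w j * of_bool (\<forall>t\<le>d. e j t \<in> S)) * (\<Prod>t\<le>d. g t S))) ^ (2 ^ Suc d)
    \<le> (\<Prod>j\<in>J. if int q dvd w j then 1 else box_const p \<rho> d)"
  using e g
proof (induction d arbitrary: w g)
  case 0
  have inj: "inj_on (\<lambda>j. e j 0) J"
    using 0(1) by (auto simp: inj_on_def)
  \<comment> \<open>With a single column every variable is hidden from \<open>g 0\<close>, which is
    therefore constant, and the average factors over \<open>J\<close>.\<close>
  have "avg p ((\<lambda>j. e j 0) ` J) (\<lambda>S. zchar q (\<Sum>j\<in>J. w j * of_bool (e j 0 \<in> S)) * g 0 S)
     = avg p ((\<lambda>j. e j 0) ` J) (\<lambda>S. g 0 {} * (\<Prod>j\<in>J. zchar q (w j * of_bool (e j 0 \<in> S))))"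
  proof (intro avg_cong)
    fix S assume "S \<subseteq> (\<lambda>j. e j 0) ` J"
    then have "S - (\<lambda>j. e j 0) ` J = {}" by auto
    moreover have "g 0 (S - (\<lambda>j. e j 0) ` J) = g 0 S" using 0(3)[of 0 S] by blast
    ultimately have "g 0 S = g 0 {}" by (simp only:)
    then show "zchar q (\<Sum>j\<in>J. w j * of_bool (e j 0 \<in> S)) * g 0 S = g 0 {} * (\<Prod>j\<in>J. zchar q (w j * of_bool (e j 0 \<in> S)))"
      by (simp add: zchar_sum)
  qed
  also have "\<dots> = g 0 {} * (\<Prod>j\<in>J. of_real p * zchar q (w j) + of_real (1 - p))"
    unfolding avg_mult_left
    by (subst avg_prod[OF J inj, where h = "\<lambda>j b. zchar q (w j * of_bool b)"]) simp
  finally have eq: "avg p ((\<lambda>j. e j 0) ` J) (\<lambda>S. zchar q (\<Sum>j\<in>J. w j * of_bool (e j 0 \<in> S)) * g 0 S)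
    = g 0 {} * (\<Prod>j\<in>J. of_real p * zchar q (w j) + of_real (1 - p))" .
  have b: "(norm (of_real p * zchar q (w j) + of_real (1 - p)))\<^sup>2 \<le> (if int q dvd w j then 1 else \<rho>)" for j
  proof (cases "int q dvd w j")
    case True
    then show ?thesis using q by (simp add: zchar_eq_1[THEN iffD2])
  next
    case False
    then show ?thesis using \<rho>(3)[of "w j"] by (simp add: add.commute)
  qed
  have "norm (g 0 {} * (\<Prod>j\<in>J. of_real p * zchar q (w j) + of_real (1 - p))) ^ 2
     = (norm (g 0 {}))\<^sup>2 * (\<Prod>j\<in>J. (norm (of_real p * zchar q (w j) + of_real (1 - p)))\<^sup>2)"
    by (simp add: norm_mult prod_norm power_mult_distrib flip: prod_power_distrib)
  also have "\<dots> \<le> 1 * (\<Prod>j\<in>J. if int q dvd w j then 1 else \<rho>)"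
    using 0(2)[of 0] b by (intro mult_mono prod_mono) (auto simp: power_le_one intro!: prod_nonneg)
  finally show ?case unfolding box_const.simps using eq by simp
next
  case (Suc d)
  define M where "M = (\<Union>t\<le>d. (\<lambda>j. e j t) ` J)"
  define T where "T = (\<lambda>j. e j (Suc d)) ` J"
  define x where "x S j = (of_bool (e j (Suc d) \<in> S) :: int)" for S j
  define h where "h S1 S2 = zchar q (\<Sum>j\<in>J. w j * x S2 j * of_bool (\<forall>t\<le>d. e j t \<in> S1)) * (\<Prod>t\<le>d. g t (S1 \<union> S2))" for S1 S2
  have fin: "finite M" "finite T" using J by (auto simp: M_def T_def)
  have einj: "e j t = e j' t' \<longleftrightarrow> j = j' \<and> t = t'" if "j \<in> J" "j' \<in> J" "t \<le> Suc d" "t' \<le> Suc d" for j j' t t'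
    using inj_onD[OF Suc.prems(1), of "(j, t)" "(j', t')"] that by auto
  have disj: "M \<inter> T = {}" unfolding M_def T_def using einj by fastforce
  have inj': "inj_on (\<lambda>(j, t). e j t) (J \<times> {..d})"
    using Suc.prems(1) by (rule inj_on_subset) auto
  have injT: "inj_on (\<lambda>j. e j (Suc d)) J" using einj by (auto simp: inj_on_def)
  have p': "0 \<le> p" "p \<le> 1" using p by auto
  define Z where "Z = avg p (\<Union>t\<le>Suc d. (\<lambda>j. e j t) ` J)
      (\<lambda>S. zchar q (\<Sum>j\<in>J. w j * of_bool (\<forall>t\<le>Suc d. e j t \<in> S)) * (\<Prod>t\<le>Suc d. g t S))"
  have U: "(\<Union>t\<le>Suc d. (\<lambda>j. e j t) ` J) = M \<union> T"
    unfolding M_def T_def by (simp add: atMost_Suc Un_commute)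
  \<comment> \<open>\<open>g (Suc d)\<close> ignores the column \<open>T\<close>, so it leaves the
    inner average, and its norm bound discards it before squaring.\<close>
  have "Z = avg p M (\<lambda>S1. g (Suc d) S1 * avg p T (h S1))"
    unfolding Z_def U avg_union[OF fin disj] avg_mult_left[symmetric]
  proof (intro avg_cong)
    fix S1 S2 assume S: "S1 \<subseteq> M" "S2 \<subseteq> T"
    have "(\<forall>t\<le>Suc d. e j t \<in> S1 \<union> S2) \<longleftrightarrow> (\<forall>t\<le>d. e j t \<in> S1) \<and> e j (Suc d) \<in> S2" if "j \<in> J" for j
    proof -
      have "e j (Suc d) \<in> T" "\<And>t. t \<le> d \<Longrightarrow> e j t \<in> M" using that by (auto simp: M_def T_def)
      then have "e j (Suc d) \<notin> S1" "\<And>t. t \<le> d \<Longrightarrow> e j t \<notin> S2" using S disj by blast+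
      then show ?thesis by (auto simp: le_Suc_eq)
    qed
    then have 1: "(\<Sum>j\<in>J. w j * of_bool (\<forall>t\<le>Suc d. e j t \<in> S1 \<union> S2)) = (\<Sum>j\<in>J. w j * x S2 j * of_bool (\<forall>t\<le>d. e j t \<in> S1))"
      by (intro sum.cong) (auto simp: x_def)
    have "(S1 \<union> S2) - T = S1 - T" using S by auto
    then have 2: "g (Suc d) (S1 \<union> S2) = g (Suc d) S1"
      using Suc.prems(3)[of "Suc d" "S1 \<union> S2"] Suc.prems(3)[of "Suc d" "S1"] by (simp add: T_def)
    show "zchar q (\<Sum>j\<in>J. w j * of_bool (\<forall>t\<le>Suc d. e j t \<in> S1 \<union> S2)) * (\<Prod>t\<le>Suc d. g t (S1 \<union> S2)) = g (Suc d) S1 * h S1 S2"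
      unfolding 1 h_def prod.atMost_Suc 2 by (simp add: mult_ac)
  qed
  then have "norm Z \<le> avg p M (\<lambda>S1. norm (g (Suc d) S1 * avg p T (h S1)))"
    using norm_avg_le[OF p'] by simp
  also have "\<dots> \<le> avg p M (\<lambda>S1. norm (avg p T (h S1)))"
    using Suc.prems(2)[of "Suc d"] by (intro avg_mono[OF p']) (auto simp: norm_mult intro!: mult_left_le_one_le)
  finally have "(norm Z)\<^sup>2 \<le> (avg p M (\<lambda>S1. norm (avg p T (h S1))))\<^sup>2" by (intro power_mono) auto
  also have "\<dots> \<le> avg p M (\<lambda>S1. (norm (avg p T (h S1)))\<^sup>2)" by (rule avg_square_le[OF p' fin(1)])
  also have "\<dots> \<le> norm (complex_of_real (avg p M (\<lambda>S1. (norm (avg p T (h S1)))\<^sup>2)))" by simp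
  also have "complex_of_real (avg p M (\<lambda>S1. (norm (avg p T (h S1)))\<^sup>2))
      = avg p M (\<lambda>S1. avg p T (\<lambda>S2. avg p T (\<lambda>S3. h S1 S2 * cnj (h S1 S3))))"
    unfolding avg_of_real norm_avg_squared ..
  also have "\<dots> = avg p T (\<lambda>S2. avg p T (\<lambda>S3. avg p M (\<lambda>S1. h S1 S2 * cnj (h S1 S3))))"
    by (subst avg_swap, intro avg_cong, rule avg_swap)
  also have "norm \<dots> \<le> avg p T (\<lambda>S2. avg p T (\<lambda>S3. norm (avg p M (\<lambda>S1. h S1 S2 * cnj (h S1 S3)))))"
    by (rule order_trans[OF norm_avg_le[OF p']], intro avg_mono[OF p'] norm_avg_le[OF p'])
  finally have "((norm Z)\<^sup>2) ^ (2 ^ Suc d) \<le> avg p T (\<lambda>S2. avg p T (\<lambda>S3. norm (avg p M (\<lambda>S1. h S1 S2 * cnj (h S1 S3))))) ^ (2 ^ Suc d)"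
    by (intro power_mono) auto
  also have "\<dots> \<le> avg p T (\<lambda>S2. avg p T (\<lambda>S3. norm (avg p M (\<lambda>S1. h S1 S2 * cnj (h S1 S3)))) ^ (2 ^ Suc d))"
    by (intro avg_power_le[OF p' fin(2)] avg_nonneg[OF p']) auto
  also have "\<dots> \<le> avg p T (\<lambda>S2. avg p T (\<lambda>S3. norm (avg p M (\<lambda>S1. h S1 S2 * cnj (h S1 S3))) ^ (2 ^ Suc d)))"
    by (intro avg_mono[OF p'] avg_power_le[OF p' fin(2)]) auto
  also have "\<dots> \<le> avg p T (\<lambda>S2. avg p T (\<lambda>S3. \<Prod>j\<in>J. if int q dvd w j * (x S2 j - x S3 j) then 1 else box_const p \<rho> d))"
  proof (intro avg_mono[OF p'])
    fix S2 S3 assume S: "S2 \<subseteq> T" "S3 \<subseteq> T"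
    \<comment> \<open>These products still have norm at most 1 and still ignore their columns. Only
      the weights change, to \<open>w j * (x S2 j - x S3 j)\<close>, so the induction hypothesis
      applies with one player fewer.\<close>
    define g' where "g' t S = g t (S \<union> S2) * cnj (g t (S \<union> S3))" for t S
    have eq: "h S1 S2 * cnj (h S1 S3) = zchar q (\<Sum>j\<in>J. (w j * (x S2 j - x S3 j)) * of_bool (\<forall>t\<le>d. e j t \<in> S1)) * (\<Prod>t\<le>d. g' t S1)" for S1
    proof -
      have *: "(\<Sum>j\<in>J. (w j * (x S2 j - x S3 j)) * of_bool (\<forall>t\<le>d. e j t \<in> S1))
        = (\<Sum>j\<in>J. w j * x S2 j * of_bool (\<forall>t\<le>d. e j t \<in> S1)) + - (\<Sum>j\<in>J. w j * x S3 j * of_bool (\<forall>t\<le>d. e j t \<in> S1))"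
        unfolding sum_negf[symmetric] sum.distrib[symmetric] by (intro sum.cong) (auto simp: algebra_simps)
      show ?thesis unfolding h_def g'_def * zchar_add by (simp add: cnj_zchar prod.distrib cnj_prod)
    qed
    have "norm (g' t S) \<le> 1" if "t \<le> d" for t S
      unfolding g'_def norm_mult complex_mod_cnj using Suc.prems(2)[of t] that by (intro mult_le_one) auto
    moreover have "g' t (S - (\<lambda>j. e j t) ` J) = g' t S" if t: "t \<le> d" for t S
    proof -
      have "(\<lambda>j. e j t) ` J \<inter> T = {}" using disj t by (auto simp: M_def)
      then have "(S - (\<lambda>j. e j t) ` J) \<union> S' = (S \<union> S') - (\<lambda>j. e j t) ` J" if "S' \<subseteq> T" for S'
        using that by auto
      then show ?thesis unfolding g'_def using S Suc.prems(3)[of t] t by simp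
    qed
    ultimately show "norm (avg p M (\<lambda>S1. h S1 S2 * cnj (h S1 S3))) ^ (2 ^ Suc d) \<le> (\<Prod>j\<in>J. if int q dvd w j * (x S2 j - x S3 j) then 1 else box_const p \<rho> d)"
      unfolding eq M_def by (rule Suc.IH[OF inj'])
  qed
  also have "\<dots> = (\<Prod>j\<in>J. if int q dvd w j then 1 else box_const p \<rho> (Suc d))"
  proof -
    \<comment> \<open>Averaging over \<open>S3\<close> and then over \<open>S2\<close> runs through
      the differences 0, 1 and -1; divisibility ignores the sign.\<close>
    define B where "B j y = (if int q dvd w j * y then 1 else box_const p \<rho> d)" for j y
    have "avg p T (\<lambda>S3. \<Prod>j\<in>J. B j (x S2 j - x S3 j)) = (\<Prod>j\<in>J. p * B j (x S2 j - 1) + (1 - p) * B j (x S2 j))" for S2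
      unfolding T_def x_def
      by (subst avg_prod[OF J injT, where h = "\<lambda>j b. B j (of_bool (e j (Suc d) \<in> S2) - of_bool b)"]) simp
    moreover have "avg p T (\<lambda>S2. \<Prod>j\<in>J. p * B j (x S2 j - 1) + (1 - p) * B j (x S2 j))
       = (\<Prod>j\<in>J. p * (p * B j 0 + (1 - p) * B j 1) + (1 - p) * (p * B j (- 1) + (1 - p) * B j 0))"
      unfolding T_def x_def
      by (subst avg_prod[OF J injT, where h = "\<lambda>j b. p * B j (of_bool b - 1) + (1 - p) * B j (of_bool b)"]) simp
    moreover have "p * (p * B j 0 + (1 - p) * B j 1) + (1 - p) * (p * B j (- 1) + (1 - p) * B j 0)
       = (if int q dvd w j then 1 else box_const p \<rho> (Suc d))" for j
      by (simp add: B_def) (simp add: algebra_simps)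
    ultimately show ?thesis unfolding B_def by simp
  qed
  finally show ?case unfolding Z_def by (simp flip: power_mult)
qed


text \<open>The variables outside the blocks are frozen. Each term of nonzero weight that is not a
  block misses an entire column and can thus be computed by the player to whom that column is
  hidden, so the product of all such terms takes the form required by
  \<open>box_bias\<close>.\<close>

lemma polynomial_bias:
  assumes p: "0 < p" "p < 1" and q: "q > 0" and J: "finite J" and M: "finite M"
    and \<rho>: "0 \<le> \<rho>" "\<rho> < 1"
      "\<And>x. \<not> int q dvd x \<Longrightarrow> (norm (of_real (1 - p) + of_real p * zchar q x))\<^sup>2 \<le> \<rho>"
    and e: "inj_on (\<lambda>(j, t). e j t) (J \<times> {..d})" "\<And>j t. j \<in> J \<Longrightarrow> t \<le> d \<Longrightarrow> e j t \<in> M"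
    and top: "\<And>j. j \<in> J \<Longrightarrow> \<not> int q dvd w (e j ` {..d})"
    and low: "\<And>U. U \<subseteq> M \<Longrightarrow> \<not> int q dvd w U \<Longrightarrow>
      (\<exists>j\<in>J. U = e j ` {..d}) \<or> (\<exists>t\<le>d. U \<inter> (\<lambda>j. e j t) ` J = {})"
  shows "norm (avg p M (\<lambda>S. zchar q (\<Sum>U\<in>Pow S. w U))) ^ (2 ^ Suc d) \<le> box_const p \<rho> d ^ card J"
proof -
  define T where "T t = (\<lambda>j. e j t) ` J" for t
  define M1 where "M1 = (\<Union>t\<le>d. T t)"
  define M2 where "M2 = M - M1"
  define E where "E j = e j ` {..d}" for j
  define Low where "Low = {U \<in> Pow M. U \<notin> E ` J \<and> \<not> int q dvd w U}"
  \<comment> \<open>A term may miss several columns; choosing one assigns it to exactly one factor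
    \<open>g t\<close>.\<close>
  define \<tau> where "\<tau> U = (SOME t. t \<le> d \<and> U \<inter> T t = {})" for U
  have p': "0 \<le> p" "p \<le> 1" using p by auto
  have einj: "e j t = e j' t' \<longleftrightarrow> j = j' \<and> t = t'" if "j \<in> J" "j' \<in> J" "t \<le> d" "t' \<le> d" for j j' t t'
    using inj_onD[OF e(1), of "(j, t)" "(j', t')"] that by auto
  have M1: "M1 \<subseteq> M" "finite M1" "finite M2" "M2 \<union> M1 = M" "M2 \<inter> M1 = {}"
    using e(2) J M by (auto simp: M1_def T_def M2_def)
  have EM: "E j \<subseteq> M1" if "j \<in> J" for j using that by (auto simp: E_def M1_def T_def)
  have injE: "inj_on E J"
  proof (rule inj_onI)
    fix i j assume ij: "i \<in> J" "j \<in> J" "E i = E j"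
    then have "e i 0 \<in> E j" by (auto simp: E_def)
    then show "i = j" using ij einj by (auto simp: E_def)
  qed
  have \<tau>: "\<tau> U \<le> d \<and> U \<inter> T (\<tau> U) = {}" if "U \<in> Low" for U
  proof -
    have "\<exists>t. t \<le> d \<and> U \<inter> T t = {}"
      using low[of U] that by (auto simp: Low_def E_def T_def)
    then show ?thesis unfolding \<tau>_def by (rule someI_ex)
  qed
  have finLow: "finite Low" using M by (auto simp: Low_def)
  have main: "norm (avg p M1 (\<lambda>S. zchar q (\<Sum>U\<in>Pow (R \<union> S). w U))) ^ (2 ^ Suc d) \<le> box_const p \<rho> d ^ card J"
    if R: "R \<subseteq> M2" for R
  proof -
    define g where "g t S = (\<Prod>U\<in>{U\<in>Low. \<tau> U = t}. zchar q (w U * of_bool (U \<subseteq> R \<union> S)))" for t S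
    have "zchar q (\<Sum>U\<in>Pow (R \<union> S). w U) = zchar q (\<Sum>j\<in>J. w (E j) * of_bool (\<forall>t\<le>d. e j t \<in> S)) * (\<Prod>t\<le>d. g t S)"
      if S: "S \<subseteq> M1" for S
    proof -
      let ?f = "\<lambda>U. w U * of_bool (U \<subseteq> R \<union> S)"
      have sub: "R \<union> S \<subseteq> M" using S R M1 by auto
      have "(\<Sum>U\<in>Pow (R \<union> S). w U) = (\<Sum>U\<in>Pow M. ?f U)"
        using M sub by (intro sum.mono_neutral_cong_left) auto
      then have "zchar q (\<Sum>U\<in>Pow (R \<union> S). w U) = (\<Prod>U\<in>Pow M. zchar q (?f U))"
        by (simp add: zchar_sum)
      also have "\<dots> = (\<Prod>U\<in>E ` J \<union> Low. zchar q (?f U))"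
      proof (intro prod.mono_neutral_right)
        show "E ` J \<union> Low \<subseteq> Pow M" using EM M1 by (auto simp: Low_def)
        show "\<forall>i\<in>Pow M - (E ` J \<union> Low). zchar q (?f i) = 1"
          using q by (auto simp: Low_def zchar_eq_1)
      qed (use M in auto)
      also have "\<dots> = (\<Prod>U\<in>E ` J. zchar q (?f U)) * (\<Prod>U\<in>Low. zchar q (?f U))"
        using J finLow by (intro prod.union_disjoint) (auto simp: Low_def)
      also have "(\<Prod>U\<in>E ` J. zchar q (?f U)) = (\<Prod>j\<in>J. zchar q (w (E j) * of_bool (\<forall>t\<le>d. e j t \<in> S)))"
        unfolding prod.reindex[OF injE] o_def
      proof (intro prod.cong refl)
        fix j assume j: "j \<in> J"
        have "E j \<subseteq> R \<union> S \<longleftrightarrow> E j \<subseteq> S" using EM[OF j] R M1(5) by blast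
        then show "zchar q (w (E j) * of_bool (E j \<subseteq> R \<union> S)) = zchar q (w (E j) * of_bool (\<forall>t\<le>d. e j t \<in> S))"
          by (auto simp: E_def)
      qed
      also have "\<dots> = zchar q (\<Sum>j\<in>J. w (E j) * of_bool (\<forall>t\<le>d. e j t \<in> S))" by (simp add: zchar_sum)
      also have "(\<Prod>U\<in>Low. zchar q (?f U)) = (\<Prod>t\<le>d. g t S)"
        unfolding g_def using \<tau> finLow by (intro prod.group[symmetric]) auto
      finally show ?thesis .
    qed
    then have "avg p M1 (\<lambda>S. zchar q (\<Sum>U\<in>Pow (R \<union> S). w U))
      = avg p M1 (\<lambda>S. zchar q (\<Sum>j\<in>J. w (E j) * of_bool (\<forall>t\<le>d. e j t \<in> S)) * (\<Prod>t\<le>d. g t S))"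
      by (intro avg_cong)
    also have "norm \<dots> ^ (2 ^ Suc d) \<le> (\<Prod>j\<in>J. if int q dvd w (E j) then 1 else box_const p \<rho> d)"
      unfolding M1_def T_def
    proof (rule box_bias[where w = "\<lambda>j. w (E j)", OF p q J \<rho> e(1)])
      show "norm (g t S) \<le> 1" for t S
        unfolding g_def prod_norm[symmetric] by simp
      show "g t (S - (\<lambda>j. e j t) ` J) = g t S" for t S
        unfolding g_def
      proof (intro prod.cong refl)
        fix U assume "U \<in> {U \<in> Low. \<tau> U = t}"
        then have "U \<inter> T t = {}" using \<tau> by auto
        then have "U \<subseteq> R \<union> (S - (\<lambda>j. e j t) ` J) \<longleftrightarrow> U \<subseteq> R \<union> S" by (auto simp: T_def)
        then show "zchar q (w U * of_bool (U \<subseteq> R \<union> (S - (\<lambda>j. e j t) ` J))) = zchar q (w U * of_bool (U \<subseteq> R \<union> S))"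
          by simp
      qed
    qed
    also have "\<dots> = box_const p \<rho> d ^ card J" using top by (simp add: E_def)
    finally show ?thesis .
  qed
  have "norm (avg p M (\<lambda>S. zchar q (\<Sum>U\<in>Pow S. w U)))
     \<le> avg p M2 (\<lambda>R. norm (avg p M1 (\<lambda>S. zchar q (\<Sum>U\<in>Pow (R \<union> S). w U))))"
    unfolding M1(4)[symmetric] avg_union[OF M1(3,2,5)] by (rule norm_avg_le[OF p'])
  then have "norm (avg p M (\<lambda>S. zchar q (\<Sum>U\<in>Pow S. w U))) ^ (2 ^ Suc d)
     \<le> avg p M2 (\<lambda>R. norm (avg p M1 (\<lambda>S. zchar q (\<Sum>U\<in>Pow (R \<union> S). w U)))) ^ (2 ^ Suc d)"
    by (intro power_mono) auto
  also have "\<dots> \<le> avg p M2 (\<lambda>R. norm (avg p M1 (\<lambda>S. zchar q (\<Sum>U\<in>Pow (R \<union> S). w U))) ^ (2 ^ Suc d))"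
    by (intro avg_power_le[OF p' M1(3)]) auto
  also have "\<dots> \<le> avg p M2 (\<lambda>R. box_const p \<rho> d ^ card J)"
    by (intro avg_mono[OF p'] main)
  finally show ?thesis by (simp add: avg_const M1)
qed

section \<open>Exponentially small sequences\<close>

definition exp_small :: "(nat \<Rightarrow> real) \<Rightarrow> bool" where
  "exp_small f \<longleftrightarrow> (\<exists>c>0. \<exists>n0. \<forall>n\<ge>n0. f n \<le> 2 powr (- c * real n))"

text \<open>The constant is absorbed by halving the rate once \<open>n\<close> is large;
  \<open>max C 1\<close> in the proof keeps the logarithm meaningful when \<open>C\<close> is not
  positive.\<close>

lemma exp_smallI:
  assumes "c > 0" "\<And>n. n \<ge> n0 \<Longrightarrow> f n \<le> C * 2 powr (- c * real n)"
  shows "exp_small f"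
proof -
  define L where "L = log 2 (max C 1)"
  have C: "C \<le> 2 powr L" unfolding L_def by simp
  have "f n \<le> 2 powr (- (c / 2) * real n)" if n: "n \<ge> max n0 (nat \<lceil>2 * L / c\<rceil>)" for n
  proof -
    have "2 * L / c \<le> real n" using n by linarith
    then have "L \<le> c / 2 * real n" using assms(1) by (simp add: field_simps)
    have "f n \<le> C * 2 powr (- c * real n)" using assms(2) n by simp
    also have "\<dots> \<le> 2 powr L * 2 powr (- c * real n)" using C by (intro mult_right_mono) auto
    also have "\<dots> = 2 powr (L - c * real n)" by (simp flip: powr_add)
    also have "\<dots> \<le> 2 powr (- (c / 2) * real n)"
      using \<open>L \<le> c / 2 * real n\<close> by (intro powr_mono) auto
    finally show ?thesis .
  qed
  then show ?thesis unfolding exp_small_def using assms(1) half_gt_zero by blast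
qed

lemma exp_small_mono:
  assumes "exp_small g" "\<And>n. f n \<le> g n"
  shows "exp_small f"
  using assms unfolding exp_small_def by (meson order_trans)

lemma exp_small_cmult: "exp_small f \<Longrightarrow> C \<ge> 0 \<Longrightarrow> exp_small (\<lambda>n. C * f n)"
  unfolding exp_small_def[of f] by (auto intro!: exp_smallI mult_left_mono)

lemma exp_small_add:
  assumes "exp_small f" "exp_small g"
  shows "exp_small (\<lambda>n. f n + g n)"
proof -
  obtain c1 n1 where 1: "c1 > 0" "\<And>n. n \<ge> n1 \<Longrightarrow> f n \<le> 2 powr (- c1 * real n)"
    using assms(1) unfolding exp_small_def by blast
  obtain c2 n2 where 2: "c2 > 0" "\<And>n. n \<ge> n2 \<Longrightarrow> g n \<le> 2 powr (- c2 * real n)"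
    using assms(2) unfolding exp_small_def by blast
  show ?thesis
  proof (rule exp_smallI)
    show "min c1 c2 > 0" using 1 2 by simp
    fix n assume n: "n \<ge> max n1 n2"
    have "2 powr (- c1 * real n) \<le> 2 powr (- min c1 c2 * real n)"
         "2 powr (- c2 * real n) \<le> 2 powr (- min c1 c2 * real n)"
      by (auto intro!: powr_mono mult_right_mono)
    moreover have "f n \<le> 2 powr (- c1 * real n)" "g n \<le> 2 powr (- c2 * real n)"
      using 1(2)[of n] 2(2)[of n] n by auto
    ultimately show "f n + g n \<le> 2 * 2 powr (- min c1 c2 * real n)" by linarith
  qed
qed

lemma exp_small_0: "exp_small (\<lambda>_. 0)"
  by (rule exp_smallI[of 1 0 _ 0]) auto

lemma exp_small_sum: "(\<And>i. i \<in> I \<Longrightarrow> exp_small (f i)) \<Longrightarrow> exp_small (\<lambda>n. \<Sum>i\<in>I. f i n)"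
  by (induction I rule: infinite_finite_induct) (auto simp: exp_small_0 intro: exp_small_add)

text \<open>The number of blocks \<open>n div m\<close> is at least \<open>n / (2 * m)\<close> from
  \<open>2 * m\<close> on, and the \<open>N\<close>-th root only divides the rate by
  \<open>N\<close>.\<close>

lemma exp_small_root:
  fixes x :: "nat \<Rightarrow> real"
  assumes "0 \<le> \<kappa>" "\<kappa> < 1" "N > 0" "m > 0" "\<And>n. x n ^ N \<le> \<kappa> ^ (n div m)"
  shows "exp_small x"
proof -
  \<comment> \<open>The lower bound 1/2 keeps the logarithm finite when \<kappa> is 0.\<close>
  define l where "l = max \<kappa> (1/2)"
  define c where "c = - log 2 l / (2 * real m * real N)"
  have l: "0 < l" "l < 1" using assms by (auto simp: l_def)
  have "log 2 l < 0" using l by simp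
  then have c: "c > 0" unfolding c_def using assms by (intro divide_pos_pos) auto
  have "x n \<le> 2 powr (- c * real n)" if n: "n \<ge> 2 * m" for n
  proof -
    have "n < (n div m) * m + m" using assms(4) by (metis add.commute dividend_less_div_times)
    moreover have "2 * m div m \<le> n div m" using n by (rule div_le_mono)
    then have "1 * m \<le> n div m * m" using assms(4) by (intro mult_right_mono) auto
    ultimately have "n \<le> 2 * (n div m * m)" by linarith
    then have "n \<le> 2 * m * (n div m)" by (simp only: mult_ac)
    then have r: "real n / (2 * real m) \<le> real (n div m)"
      using assms(4) by (simp add: divide_simps mult.commute) (metis of_nat_le_iff of_nat_mult of_nat_numeral mult.assoc mult.commute)
    have "x n ^ N \<le> l ^ (n div m)"
      using assms(5)[of n] power_mono[of \<kappa> l "n div m"] assms(1) unfolding l_def by linarith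
    also have "\<dots> = l powr real (n div m)" using l by (simp add: powr_realpow)
    also have "\<dots> \<le> l powr (real n / (2 * real m))" using l r by (intro powr_mono') auto
    also have "\<dots> = (2 powr log 2 l) powr (real n / (2 * real m))" using l by simp
    also have "\<dots> = 2 powr (- c * real n * real N)" 
      unfolding powr_powr c_def using assms by (simp add: field_simps)
    also have "\<dots> = (2 powr (- c * real n)) powr real N" by (simp add: powr_powr)
    also have "\<dots> = (2 powr (- c * real n)) ^ N" by (simp add: powr_realpow)
    finally show ?thesis using assms(3) by (metis gr0_conv_Suc powr_ge_zero power_le_imp_le_base)
  qed
  then show ?thesis unfolding exp_small_def using c by blast
qed

section \<open>Weights on connected edge sets\<close>

text \<open>Connectivity through cuts instead of walks. Disjointness of \<open>V\<close> and
  \<open>W\<close> is implicit: a shared nonempty edge already makes the vertex sets meet.\<close>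

definition edge_connected :: "'a set set \<Rightarrow> bool" where
  "edge_connected U \<longleftrightarrow> U \<noteq> {} \<and>
     (\<forall>V W. U = V \<union> W \<longrightarrow> V \<noteq> {} \<longrightarrow> W \<noteq> {} \<longrightarrow> \<Union>V \<inter> \<Union>W \<noteq> {})"

text \<open>Invariance under injections lets a pattern be translated to fresh vertices without
  changing its weight. \<open>K\<close> bounds the degree of the associated polynomial in the edge
  indicators.\<close>

definition conn_weight :: "(nat set set \<Rightarrow> int) \<Rightarrow> nat \<Rightarrow> bool" where
  "conn_weight w K \<longleftrightarrow> (\<forall>\<sigma> U. inj \<sigma> \<longrightarrow> w ((`) \<sigma> ` U) = w U) \<and>
     (\<forall>U. w U \<noteq> 0 \<longrightarrow> edge_connected U \<and> finite U \<and> (\<forall>e\<in>U. card e = 2) \<and> card U \<le> K)"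

definition weighted_count :: "(nat set set \<Rightarrow> int) \<Rightarrow> nat set set \<Rightarrow> int" where
  "weighted_count w S = (\<Sum>U\<in>Pow S. w U)"

lemma finite_all_pairs [simp]: "finite (all_pairs n)"
  by (rule finite_subset[of _ "Pow {..<n}"]) (auto simp: all_pairs_def)

text \<open>The blocks are translates of an edge set \<open>U\<close> of maximal size among those
  with weight nonzero modulo \<open>q\<close>. By maximality, a set of nonzero weight that meets
  every column has exactly one edge in each; being connected, it cannot spread over several
  vertex-disjoint blocks, so it is a block. This is what \<open>polynomial_bias\<close>
  requires.\<close>

lemma conn_weight_bias:
  assumes p: "0 < p" "p < 1" and q: "q > 0" and w: "conn_weight w K" and U0: "\<not> int q dvd w U0"
  shows "exp_small (\<lambda>n. norm (avg p (all_pairs n) (\<lambda>S. zchar q (weighted_count w S))))"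
proof -
  obtain \<rho> where \<rho>: "0 \<le> \<rho>" "\<rho> < 1"
    "\<And>x. \<not> int q dvd x \<Longrightarrow> (norm (of_real (1 - p) + of_real p * zchar q x))\<^sup>2 \<le> \<rho>"
    using zchar_gap[OF p q] by blast
  have supp: "edge_connected V \<and> finite V \<and> (\<forall>e\<in>V. card e = 2) \<and> card V \<le> K" if "\<not> int q dvd w V" for V
    using w that unfolding conn_weight_def by (metis dvd_0_right)
  obtain U where U: "\<not> int q dvd w U" and Umax: "\<And>V. \<not> int q dvd w V \<Longrightarrow> card V \<le> card U"
    using ex_has_greatest_nat[of "\<lambda>V. \<not> int q dvd w V" U0 card "Suc K"] U0 supp by (metis le_imp_less_Suc)
  note sU = supp[OF U]
  obtain d where d: "card U = Suc d"
    using sU by (metis card_0_eq edge_connected_def not0_implies_Suc)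
  obtain b where b: "bij_betw b {..d} U"
    using finite_same_card_bij[of "{..d}" U] sU d by auto
  have "finite (\<Union>U)" using sU by (metis card.infinite finite_Union zero_neq_numeral)
  then obtain m0 where "\<forall>x\<in>\<Union>U. x \<le> m0" using finite_nat_set_iff_bounded_le by blast
  then obtain m where m: "m > 0" "\<And>x u. u \<in> U \<Longrightarrow> x \<in> u \<Longrightarrow> x < m"
    by (metis UnionI le_imp_less_Suc zero_less_Suc)
  \<comment> \<open>All vertices of \<open>U\<close> lie below \<open>m\<close>, so block
    \<open>j\<close> lives between \<open>j * m\<close> and \<open>(j + 1) * m\<close>, and
    \<open>x div m\<close> recovers it.\<close>
  define \<sigma> where "\<sigma> j = (\<lambda>x. x + j * m)" for j
  define e where "e j t = \<sigma> j ` b t" for j t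
  have inj\<sigma>: "inj (\<sigma> j)" for j by (auto simp: \<sigma>_def)
  have bU: "b t \<in> U" if "t \<le> d" for t using b that by (auto simp: bij_betw_def)
  have blk: "x div m = j" if "x \<in> e j t" "t \<le> d" for x j t
    using that m bU[of t] by (auto simp: e_def \<sigma>_def)
  have ne: "e j t \<noteq> {}" if "t \<le> d" for j t
    using sU bU[OF that] by (auto simp: e_def)
  have einj: "j = j' \<and> t = t'" if "e j t = e j' t'" "t \<le> d" "t' \<le> d" for j j' t t'
  proof -
    have j: "j = j'" using that ne[of t j] blk by (metis ex_in_conv)
    then have "b t = b t'" using that(1) inj\<sigma> by (simp add: e_def inj_image_eq_iff)
    then show ?thesis using b that j by (auto simp: bij_betw_def inj_on_def)
  qed
  have eU: "e j ` {..d} = (`) (\<sigma> j) ` U" for j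
    using b by (auto simp: e_def bij_betw_def)
  show ?thesis
  proof (rule exp_small_root)
    fix n
    let ?J = "{..<n div m}"
    show "norm (avg p (all_pairs n) (\<lambda>S. zchar q (weighted_count w S))) ^ (2 ^ Suc d) \<le> box_const p \<rho> d ^ (n div m)"
      unfolding weighted_count_def
    proof (subst card_lessThan[symmetric], rule polynomial_bias[where e = e, OF p q _ _ \<rho>])
      show "inj_on (\<lambda>(j, t). e j t) (?J \<times> {..d})" using einj by (auto simp: inj_on_def)
      show "e j t \<in> all_pairs n" if "j \<in> ?J" "t \<le> d" for j t
      proof -
        have "Suc j * m \<le> n div m * m" using that by (intro mult_right_mono) auto
        also have "\<dots> \<le> n" by simp
        finally have "x + j * m < n" if "x < m" for x using that by simp
        moreover have "card (e j t) = 2"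
          unfolding e_def using sU bU[OF that(2)] inj\<sigma>[of j] by (simp add: card_image inj_on_def)
        ultimately show ?thesis using m(2) bU[OF that(2)] by (auto simp: all_pairs_def e_def \<sigma>_def)
      qed
      show "\<not> int q dvd w (e j ` {..d})" for j
        unfolding eU using w U inj\<sigma> by (simp add: conn_weight_def)
      show "(\<exists>j\<in>?J. V = e j ` {..d}) \<or> (\<exists>t\<le>d. V \<inter> (\<lambda>j. e j t) ` ?J = {})" if V: "\<not> int q dvd w V" for V
      proof (rule ccontr)
        assume *: "\<not> ?thesis"
        then have "\<forall>t\<in>{..d}. \<exists>j. j \<in> ?J \<and> e j t \<in> V" by auto
        then obtain \<phi> where \<phi>: "\<And>t. t \<le> d \<Longrightarrow> \<phi> t \<in> ?J \<and> e (\<phi> t) t \<in> V" by (metis atMost_iff)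
        define v where "v t = e (\<phi> t) t" for t
        have vinj: "inj_on v {..d}" using einj by (auto simp: inj_on_def v_def)
        have "card (v ` {..d}) = Suc d" using card_image[OF vinj] by simp
        then have "v ` {..d} = V"
          using \<phi> Umax[OF V] supp[OF V] d by (intro card_seteq) (auto simp: v_def)
        \<comment> \<open>\<open>V1\<close> collects the edges of \<open>V\<close> in the block of
          its column-0 edge; blocks have disjoint vertex sets, so connectedness leaves nothing for
          \<open>V2\<close>.\<close>
        define V1 where "V1 = {x \<in> V. \<exists>t\<le>d. x = e (\<phi> 0) t}"
        define V2 where "V2 = V - V1"
        have "\<Union>V1 \<inter> \<Union>V2 = {}"
        proof -
          have False if x: "x \<in> y" "y \<in> V1" "x \<in> z" "z \<in> V2" for x y z
          proof -
            obtain t where t: "t \<le> d" "z = e (\<phi> t) t"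
              using x \<open>v ` {..d} = V\<close> by (auto simp: V2_def v_def)
            have "x div m = \<phi> 0" using x blk by (auto simp: V1_def)
            moreover have "x div m = \<phi> t" using x t blk by auto
            ultimately show False using x t by (auto simp: V2_def V1_def)
          qed
          then show ?thesis by blast
        qed
        moreover have "V = V1 \<union> V2" "V1 \<noteq> {}" using \<phi>[of 0] by (auto simp: V1_def V2_def)
        ultimately have "V2 = {}" using supp[OF V] unfolding edge_connected_def by blast
        then have "V \<subseteq> e (\<phi> 0) ` {..d}" by (auto simp: V1_def V2_def)
        moreover have "card (e (\<phi> 0) ` {..d}) \<le> card V"
          using card_image_le[of "{..d}" "e (\<phi> 0)"] card_image[OF vinj] \<open>v ` {..d} = V\<close> by simp
        ultimately have "V = e (\<phi> 0) ` {..d}" by (intro card_seteq) auto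
        then show False using * \<phi>[of 0] by auto
      qed
    qed auto
  qed (use box_const_bounds[OF p \<rho>(1,2)] m in auto)
qed

section \<open>The algebra spanned by characters of connected counts\<close>

lemma weighted_count_add: "weighted_count (\<lambda>U. v U + w U) S = weighted_count v S + weighted_count w S"
  by (simp add: weighted_count_def sum.distrib)

lemma weighted_count_cmult: "weighted_count (\<lambda>U. a * w U) S = a * weighted_count w S"
  by (simp add: weighted_count_def sum_distrib_left)

lemma conn_weight_add: "conn_weight v K \<Longrightarrow> conn_weight w K \<Longrightarrow> conn_weight (\<lambda>U. v U + w U) K"
  unfolding conn_weight_def by (metis add.right_neutral)

lemma conn_weight_cmult: "conn_weight w K \<Longrightarrow> conn_weight (\<lambda>U. a * w U) K"
  unfolding conn_weight_def by auto

lemma conn_weight_mono: "conn_weight w K \<Longrightarrow> K \<le> L \<Longrightarrow> conn_weight w L"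
  unfolding conn_weight_def by (meson order_trans)

text \<open>A product of characters is the character of the sum of the weights, so this span is
  closed under multiplication. Rule \<open>eq\<close> is included because the cluster identities are
  available for finite \<open>S\<close> only.\<close>

inductive_set character_span :: "nat \<Rightarrow> nat \<Rightarrow> (nat set set \<Rightarrow> complex) set" for q K where
  char: "conn_weight w K \<Longrightarrow> (\<lambda>S. zchar q (weighted_count w S)) \<in> character_span q K"
| add: "f \<in> character_span q K \<Longrightarrow> g \<in> character_span q K \<Longrightarrow> (\<lambda>S. f S + g S) \<in> character_span q K"
| scale: "f \<in> character_span q K \<Longrightarrow> (\<lambda>S. c * f S) \<in> character_span q K"
| eq: "f \<in> character_span q K \<Longrightarrow> (\<And>S. finite S \<Longrightarrow> f S = g S) \<Longrightarrow> g \<in> character_span q K"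

lemma character_span_const: "(\<lambda>S. c) \<in> character_span q K"
proof -
  have "conn_weight (\<lambda>_. 0) K" by (simp add: conn_weight_def)
  from character_span.scale[OF character_span.char[OF this], of c q]
  show ?thesis by (simp add: weighted_count_def)
qed

lemma character_span_sum:
  "(\<And>i. i \<in> I \<Longrightarrow> f i \<in> character_span q K) \<Longrightarrow> (\<lambda>S. \<Sum>i\<in>I. f i S) \<in> character_span q K"
  by (induction I rule: infinite_finite_induct) (auto simp: character_span_const intro: character_span.add)

lemma character_span_mult:
  assumes "f \<in> character_span q K" "g \<in> character_span q K"
  shows "(\<lambda>S. f S * g S) \<in> character_span q K"
  using assms(1)
proof induction
  case (char w)
  show ?case using assms(2)
  proof induction
    case (char v)
    with \<open>conn_weight w K\<close> show ?case
      using character_span.char[OF conn_weight_add[of w K v]] by (simp add: weighted_count_add zchar_add)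
  next
    case (add f g)
    from character_span.add[OF add.IH] show ?case by (simp add: ring_distribs)
  next
    case (scale f c)
    from character_span.scale[OF scale.IH, of c] show ?case by (simp add: mult_ac)
  next
    case (eq f g)
    show ?case by (rule character_span.eq[OF eq.IH]) (use eq in auto)
  qed
next
  case (add f g)
  from character_span.add[OF add.IH] show ?case by (simp add: ring_distribs)
next
  case (scale f c)
  from character_span.scale[OF scale.IH, of c] show ?case by (simp add: mult_ac)
next
  case (eq f g)
  show ?case by (rule character_span.eq[OF eq.IH]) (use eq in auto)
qed

text \<open>The residue of \<open>X\<close> modulo \<open>q\<close> is determined by weighted counts of connected edge sets
  with at most \<open>K\<close> edges.\<close>
definition residue_spanned :: "nat \<Rightarrow> nat \<Rightarrow> (nat set set \<Rightarrow> int) \<Rightarrow> bool" where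
  "residue_spanned q K X \<longleftrightarrow> (\<forall>v. (\<lambda>S. of_bool (int q dvd X S - v)) \<in> character_span q K)"

lemma sum_residue_indicator:
  fixes F :: "int \<Rightarrow> 'a::comm_semiring_1"
  assumes "q > 0"
  shows "(\<Sum>u<q. of_bool (int q dvd x - int u) * F (int u)) = F (x mod int q)"
proof -
  have "int q dvd x - int u \<longleftrightarrow> u = nat (x mod int q)" if "u < q" for u
  proof -
    have "int q dvd x - int u \<longleftrightarrow> x mod int q = int u mod int q" by (simp add: mod_eq_dvd_iff)
    also have "\<dots> \<longleftrightarrow> x mod int q = int u" using that by simp
    also have "\<dots> \<longleftrightarrow> u = nat (x mod int q)" using assms by (auto simp: nat_eq_iff)
    finally show ?thesis .
  qed
  then have "(\<Sum>u<q. of_bool (int q dvd x - int u) * F (int u)) = (\<Sum>u<q. if u = nat (x mod int q) then F (int u) else 0)"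
    by (intro sum.cong) auto
  also have "\<dots> = F (int (nat (x mod int q)))"
    using assms by (subst sum.delta) (auto simp: nat_less_iff)
  finally show ?thesis using assms by simp
qed

text \<open>Fourier inversion on the integers modulo \<open>q\<close>: every character in the
  expansion of the indicator is that of a connected weight \<open>int a * w U\<close>.\<close>

lemma residue_spanned_weight:
  assumes "q > 0" "conn_weight w K"
  shows "residue_spanned q K (weighted_count w)"
  unfolding residue_spanned_def
proof
  fix v
  have "(\<lambda>S. \<Sum>a<q. (zchar q (int a * - v) / of_nat q) * zchar q (weighted_count (\<lambda>U. int a * w U) S)) \<in> character_span q K"
    using assms(2) by (intro character_span_sum character_span.scale character_span.char conn_weight_cmult)
  also have "(\<lambda>S. \<Sum>a<q. (zchar q (int a * - v) / of_nat q) * zchar q (weighted_count (\<lambda>U. int a * w U) S))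
     = (\<lambda>S. of_bool (int q dvd weighted_count w S - v))"
  proof
    fix S
    have "(\<Sum>a<q. (zchar q (int a * - v) / of_nat q) * zchar q (weighted_count (\<lambda>U. int a * w U) S))
      = (\<Sum>a<q. zchar q (int a * (weighted_count w S - v))) / of_nat q"
      unfolding sum_divide_distrib weighted_count_cmult right_diff_distrib
      by (simp add: mult.commute flip: zchar_add)
    then show "(\<Sum>a<q. (zchar q (int a * - v) / of_nat q) * zchar q (weighted_count (\<lambda>U. int a * w U) S))
      = of_bool (int q dvd weighted_count w S - v)"
      using assms(1) by (simp only: zchar_orthogonal) simp
  qed
  finally show "(\<lambda>S. of_bool (int q dvd weighted_count w S - v)) \<in> character_span q K" .
qed

text \<open>This is where nonlinearity is removed: the indicator of a residue of
  \<open>h (X S) (Y S)\<close> is summed over all pairs of residues of the arguments, and each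
  summand is a product of indicators in the span.\<close>

lemma residue_spanned_comb:
  assumes "q > 0" "residue_spanned q K X" "residue_spanned q K Y"
    and h: "\<And>x y. h x y mod int q = h (x mod int q) (y mod int q) mod int q"
  shows "residue_spanned q K (\<lambda>S. h (X S) (Y S))"
  unfolding residue_spanned_def
proof
  fix v
  let ?f = "\<lambda>S. \<Sum>u<q. \<Sum>u'<q. of_bool (int q dvd X S - int u) *
    (of_bool (int q dvd Y S - int u') * of_bool (int q dvd h (int u) (int u') - v)) :: complex"
  have "?f \<in> character_span q K"
    using assms(2,3) unfolding residue_spanned_def
    by (intro character_span_sum character_span_mult character_span_const) auto
  also have "?f = (\<lambda>S. of_bool (int q dvd h (X S) (Y S) - v))"
  proof
    fix S
    have "?f S = (\<Sum>u<q. of_bool (int q dvd X S - int u) *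
      (\<Sum>u'<q. of_bool (int q dvd Y S - int u') * of_bool (int q dvd h (int u) (int u') - v)))"
      by (simp only: sum_distrib_left)
    also have "\<dots> = (\<Sum>u<q. of_bool (int q dvd X S - int u) * of_bool (int q dvd h (int u) (Y S mod int q) - v))"
      by (intro sum.cong refl arg_cong2[where f = "(*)"] sum_residue_indicator[OF assms(1)])
    also have "\<dots> = of_bool (int q dvd h (X S mod int q) (Y S mod int q) - v)"
      by (rule sum_residue_indicator[OF assms(1)])
    also have "\<dots> = of_bool (int q dvd h (X S) (Y S) - v)"
      using h[of "X S" "Y S"] by (simp flip: mod_eq_dvd_iff)
    finally show "?f S = of_bool (int q dvd h (X S) (Y S) - v)" .
  qed
  finally show "(\<lambda>S. of_bool (int q dvd h (X S) (Y S) - v)) \<in> character_span q K" .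
qed

lemma residue_spanned_add:
  "q > 0 \<Longrightarrow> residue_spanned q K X \<Longrightarrow> residue_spanned q K Y \<Longrightarrow> residue_spanned q K (\<lambda>S. X S + Y S)"
  using residue_spanned_comb[of q K X Y "(+)"] by (simp add: mod_add_eq)

lemma residue_spanned_mult:
  "q > 0 \<Longrightarrow> residue_spanned q K X \<Longrightarrow> residue_spanned q K Y \<Longrightarrow> residue_spanned q K (\<lambda>S. X S * Y S)"
  using residue_spanned_comb[of q K X Y "(*)"] by (simp add: mod_mult_eq)

lemma residue_spanned_const: "residue_spanned q K (\<lambda>S. c)"
  by (simp add: residue_spanned_def character_span_const)

lemma residue_spanned_sum:
  "q > 0 \<Longrightarrow> (\<And>i. i \<in> I \<Longrightarrow> residue_spanned q K (X i)) \<Longrightarrow> residue_spanned q K (\<lambda>S. \<Sum>i\<in>I. X i S)"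
  by (induction I rule: infinite_finite_induct) (auto simp: residue_spanned_const intro: residue_spanned_add)

lemma residue_spanned_eq:
  assumes "residue_spanned q K X" "\<And>S. finite S \<Longrightarrow> X S = Y S"
  shows "residue_spanned q K Y"
  unfolding residue_spanned_def
proof
  fix v
  show "(\<lambda>S. of_bool (int q dvd Y S - v)) \<in> character_span q K"
    by (rule character_span.eq[of "\<lambda>S. of_bool (int q dvd X S - v)"])
      (use assms in \<open>auto simp: residue_spanned_def\<close>)
qed

lemma zchar_residue_spanned:
  assumes "q > 0" "residue_spanned q K X"
  shows "(\<lambda>S. zchar q (a * X S)) \<in> character_span q K"
proof -
  have "(\<lambda>S. \<Sum>u<q. zchar q (a * int u) * of_bool (int q dvd X S - int u)) \<in> character_span q K"
    using assms(2) unfolding residue_spanned_def by (intro character_span_sum character_span.scale) auto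
  also have "(\<lambda>S. \<Sum>u<q. zchar q (a * int u) * of_bool (int q dvd X S - int u)) = (\<lambda>S. zchar q (a * X S))"
  proof
    fix S
    have "zchar q (a * (X S mod int q)) = zchar q (a * X S)"
      using assms(1) by (intro zchar_cong) (simp_all add: mod_mult_right_eq)
    then show "(\<Sum>u<q. zchar q (a * int u) * of_bool (int q dvd X S - int u)) = zchar q (a * X S)"
      using sum_residue_indicator[OF assms(1), where F = "\<lambda>u. zchar q (a * u)"] by (simp add: mult.commute)
  qed
  finally show ?thesis .
qed

text \<open>A character of degree at most \<open>K\<close> merely adds its weight \<open>v\<close>
  to \<open>w\<close>. At \<open>U0\<close>, which has more than \<open>K\<close> edges,
  \<open>v\<close> vanishes, so the sum is still nonzero modulo \<open>q\<close>; linearity does the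
  rest.\<close>

lemma character_span_bias:
  assumes p: "0 < p" "p < 1" and q: "q > 0" and w: "conn_weight w L" and U0: "\<not> int q dvd w U0"
    and K: "K < card U0" "K \<le> L" and f: "f \<in> character_span q K"
  shows "exp_small (\<lambda>n. norm (avg p (all_pairs n) (\<lambda>S. zchar q (weighted_count w S) * f S)))"
  using f
proof induction
  case (char v)
  have "v U0 = 0" using char K by (auto simp: conn_weight_def)
  then have nd: "\<not> int q dvd w U0 + v U0" using U0 by simp
  have "conn_weight (\<lambda>U. w U + v U) L"
    using w conn_weight_mono[OF char K(2)] by (rule conn_weight_add)
  from conn_weight_bias[OF p q this nd] show ?case by (simp add: weighted_count_add zchar_add)
next
  case (add f g)
  show ?case
    by (rule exp_small_mono[OF exp_small_add[OF add.IH]]) (simp add: ring_distribs avg_add norm_triangle_ineq)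
next
  case (scale f c)
  show ?case
    using exp_small_cmult[OF scale.IH, of "norm c"] 
    by (simp add: mult.left_commute[of _ c] avg_mult_left norm_mult)
next
  case (eq f g)
  have "avg p (all_pairs n) (\<lambda>S. zchar q (weighted_count w S) * f S)
      = avg p (all_pairs n) (\<lambda>S. zchar q (weighted_count w S) * g S)" for n
    using eq.hyps by (intro avg_cong) (metis finite_all_pairs finite_subset)
  then show ?case using eq.IH by simp
qed

section \<open>From biases to total variation distance\<close>

lemma expectation_random_subset:
  assumes "0 \<le> p" "p \<le> 1" "finite A"
  shows "measure_pmf.expectation (Pi_pmf A False (\<lambda>_. bernoulli_pmf p)) (\<lambda>f. h {e \<in> A. f e}) = avg p A (h :: _ \<Rightarrow> real)"
proof -
  let ?P = "Pi_pmf A False (\<lambda>_. bernoulli_pmf p)"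
  let ?i = "\<lambda>S e. e \<in> S"
  \<comment> \<open>Outside \<open>A\<close> the product measure takes the default value
    \<open>False\<close>, so its support corresponds to subsets of \<open>A\<close>.\<close>
  have "f \<in> ?i ` Pow A" if "f \<in> set_pmf ?P" for f
  proof -
    have "{e. f e} \<subseteq> A" using that set_Pi_pmf_subset[OF assms(3), of False "\<lambda>_. bernoulli_pmf p"] by auto
    then show ?thesis by (intro image_eqI[of _ _ "{e. f e}"]) auto
  qed
  then have "measure_pmf.expectation ?P (\<lambda>f. h {e \<in> A. f e}) = (\<Sum>f\<in>?i ` Pow A. h {e \<in> A. f e} * pmf ?P f)"
    using assms(3) by (intro integral_measure_pmf_real) auto
  also have "\<dots> = (\<Sum>S\<in>Pow A. h {e \<in> A. e \<in> S} * pmf ?P (?i S))"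
    by (subst sum.reindex) (auto simp: inj_on_def set_eq_iff fun_eq_iff)
  also have "\<dots> = avg p A h"
    unfolding avg_def
  proof (intro sum.cong refl)
    fix S assume S: "S \<in> Pow A"
    have "pmf ?P (?i S) = subset_weight p A S"
      unfolding subset_weight_def using S assms by (subst pmf_Pi') (auto intro!: prod.cong)
    moreover have "{e \<in> A. e \<in> S} = S" using S by auto
    ultimately show "h {e \<in> A. e \<in> S} * pmf ?P (?i S) = subset_weight p A S *\<^sub>R h S" by simp
  qed
  finally show ?thesis .
qed

lemma pmf_map_Gnp:
  assumes "0 \<le> p" "p \<le> 1"
  shows "pmf (map_pmf N (Gnp n p)) r = avg p (all_pairs n) (\<lambda>S. of_bool (N ({..<n}, S) = r))"
proof -
  let ?P = "Pi_pmf (all_pairs n) False (\<lambda>_. bernoulli_pmf p)"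
  have "pmf (map_pmf N (Gnp n p)) r = measure_pmf.prob ?P {f. N ({..<n}, {e \<in> all_pairs n. f e}) = r}"
    by (simp add: Gnp_def pmf.map_comp o_def pmf_map vimage_def)
  also have "\<dots> = measure_pmf.expectation ?P (indicator {f. N ({..<n}, {e \<in> all_pairs n. f e}) = r})"
    by simp
  also have "\<dots> = measure_pmf.expectation ?P (\<lambda>f. (\<lambda>S. of_bool (N ({..<n}, S) = r)) {e \<in> all_pairs n. f e})"
    by (intro Bochner_Integration.integral_cong) (auto simp: indicator_def)
  also have "\<dots> = avg p (all_pairs n) (\<lambda>S. of_bool (N ({..<n}, S) = r))"
    using assms by (intro expectation_random_subset) auto
  finally show ?thesis .
qed

text \<open>Fourier inversion: frequency 0 contributes exactly \<open>1 / q\<close> to each residue,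
  and the deviation is at most the sum of the biases at the other frequencies, divided by
  \<open>q\<close>.\<close>

lemma tv_exp_small:
  fixes N :: "nat ugraph \<Rightarrow> nat"
  assumes p: "0 < p" "p < 1" and q: "q > 1"
    and bias: "\<And>a. 0 < a \<Longrightarrow> a < q \<Longrightarrow>
      exp_small (\<lambda>n. norm (avg p (all_pairs n) (\<lambda>S. zchar q (int a * int (N ({..<n}, S))))))"
  shows "exp_small (\<lambda>n. tv_from_uniform (map_pmf (\<lambda>Gr. N Gr mod q) (Gnp n p)) q)"
proof -
  define B where "B a n = avg p (all_pairs n) (\<lambda>S. zchar q (int a * int (N ({..<n}, S))))" for a n
  let ?X = "\<lambda>n. map_pmf (\<lambda>Gr. N Gr mod q) (Gnp n p)"
  have "\<bar>pmf (?X n) r - 1 / real q\<bar> \<le> (\<Sum>a\<in>{1..<q}. norm (B a n)) / real q" if r: "r < q" for r n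
  proof -
    have ind: "complex_of_real (of_bool (N ({..<n}, S) mod q = r))
       = (\<Sum>a<q. (zchar q (int a * - int r) / of_nat q) * zchar q (int a * int (N ({..<n}, S))))" for S
    proof -
      have "N ({..<n}, S) mod q = r \<longleftrightarrow> int (N ({..<n}, S)) mod int q = int r mod int q"
        using r by (metis mod_less of_nat_eq_iff zmod_int)
      also have "\<dots> \<longleftrightarrow> int q dvd int (N ({..<n}, S)) - int r" by (rule mod_eq_dvd_iff)
      finally have "complex_of_real (of_bool (N ({..<n}, S) mod q = r)) = 
         (\<Sum>a<q. zchar q (int a * (int (N ({..<n}, S)) - int r))) / of_nat q"
        using q by (simp add: zchar_orthogonal)
      then show ?thesis
        unfolding sum_divide_distrib right_diff_distrib by (simp add: mult.commute flip: zchar_add)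
    qed
    have "complex_of_real (pmf (?X n) r) = (\<Sum>a<q. (zchar q (int a * - int r) / of_nat q) * B a n)"
      using p by (simp only: pmf_map_Gnp less_imp_le avg_of_real ind avg_sum avg_mult_left B_def)
    also have "\<dots> = 1 / of_nat q + (\<Sum>a\<in>{1..<q}. (zchar q (int a * - int r) / of_nat q) * B a n)"
    proof -
      have "B 0 n = 1" by (simp add: B_def avg_const)
      moreover have "{..<q} = insert 0 {1..<q}" using q by auto
      ultimately show ?thesis by simp
    qed
    finally have cr: "complex_of_real (pmf (?X n) r - 1 / real q) = (\<Sum>a\<in>{1..<q}. (zchar q (int a * - int r) / of_nat q) * B a n)"
      by simp
    have "\<bar>pmf (?X n) r - 1 / real q\<bar> = norm (\<Sum>a\<in>{1..<q}. (zchar q (int a * - int r) / of_nat q) * B a n)"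
      using arg_cong[OF cr, where f = norm] unfolding norm_of_real .
    also have "\<dots> \<le> (\<Sum>a\<in>{1..<q}. norm ((zchar q (int a * - int r) / of_nat q) * B a n))"
      by (rule norm_sum)
    also have "\<dots> = (\<Sum>a\<in>{1..<q}. norm (B a n)) / real q"
      by (simp add: norm_mult norm_divide sum_divide_distrib)
    finally show ?thesis .
  qed
  then have "(\<Sum>r<q. \<bar>pmf (?X n) r - 1 / real q\<bar>) \<le> (\<Sum>r<q. (\<Sum>a\<in>{1..<q}. norm (B a n)) / real q)" for n
    by (intro sum_mono) auto
  moreover have "measure_pmf.prob (?X n) {r. r \<ge> q} = 0" for n
    using q by (auto simp: measure_pmf_zero_iff) (metis gr_implies_not0 mod_less_divisor not_le zero_less_iff_neq_zero)
  ultimately have "tv_from_uniform (?X n) q \<le> 1 / 2 * (\<Sum>a\<in>{1..<q}. norm (B a n))" for n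
    using q by (simp add: tv_from_uniform_def)
  moreover have "exp_small (\<lambda>n. 1 / 2 * (\<Sum>a\<in>{1..<q}. norm (B a n)))"
    unfolding B_def using bias by (intro exp_small_cmult exp_small_sum) auto
  ultimately show ?thesis by (rule exp_small_mono[rotated])
qed

section \<open>Cluster expansion\<close>

definition no_edges :: "('i \<Rightarrow> 'i \<Rightarrow> bool) \<Rightarrow> 'i set \<Rightarrow> int" where
  "no_edges R B = of_bool (\<forall>i\<in>B. \<forall>j\<in>B. i \<noteq> j \<longrightarrow> \<not> R i j)"

text \<open>The Ursell function $\sum_F (-1)^{|F|}$ over the connected spanning edge sets $F$ of the graph
  \<open>R\<close> on \<open>B\<close>, defined by the recursion that it satisfies.\<close>
function ursell :: "(nat \<Rightarrow> nat \<Rightarrow> bool) \<Rightarrow> nat set \<Rightarrow> int" where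
  "ursell R B = (if finite B \<and> B \<noteq> {} then
     no_edges R B - (\<Sum>A\<in>{A. A \<subset> B \<and> Min B \<in> A}. ursell R A * no_edges R (B - A)) else 0)"
  by auto
termination by (relation "Wellfounded.measure (\<lambda>(R, B). card B)") (auto intro: psubset_card_mono)

declare ursell.simps [simp del]

lemma no_edges_empty [simp]: "no_edges R {} = 1"
  by (simp add: no_edges_def)

lemma no_edges_cong: "(\<And>i j. i \<in> B \<Longrightarrow> j \<in> B \<Longrightarrow> R i j = R' i j) \<Longrightarrow> no_edges R B = no_edges R' B"
  by (simp add: no_edges_def)

lemma no_edges_Un:
  "(\<And>x y. x \<in> X \<Longrightarrow> y \<in> Y \<Longrightarrow> \<not> R x y \<and> \<not> R y x) \<Longrightarrow> no_edges R (X \<union> Y) = no_edges R X * no_edges R Y"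
  by (auto simp: no_edges_def)

text \<open>The recursion defining \<open>ursell\<close>, with the term \<open>A = B\<close> moved
  to the other side. Anchoring \<open>A\<close> at \<open>Min B\<close> singles out one cluster
  canonically.\<close>

lemma no_edges_expand:
  assumes "finite B" "B \<noteq> {}"
  shows "no_edges R B = (\<Sum>A\<in>{A. A \<subseteq> B \<and> Min B \<in> A}. ursell R A * no_edges R (B - A))"
proof -
  have "{A. A \<subseteq> B \<and> Min B \<in> A} = insert B {A. A \<subset> B \<and> Min B \<in> A}"
    using Min_in[OF assms] by auto
  moreover have "finite {A. A \<subset> B \<and> Min B \<in> A}"
    by (rule finite_subset[of _ "Pow B"]) (use assms in auto)
  ultimately have "(\<Sum>A\<in>{A. A \<subseteq> B \<and> Min B \<in> A}. ursell R A * no_edges R (B - A))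
     = ursell R B + (\<Sum>A\<in>{A. A \<subset> B \<and> Min B \<in> A}. ursell R A * no_edges R (B - A))"
    by simp
  then show ?thesis using assms by (simp add: ursell.simps[of R B])
qed

lemma ursell_cong:
  assumes "finite B" "\<And>i j. i \<in> B \<Longrightarrow> j \<in> B \<Longrightarrow> R i j = R' i j"
  shows "ursell R B = ursell R' B"
  using assms
proof (induction B rule: finite_psubset_induct)
  case (psubset B)
  have "no_edges R B = no_edges R' B" using psubset.prems by (rule no_edges_cong)
  moreover have "ursell R A * no_edges R (B - A) = ursell R' A * no_edges R' (B - A)" if "A \<subset> B" for A
  proof -
    have "ursell R A = ursell R' A" using that psubset.prems by (intro psubset.IH) auto
    moreover have "no_edges R (B - A) = no_edges R' (B - A)" using psubset.prems by (intro no_edges_cong) auto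
    ultimately show ?thesis by simp
  qed
  ultimately show ?case by (simp add: ursell.simps[of _ B])
qed

text \<open>When \<open>Min B\<close> is in \<open>X\<close>, the terms of the recursion with
  \<open>A\<close> meeting \<open>Y\<close> vanish by induction. Those inside \<open>X\<close> add
  up to \<open>no_edges R X * no_edges R Y\<close>, which equals \<open>no_edges R B\<close>, so
  nothing remains.\<close>

lemma ursell_disconnected:
  assumes "finite X" "finite Y" "X \<noteq> {}" "Y \<noteq> {}" "X \<inter> Y = {}"
    "\<And>x y. x \<in> X \<Longrightarrow> y \<in> Y \<Longrightarrow> \<not> R x y \<and> \<not> R y x"
  shows "ursell R (X \<union> Y) = 0"
proof -
  have main: "ursell R B = 0"
    if "finite B" "B = X \<union> Y" "Min B \<in> X" "Y \<noteq> {}" "X \<inter> Y = {}" 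
      "\<And>x y. x \<in> X \<Longrightarrow> y \<in> Y \<Longrightarrow> \<not> R x y \<and> \<not> R y x" for B X Y
    using that
  proof (induction B arbitrary: X Y rule: finite_psubset_induct)
    case (psubset B)
    have fX: "finite X" "X \<noteq> {}" using psubset by auto
    have MX: "Min X = Min B"
      using psubset.prems psubset.hyps by (intro Min_eqI) (auto intro: finite_subset)
    have "(\<Sum>A\<in>{A. A \<subset> B \<and> Min B \<in> A}. ursell R A * no_edges R (B - A))
      = (\<Sum>A\<in>{A. A \<subseteq> X \<and> Min B \<in> A}. ursell R A * no_edges R (B - A))"
    proof (intro sum.mono_neutral_right ballI)
      show "finite {A. A \<subset> B \<and> Min B \<in> A}"
        by (rule finite_subset[of _ "Pow B"]) (use psubset.hyps in auto)
      show "{A. A \<subseteq> X \<and> Min B \<in> A} \<subseteq> {A. A \<subset> B \<and> Min B \<in> A}"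
        using psubset.prems by auto
      fix A assume A: "A \<in> {A. A \<subset> B \<and> Min B \<in> A} - {A. A \<subseteq> X \<and> Min B \<in> A}"
      have "ursell R A = 0"
      proof (rule psubset.IH)
        show "A \<subset> B" "A = (A \<inter> X) \<union> (A \<inter> Y)" "A \<inter> Y \<noteq> {}" "(A \<inter> X) \<inter> (A \<inter> Y) = {}"
          using A psubset.prems by auto
        have "Min A = Min B"
          using A psubset.hyps by (intro Min_eqI) (auto intro: finite_subset Min_le)
        then show "Min A \<in> A \<inter> X" using A psubset.prems by simp
      qed (use psubset.prems in auto)
      then show "ursell R A * no_edges R (B - A) = 0" by simp
    qed
    also have "\<dots> = (\<Sum>A\<in>{A. A \<subseteq> X \<and> Min B \<in> A}. ursell R A * no_edges R (X - A)) * no_edges R Y"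
      unfolding sum_distrib_right
    proof (intro sum.cong refl)
      fix A assume "A \<in> {A. A \<subseteq> X \<and> Min B \<in> A}"
      then have "B - A = (X - A) \<union> Y" using psubset.prems by auto
      moreover have "no_edges R ((X - A) \<union> Y) = no_edges R (X - A) * no_edges R Y"
        using psubset.prems(5) by (intro no_edges_Un) auto
      ultimately show "ursell R A * no_edges R (B - A) = ursell R A * no_edges R (X - A) * no_edges R Y"
        by simp
    qed
    also have "\<dots> = no_edges R X * no_edges R Y"
      unfolding no_edges_expand[OF fX, of R] MX ..
    also have "\<dots> = no_edges R B"
      using psubset.prems(1,5) by (simp add: no_edges_Un)
    finally show ?case using psubset.hyps by (simp add: ursell.simps[of R B])
  qed
  have "Min (X \<union> Y) \<in> X \<union> Y" using assms by (intro Min_in) auto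
  then show ?thesis
    using main[of "X \<union> Y" X Y] main[of "X \<union> Y" Y X] assms by blast
qed

text \<open>Since \<open>u\<close> and \<open>v\<close> are adjacent, the expansion of
  \<open>no_edges\<close> over \<open>insert v B\<close> sums to 0. Pairing \<open>A\<close> with
  \<open>insert v A\<close> cancels everything but \<open>A = B\<close>: if \<open>u\<close> is in
  \<open>A\<close>, by induction; otherwise both terms are 0, as \<open>v\<close> is disconnected
  from \<open>A\<close> and the complement of \<open>A\<close> contains \<open>u\<close> and
  \<open>v\<close>. The bound \<open>m < v\<close> keeps the anchor at \<open>m\<close>.\<close>

lemma ursell_leaf:
  assumes "finite B" "v \<notin> B" "u \<in> B" "R u v" "m \<in> B" "\<And>x. x \<in> B \<Longrightarrow> m \<le> x" "m < v"
    "\<And>x. x \<in> B \<Longrightarrow> x \<noteq> u \<Longrightarrow> \<not> R x v \<and> \<not> R v x"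
  shows "ursell R (insert v B) = - ursell R B"
  using assms
proof (induction B rule: finite_psubset_induct)
  case (psubset B)
  define C where "C = insert v B"
  let ?P = "{A. A \<subseteq> B \<and> m \<in> A}"
  let ?h = "\<lambda>A. ursell R A * no_edges R (C - A)"
  have MC: "Min C = m" unfolding C_def using psubset.hyps psubset.prems
    by (intro Min_eqI) auto
  have finP: "finite ?P" by (rule finite_subset[of _ "Pow B"]) (use psubset.hyps in auto)
  have inj: "inj_on (insert v) ?P" using psubset.prems(1) by (auto simp: inj_on_def)
  have split: "{A. A \<subseteq> C \<and> m \<in> A} = ?P \<union> insert v ` ?P" 
  proof -
    have "A \<in> ?P \<union> insert v ` ?P" if "A \<in> {A. A \<subseteq> C \<and> m \<in> A}" for A
    proof (cases "v \<in> A")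
      case True
      then show ?thesis
        using that psubset.prems by (intro UnI2 image_eqI[of _ _ "A - {v}"]) (auto simp: C_def)
    qed (use that in \<open>auto simp: C_def\<close>)
    then show ?thesis by (intro subset_antisym subsetI) (auto simp: C_def)
  qed
  have "0 = no_edges R C" using psubset.prems by (auto simp: no_edges_def C_def)
  also have "\<dots> = (\<Sum>A\<in>?P \<union> insert v ` ?P. ?h A)"
    using no_edges_expand[of C R] psubset.hyps unfolding MC split by (simp add: C_def)
  also have "\<dots> = (\<Sum>A\<in>?P. ?h A) + (\<Sum>A\<in>insert v ` ?P. ?h A)"
    using finP psubset.prems(1) by (intro sum.union_disjoint) auto
  also have "\<dots> = (\<Sum>A\<in>?P. ?h A + ?h (insert v A))"
    by (simp add: sum.reindex[OF inj] sum.distrib)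
  also have "\<dots> = (\<Sum>A\<in>{B}. ?h A + ?h (insert v A))"
  proof (intro sum.mono_neutral_right ballI finP)
    show "{B} \<subseteq> ?P" using psubset.prems by auto
    fix A assume A: "A \<in> ?P - {B}"
    then have fA: "finite A" using psubset.hyps by (auto intro: finite_subset)
    have vA: "v \<notin> A" using A psubset.prems by auto
    show "?h A + ?h (insert v A) = 0"
    proof (cases "u \<in> A")
      case True
      have "ursell R (insert v A) = - ursell R A"
        using A True psubset.prems by (intro psubset.IH) auto
      moreover have "no_edges R (C - A) = no_edges R (C - insert v A)"
      proof -
        have "C - A = {v} \<union> (C - insert v A)" using vA by (auto simp: C_def)
        moreover have "no_edges R ({v} \<union> (C - insert v A)) = no_edges R {v} * no_edges R (C - insert v A)"
          using psubset.prems True by (intro no_edges_Un) (auto simp: C_def)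
        ultimately show ?thesis by (simp add: no_edges_def)
      qed
      ultimately show ?thesis by simp
    next
      case False
      have "ursell R ({v} \<union> A) = 0"
        using fA A False vA psubset.prems by (intro ursell_disconnected) auto
      moreover have "u \<in> C - A" "v \<in> C - A" "u \<noteq> v"
        using psubset.prems False vA by (auto simp: C_def)
      then have "\<not> (\<forall>i\<in>C - A. \<forall>j\<in>C - A. i \<noteq> j \<longrightarrow> \<not> R i j)"
        using psubset.prems(3) by blast
      then have "no_edges R (C - A) = 0" by (simp add: no_edges_def)
      ultimately show ?thesis by simp
    qed
  qed
  also have "\<dots> = ursell R B * no_edges R (C - B) + ursell R C * no_edges R (C - C)"
    by (simp add: C_def)
  also have "C - B = {v}" using psubset.prems by (auto simp: C_def)
  finally show ?case by (simp add: no_edges_def C_def)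
qed

text \<open>The only connected spanning edge set of a path is the path itself, with \<open>m\<close>
  edges; its vertices are added one by one as leaves.\<close>

lemma ursell_path:
  assumes "\<And>i j. i < Suc m \<Longrightarrow> j < Suc m \<Longrightarrow> i < j \<Longrightarrow> R i j = (j = Suc i) \<and> R j i = (j = Suc i)"
  shows "ursell R {..<Suc m} = (- 1) ^ m"
  using assms
proof (induction m)
  case 0
  have *: "{A. A \<subset> {0} \<and> Min {0::nat} \<in> A} = {}" by auto
  have "ursell R {0} = 1" unfolding ursell.simps[of R "{0}"] * by (simp add: no_edges_def)
  then show ?case by (simp add: lessThan_Suc)
next
  case (Suc m)
  have "ursell R (insert (Suc m) {..<Suc m}) = - ursell R {..<Suc m}"
  proof (rule ursell_leaf[where u = m and m = 0])
    fix x assume "x \<in> {..<Suc m}" "x \<noteq> m"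
    then show "\<not> R x (Suc m) \<and> \<not> R (Suc m) x" using Suc.prems[of x "Suc m"] by auto
  qed (use Suc.prems[of m "Suc m"] in auto)
  then show ?case using Suc by (simp add: lessThan_Suc[of "Suc m"])
qed

section \<open>Counting tuples of disjoint copies by clusters\<close>

lemma sum_PiE_split:
  fixes f g :: "('i \<Rightarrow> 'x) \<Rightarrow> 'c::comm_semiring_0"
  assumes "A \<subseteq> B"
  shows "(\<Sum>s\<in>PiE B F. f (restrict s A) * g (restrict s (B - A))) = (\<Sum>s\<in>PiE A F. f s) * (\<Sum>s\<in>PiE (B - A) F. g s)"
proof -
  have "(\<Sum>s\<in>PiE A F. f s) * (\<Sum>s\<in>PiE (B - A) F. g s) = (\<Sum>(s, t)\<in>PiE A F \<times> PiE (B - A) F. f s * g t)"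
    by (simp add: sum_product sum.cartesian_product)
  also have "\<dots> = (\<Sum>s\<in>PiE B F. f (restrict s A) * g (restrict s (B - A)))"
  proof (rule sum.reindex_bij_witness[where i = "\<lambda>s. (restrict s A, restrict s (B - A))"
        and j = "\<lambda>(s, t) x. if x \<in> A then s x else t x"])
    show "(restrict ((\<lambda>(s, t) x. if x \<in> A then s x else t x) a) A, restrict ((\<lambda>(s, t) x. if x \<in> A then s x else t x) a) (B - A)) = a"
      if "a \<in> PiE A F \<times> PiE (B - A) F" for a
      using that by (auto simp: fun_eq_iff restrict_def PiE_def extensional_def)
    show "(case (restrict s A, restrict s (B - A)) of (s, t) \<Rightarrow> \<lambda>x. if x \<in> A then s x else t x) = s" if "s \<in> PiE B F" for s
      using that assms by (auto simp: fun_eq_iff restrict_def PiE_def extensional_def)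
    show "(case a of (s, t) \<Rightarrow> \<lambda>x. if x \<in> A then s x else t x) \<in> PiE B F" if "a \<in> PiE A F \<times> PiE (B - A) F" for a
      using that assms by (auto simp: PiE_def extensional_def Pi_def)
    show "(restrict s A, restrict s (B - A)) \<in> PiE A F \<times> PiE (B - A) F" if "s \<in> PiE B F" for s
      using that assms by (auto simp: PiE_def Pi_def)
    show "f (restrict ((\<lambda>(s, t) x. if x \<in> A then s x else t x) a) A) * g (restrict ((\<lambda>(s, t) x. if x \<in> A then s x else t x) a) (B - A)) = (case a of (s, t) \<Rightarrow> f s * g t)"
      if "a \<in> PiE A F \<times> PiE (B - A) F" for a
    proof -
      obtain s t where a: "a = (s, t)" "s \<in> PiE A F" "t \<in> PiE (B - A) F" using \<open>a \<in> _\<close> by auto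
      have "restrict (\<lambda>x. if x \<in> A then s x else t x) A = s" "restrict (\<lambda>x. if x \<in> A then s x else t x) (B - A) = t"
        using a(2,3) by (auto simp: fun_eq_iff restrict_def PiE_def extensional_def)
      then show ?thesis using a by simp
    qed
  qed
  finally show ?thesis by simp
qed

definition touching :: "(nat \<Rightarrow> nat set set) \<Rightarrow> nat \<Rightarrow> nat \<Rightarrow> bool" where
  "touching s i j \<longleftrightarrow> \<Union>(s i) \<inter> \<Union>(s j) \<noteq> {}"

definition disjoint_count :: "(nat \<Rightarrow> nat set set set) \<Rightarrow> nat set \<Rightarrow> nat set set \<Rightarrow> int" where
  "disjoint_count C B S = (\<Sum>s\<in>PiE B (\<lambda>i. C i \<inter> Pow S). no_edges (touching s) B)"

definition cluster_count :: "(nat \<Rightarrow> nat set set set) \<Rightarrow> nat set \<Rightarrow> nat set set \<Rightarrow> int" where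
  "cluster_count C B S = (\<Sum>s\<in>PiE B (\<lambda>i. C i \<inter> Pow S). ursell (touching s) B)"

text \<open>Collecting the tuples with the same union turns a sum over tuples into a polynomial in
  the edge indicators.\<close>

definition cluster_weight :: "(nat \<Rightarrow> nat set set set) \<Rightarrow> nat set \<Rightarrow> nat set set \<Rightarrow> int" where
  "cluster_weight C B U = (\<Sum>s\<in>{s \<in> PiE B C. (\<Union>i\<in>B. s i) = U}. ursell (touching s) B)"

lemma disjoint_count_expand:
  assumes "finite B" "B \<noteq> {}"
  shows "disjoint_count C B S =
    (\<Sum>A\<in>{A. A \<subseteq> B \<and> Min B \<in> A}. cluster_count C A S * disjoint_count C (B - A) S)"
proof -
  let ?F = "\<lambda>i. C i \<inter> Pow S"
  have "disjoint_count C B S = (\<Sum>s\<in>PiE B ?F. \<Sum>A\<in>{A. A \<subseteq> B \<and> Min B \<in> A}.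
      ursell (touching s) A * no_edges (touching s) (B - A))"
    unfolding disjoint_count_def no_edges_expand[OF assms] ..
  also have "\<dots> = (\<Sum>A\<in>{A. A \<subseteq> B \<and> Min B \<in> A}. \<Sum>s\<in>PiE B ?F.
      ursell (touching s) A * no_edges (touching s) (B - A))"
    by (rule sum.swap)
  also have "\<dots> = (\<Sum>A\<in>{A. A \<subseteq> B \<and> Min B \<in> A}. cluster_count C A S * disjoint_count C (B - A) S)"
  proof (intro sum.cong refl)
    fix A assume A: "A \<in> {A. A \<subseteq> B \<and> Min B \<in> A}"
    then have fA: "finite A" using assms by (auto intro: finite_subset)
    have "(\<Sum>s\<in>PiE B ?F. ursell (touching s) A * no_edges (touching s) (B - A))
      = (\<Sum>s\<in>PiE B ?F. ursell (touching (restrict s A)) A * no_edges (touching (restrict s (B - A))) (B - A))"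
      using fA by (intro sum.cong refl arg_cong2[where f = "(*)"] ursell_cong no_edges_cong) (auto simp: touching_def)
    also have "\<dots> = cluster_count C A S * disjoint_count C (B - A) S"
      unfolding cluster_count_def disjoint_count_def using A by (intro sum_PiE_split) auto
    finally show "(\<Sum>s\<in>PiE B ?F. ursell (touching s) A * no_edges (touching s) (B - A))
      = cluster_count C A S * disjoint_count C (B - A) S" .
  qed
  finally show ?thesis .
qed

lemma cluster_count_weighted:
  assumes "finite B" "finite S"
  shows "cluster_count C B S = weighted_count (cluster_weight C B) S"
proof -
  let ?P = "PiE B (\<lambda>i. C i \<inter> Pow S)"
  have fin: "finite ?P" using assms by (intro finite_PiE) auto
  have "cluster_count C B S = (\<Sum>U\<in>Pow S. \<Sum>s\<in>{s \<in> ?P. (\<Union>i\<in>B. s i) = U}. ursell (touching s) B)"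
    unfolding cluster_count_def using assms fin by (intro sum.group[symmetric]) auto
  also have "\<dots> = weighted_count (cluster_weight C B) S"
    unfolding weighted_count_def cluster_weight_def
  proof (intro sum.cong refl)
    fix U assume "U \<in> Pow S"
    then show "{s \<in> ?P. (\<Union>i\<in>B. s i) = U} = {s \<in> PiE B C. (\<Union>i\<in>B. s i) = U}"
      by (auto simp: PiE_def Pi_def)
  qed
  finally show ?thesis .
qed

text \<open>Everything that the expansion uses about copies of connected graphs; \<open>K i\<close>
  is the number of edges of the i-th graph.\<close>

locale edge_families =
  fixes C :: "nat \<Rightarrow> nat set set set" and K :: "nat \<Rightarrow> nat" and k :: nat
  assumes connected: "i < k \<Longrightarrow> U \<in> C i \<Longrightarrow> edge_connected U"
    and finite: "i < k \<Longrightarrow> U \<in> C i \<Longrightarrow> finite U"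
    and card_edge: "i < k \<Longrightarrow> U \<in> C i \<Longrightarrow> e \<in> U \<Longrightarrow> card e = 2"
    and card: "i < k \<Longrightarrow> U \<in> C i \<Longrightarrow> card U = K i"
    and invariant: "i < k \<Longrightarrow> inj \<sigma> \<Longrightarrow> (`) \<sigma> ` U \<in> C i \<longleftrightarrow> U \<in> C i"
begin

lemma cluster_weight_invariant:
  assumes "inj \<sigma>" "B \<subseteq> {..<k}"
  shows "cluster_weight C B ((`) \<sigma> ` U) = cluster_weight C B U"
  unfolding cluster_weight_def
proof (rule sum.reindex_bij_witness[symmetric, where j = "\<lambda>s. restrict (\<lambda>i. (`) \<sigma> ` s i) B"
      and i = "\<lambda>s. restrict (\<lambda>i. (`) \<sigma> -` s i) B"])
  have inj2: "inj ((`) \<sigma>)" using assms(1) by (simp add: inj_on_image inj_def inj_image_eq_iff)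
  {
    fix s assume s: "s \<in> {s \<in> PiE B C. (\<Union>i\<in>B. s i) = U}"
    show "restrict (\<lambda>i. (`) \<sigma> -` (restrict (\<lambda>i. (`) \<sigma> ` s i) B) i) B = s"
      using s inj2 by (auto simp: fun_eq_iff restrict_def PiE_def extensional_def inj_vimage_image_eq)
    have "(\<Union>i\<in>B. (`) \<sigma> ` s i) = (`) \<sigma> ` U" using s by blast
    then show "restrict (\<lambda>i. (`) \<sigma> ` s i) B \<in> {s \<in> PiE B C. (\<Union>i\<in>B. s i) = (`) \<sigma> ` U}"
      using s assms invariant by (auto simp: PiE_def Pi_def subset_iff)
    have "touching (restrict (\<lambda>i. (`) \<sigma> ` s i) B) i j = touching s i j" if "i \<in> B" "j \<in> B" for i j
    proof -
      have "\<Union> ((`) \<sigma> ` s i) \<inter> \<Union> ((`) \<sigma> ` s j) = \<sigma> ` (\<Union>(s i) \<inter> \<Union>(s j))"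
        using assms(1) by (simp add: image_Int image_Union)
      then show ?thesis using that by (simp add: touching_def)
    qed
    then show "ursell (touching (restrict (\<lambda>i. (`) \<sigma> ` s i) B)) B = ursell (touching s) B"
      using assms(2) by (intro ursell_cong) (auto intro: finite_subset)
  next
    fix s assume s: "s \<in> {s \<in> PiE B C. (\<Union>i\<in>B. s i) = (`) \<sigma> ` U}"
    have pre: "(`) \<sigma> ` ((`) \<sigma> -` s i) = s i" if "i \<in> B" for i
    proof -
      have "s i \<subseteq> (`) \<sigma> ` U" using s that by blast
      then show ?thesis by blast
    qed
    show "restrict (\<lambda>i. (`) \<sigma> ` (restrict (\<lambda>i. (`) \<sigma> -` s i) B) i) B = s"
      using s pre by (auto simp: fun_eq_iff restrict_def PiE_def extensional_def)
    have "(`) \<sigma> -` s i \<in> C i" if "i \<in> B" for i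
    proof -
      have "s i \<in> C i" using s that by auto
      then show ?thesis using invariant[OF _ assms(1), of i "(`) \<sigma> -` s i"] pre[OF that] assms(2) that by auto
    qed
    moreover have "(\<Union>i\<in>B. (`) \<sigma> -` s i) = U"
    proof -
      have "(\<Union>i\<in>B. (`) \<sigma> -` s i) = (`) \<sigma> -` (\<Union>i\<in>B. s i)" by blast
      also have "\<dots> = U" using s inj2 by (simp add: inj_vimage_image_eq)
      finally show ?thesis .
    qed
    ultimately show "restrict (\<lambda>i. (`) \<sigma> -` s i) B \<in> {s \<in> PiE B C. (\<Union>i\<in>B. s i) = U}"
      by auto
  }
qed

text \<open>If \<open>U\<close> splits into vertex-disjoint parts, each connected \<open>s i\<close>
  lies in one of them, so the touching graph on \<open>B\<close> is disconnected and its Ursell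
  function is 0.\<close>

lemma conn_weight_cluster_weight:
  assumes B: "B \<subseteq> {..<k}"
  shows "conn_weight (cluster_weight C B) (\<Sum>i\<in>B. K i)"
  unfolding conn_weight_def
proof (intro conjI allI impI ballI)
  fix \<sigma> :: "nat \<Rightarrow> nat" and U assume "inj \<sigma>"
  then show "cluster_weight C B ((`) \<sigma> ` U) = cluster_weight C B U"
    using cluster_weight_invariant B by blast
next
  fix U assume "cluster_weight C B U \<noteq> 0"
  then obtain s where s: "s \<in> PiE B C" "(\<Union>i\<in>B. s i) = U" "ursell (touching s) B \<noteq> 0"
    unfolding cluster_weight_def using sum.not_neutral_contains_not_neutral by (metis (mono_tags, lifting) mem_Collect_eq)
  have finB: "finite B" using B by (rule finite_subset) simp
  have sC: "s i \<in> C i" "i < k" if "i \<in> B" for i using s(1) B that by auto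
  have Bne: "B \<noteq> {}" using s(3) by (auto simp: ursell.simps[of _ "{}"])
  show "finite U" using s(2) finB sC finite by blast
  show "card e = 2" if "e \<in> U" for e
    using that s(2) sC card_edge by blast
  show "card U \<le> (\<Sum>i\<in>B. K i)"
  proof -
    have "card (\<Union>i\<in>B. s i) \<le> (\<Sum>i\<in>B. card (s i))" by (rule card_UN_le[OF finB])
    also have "\<dots> = (\<Sum>i\<in>B. K i)" using sC card by (intro sum.cong) auto
    finally show ?thesis using s(2) by simp
  qed
  show "edge_connected U" unfolding edge_connected_def
  proof (intro conjI allI impI notI)
    assume "U = {}"
    moreover obtain i where "i \<in> B" using Bne by blast
    moreover have "s i \<noteq> {}" using connected[of i "s i"] sC[OF \<open>i \<in> B\<close>] by (simp add: edge_connected_def)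
    ultimately show False using s(2) by blast
  next
    fix V W assume VW: "U = V \<union> W" "V \<noteq> {}" "W \<noteq> {}" "\<Union>V \<inter> \<Union>W = {}"
    have ne: "e \<noteq> {}" if "e \<in> U" for e using that s(2) sC card_edge by fastforce
    then have disj: "V \<inter> W = {}" using VW by blast
    have side: "s i \<subseteq> V \<or> s i \<subseteq> W" if "i \<in> B" for i
    proof (rule ccontr)
      assume *: "\<not> ?thesis"
      have "s i = (s i \<inter> V) \<union> (s i \<inter> W)" using s(2) that VW(1) by blast
      moreover have "s i \<inter> V \<noteq> {}" "s i \<inter> W \<noteq> {}" using * calculation by blast+
      moreover have "\<Union>(s i \<inter> V) \<inter> \<Union>(s i \<inter> W) = {}" using VW(4) by blast
      ultimately show False using connected[of i "s i"] sC[OF that] unfolding edge_connected_def by metis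
    qed
    define X where "X = {i \<in> B. s i \<subseteq> V}"
    define Y where "Y = B - X"
    have Y: "s i \<subseteq> W" if "i \<in> Y" for i using side that by (auto simp: X_def Y_def)
    have "X \<noteq> {}"
    proof
      assume "X = {}"
      then have "U \<subseteq> W" using s(2) Y by (auto simp: Y_def)
      then show False using VW disj by blast
    qed
    moreover have "Y \<noteq> {}"
    proof
      assume "Y = {}"
      then have "U \<subseteq> V" using s(2) by (auto simp: Y_def X_def)
      then show False using VW disj by blast
    qed
    moreover have "\<not> touching s x y \<and> \<not> touching s y x" if "x \<in> X" "y \<in> Y" for x y
      using that Y[of y] VW(4) unfolding X_def touching_def by blast
    moreover have "B = X \<union> Y" "X \<inter> Y = {}" by (auto simp: X_def Y_def)
    ultimately show False using s(3) finB ursell_disconnected[of X Y "touching s"] by auto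
  qed
qed

lemma residue_spanned_cluster_count:
  assumes "q > 0" "B \<subseteq> {..<k}" "(\<Sum>i\<in>B. K i) \<le> L"
  shows "residue_spanned q L (cluster_count C B)"
proof -
  have "residue_spanned q L (weighted_count (cluster_weight C B))"
    using conn_weight_mono[OF conn_weight_cluster_weight[OF assms(2)] assms(3)] assms(1)
    by (intro residue_spanned_weight)
  then show ?thesis
    using assms(2) by (rule_tac residue_spanned_eq) (auto simp: cluster_count_weighted finite_subset[of _ "{..<k}"])
qed

lemma residue_spanned_disjoint_count:
  assumes "q > 0" "B \<subseteq> {..<k}" "(\<Sum>i\<in>B. K i) \<le> L"
  shows "residue_spanned q L (disjoint_count C B)"
proof -
  have "finite B" using assms(2) by (rule finite_subset) simp
  then show ?thesis
    using assms(2,3)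
  proof (induction B rule: finite_psubset_induct)
    case (psubset B)
    show ?case
    proof (cases "B = {}")
      case True
      then have "disjoint_count C B = (\<lambda>S. 1)" by (simp add: disjoint_count_def fun_eq_iff)
      then show ?thesis by (simp add: residue_spanned_const)
    next
      case False
      have sub: "(\<Sum>i\<in>A. K i) \<le> L" if "A \<subseteq> B" for A
        using sum_mono2[OF psubset.hyps that, of K] psubset.prems by simp
      have "disjoint_count C B = (\<lambda>S. \<Sum>A\<in>{A. A \<subseteq> B \<and> Min B \<in> A}. cluster_count C A S * disjoint_count C (B - A) S)"
        using disjoint_count_expand[OF psubset.hyps False] by (simp add: fun_eq_iff)
      moreover have "residue_spanned q L (disjoint_count C (B - A))" if "A \<subseteq> B" "Min B \<in> A" for A
        using psubset.prems that Min_in[OF psubset.hyps False] by (intro psubset.IH sub) auto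
      moreover have "residue_spanned q L (cluster_count C A)" if "A \<subseteq> B" for A
        using psubset.prems that by (intro residue_spanned_cluster_count assms(1) sub) auto
      ultimately show ?thesis
        using assms(1) by (auto intro!: residue_spanned_sum residue_spanned_mult)
    qed
  qed
qed

text \<open>The expansion anchored at 0 isolates the full cluster \<open>A = {..<k}\<close>. Every
  other term is a product of counts for proper subfamilies, whose clusters have fewer edges than
  \<open>U\<close>, so \<open>character_span_bias\<close> applies.\<close>

lemma disjoint_count_bias:
  assumes p: "0 < p" "p < 1" and q: "q > 0" and k: "k > 0" and K: "\<And>i. i < k \<Longrightarrow> K i > 0"
    and U: "card U = (\<Sum>i<k. K i)" "\<not> int q dvd a * cluster_weight C {..<k} U"
  shows "exp_small (\<lambda>n. norm (avg p (all_pairs n) (\<lambda>S. zchar q (a * disjoint_count C {..<k} S))))"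
proof -
  \<comment> \<open>A proper subfamily omits some index \<open>j\<close> with
    \<open>K j > 0\<close>, hence the subtraction of 1.\<close>
  define L where "L = (\<Sum>i<k. K i) - 1"
  have Kpos: "(\<Sum>i<k. K i) > 0" using k K by (intro sum_pos) auto
  have sub: "(\<Sum>i\<in>B. K i) \<le> L" if B: "B \<subset> {..<k}" for B
  proof -
    obtain j where j: "j \<in> {..<k} - B" using psubset_imp_ex_mem[OF B] by blast
    have "(\<Sum>i\<in>B. K i) \<le> (\<Sum>i\<in>{..<k} - {j}. K i)" using psubset_imp_subset[OF B] j by (intro sum_mono2) auto
    also have "\<dots> = (\<Sum>i<k. K i) - K j" using j by (subst sum_diff1_nat) auto
    also have "\<dots> \<le> L" using j K[of j] by (auto simp: L_def)
    finally show ?thesis .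
  qed
  define X where "X S = (\<Sum>A\<in>{A. A \<subset> {..<k} \<and> 0 \<in> A}. cluster_count C A S * disjoint_count C ({..<k} - A) S)" for S
  have "residue_spanned q L X"
    unfolding X_def using q
    by (auto intro!: residue_spanned_sum residue_spanned_mult residue_spanned_cluster_count
        residue_spanned_disjoint_count sub)
  then have X: "(\<lambda>S. zchar q (a * X S)) \<in> character_span q L" by (intro zchar_residue_spanned q)
  have split: "disjoint_count C {..<k} S = weighted_count (cluster_weight C {..<k}) S + X S" if "finite S" for S
  proof -
    have "Min {..<k} = 0" using k by (intro Min_eqI) auto
    moreover have "{A. A \<subseteq> {..<k} \<and> 0 \<in> A} = insert {..<k} {A. A \<subset> {..<k} \<and> 0 \<in> A}" using k by auto
    moreover have "finite {A. A \<subset> {..<k} \<and> (0::nat) \<in> A}" by (rule finite_subset[of _ "Pow {..<k}"]) auto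
    ultimately have "disjoint_count C {..<k} S = cluster_count C {..<k} S * disjoint_count C {} S + X S"
      using k by (subst disjoint_count_expand) (auto simp: X_def)
    then show ?thesis using that by (simp add: cluster_count_weighted disjoint_count_def)
  qed
  have "exp_small (\<lambda>n. norm (avg p (all_pairs n)
      (\<lambda>S. zchar q (weighted_count (\<lambda>U. a * cluster_weight C {..<k} U) S) * zchar q (a * X S))))"
  proof (rule character_span_bias[where w = "\<lambda>U. a * cluster_weight C {..<k} U", OF p q _ U(2) _ _ X])
    show "conn_weight (\<lambda>U. a * cluster_weight C {..<k} U) (\<Sum>i<k. K i)"
      by (intro conn_weight_cmult conn_weight_cluster_weight) simp
    show "L < card U" "L \<le> (\<Sum>i<k. K i)" using U(1) Kpos by (auto simp: L_def)
  qed
  moreover have "zchar q (weighted_count (\<lambda>U. a * cluster_weight C {..<k} U) S) * zchar q (a * X S)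
     = zchar q (a * disjoint_count C {..<k} S)" if "S \<subseteq> all_pairs n" for n S
  proof -
    have "finite S" using that by (rule finite_subset) simp
    then show ?thesis by (simp add: split weighted_count_cmult ring_distribs zchar_add)
  qed
  ultimately show ?thesis by (simp cong: avg_cong)
qed

end

section \<open>Copies of a graph\<close>

lemma wf_graph_edgeE:
  assumes "wf_graph G" "e \<in> edges G"
  obtains u v where "e = {u, v}" "u \<noteq> v" "u \<in> verts G" "v \<in> verts G"
proof -
  have "card e = 2" "e \<subseteq> verts G" using assms by (auto simp: wf_graph_def)
  then show ?thesis using that by (auto simp: card_2_iff)
qed

lemma wf_graph_edge_subset: "wf_graph G \<Longrightarrow> e \<in> edges G \<Longrightarrow> e \<subseteq> verts G"
  by (auto simp: wf_graph_def)

lemma verts_pair [simp]: "verts (V, E) = V" and edges_pair [simp]: "edges (V, E) = E"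
  by (simp_all add: verts_def edges_def)

lemma graph_iso_iff:
  assumes G: "wf_graph G" and H: "wf_graph H"
  shows "graph_iso G H \<longleftrightarrow>
    (\<exists>f. inj_on f (verts G) \<and> f ` verts G = verts H \<and> (`) f ` edges G = edges H)"
proof
  assume "graph_iso G H"
  then obtain f where f: "bij_betw f (verts G) (verts H)"
    "\<And>u v. u \<in> verts G \<Longrightarrow> v \<in> verts G \<Longrightarrow> {u, v} \<in> edges G \<longleftrightarrow> {f u, f v} \<in> edges H"
    unfolding graph_iso_def by blast
  have "(`) f ` edges G = edges H"
  proof (intro subset_antisym subsetI)
    fix e assume "e \<in> (`) f ` edges G"
    then obtain e' where e': "e' \<in> edges G" "e = f ` e'" by blast
    obtain u v where "e' = {u, v}" "u \<in> verts G" "v \<in> verts G"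
      using wf_graph_edgeE[OF G e'(1)] by metis
    then show "e \<in> edges H" using f(2)[of u v] e' by simp
  next
    fix e assume e: "e \<in> edges H"
    then obtain x y where xy: "e = {x, y}" "x \<in> verts H" "y \<in> verts H"
      using wf_graph_edgeE[OF H] by metis
    then obtain u v where uv: "x = f u" "y = f v" "u \<in> verts G" "v \<in> verts G"
      using xy f(1) unfolding bij_betw_def by blast
    then have "{u, v} \<in> edges G" using f(2) e xy by simp
    then show "e \<in> (`) f ` edges G" using uv xy by (intro image_eqI[of _ _ "{u, v}"]) auto
  qed
  then show "\<exists>f. inj_on f (verts G) \<and> f ` verts G = verts H \<and> (`) f ` edges G = edges H"
    using f(1) by (auto simp: bij_betw_def)
next
  assume "\<exists>f. inj_on f (verts G) \<and> f ` verts G = verts H \<and> (`) f ` edges G = edges H"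
  then obtain f where f: "inj_on f (verts G)" "f ` verts G = verts H" "(`) f ` edges G = edges H" by blast
  have "{u, v} \<in> edges G \<longleftrightarrow> {f u, f v} \<in> edges H" if uv: "u \<in> verts G" "v \<in> verts G" for u v
  proof
    assume "{u, v} \<in> edges G"
    then have "f ` {u, v} \<in> edges H" unfolding f(3)[symmetric] by (rule imageI)
    then show "{f u, f v} \<in> edges H" by simp
  next
    assume "{f u, f v} \<in> edges H"
    then have "f ` {u, v} \<in> (`) f ` edges G" unfolding f(3) by simp
    then obtain e where e: "e \<in> edges G" "f ` e = f ` {u, v}" by (metis imageE)
    then have "e = {u, v}"
      using inj_on_image_eq_iff[OF f(1), of e "{u, v}"] wf_graph_edge_subset[OF G] uv by blast
    then show "{u, v} \<in> edges G" using e by simp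
  qed
  then show "graph_iso G H" unfolding graph_iso_def using f by (auto simp: bij_betw_def intro!: exI[of _ f])
qed

lemma wf_graph_image:
  assumes "wf_graph G" "inj_on f (verts G)"
  shows "wf_graph (f ` verts G, (`) f ` edges G)"
proof -
  have "card (f ` e) = 2" if "e \<in> edges G" for e
    using assms that by (subst card_image) (auto simp: wf_graph_def intro: inj_on_subset)
  then show ?thesis using assms by (auto simp: wf_graph_def)
qed

lemma graph_iso_image:
  assumes "wf_graph G" "inj_on f (verts G)"
  shows "graph_iso G (f ` verts G, (`) f ` edges G)"
  using assms wf_graph_image[OF assms] by (auto simp: graph_iso_iff)

lemma graph_iso_sym:
  assumes "wf_graph G" "wf_graph H" "graph_iso G H"
  shows "graph_iso H G"
proof -
  obtain f where f: "inj_on f (verts G)" "f ` verts G = verts H" "(`) f ` edges G = edges H"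
    using assms by (auto simp: graph_iso_iff)
  let ?g = "inv_into (verts G) f"
  have "(\<lambda>e. ?g ` f ` e) ` edges G = (\<lambda>e. e) ` edges G"
    using assms(1) f(1) by (intro image_cong refl inv_into_image_cancel wf_graph_edge_subset)
  then have "(`) ?g ` edges H = edges G"
    unfolding f(3)[symmetric] image_image by simp
  moreover have "?g ` verts H = verts G" using f by (auto simp: inv_into_image_cancel simp flip: f(2))
  moreover have "inj_on ?g (verts H)" using f(2) by (auto intro!: inj_on_inv_into)
  ultimately show ?thesis using assms by (auto simp: graph_iso_iff)
qed

lemma graph_iso_trans:
  assumes "wf_graph G" "wf_graph H" "wf_graph J" "graph_iso G H" "graph_iso H J"
  shows "graph_iso G J"
proof -
  obtain f where f: "inj_on f (verts G)" "f ` verts G = verts H" "(`) f ` edges G = edges H"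
    using assms by (auto simp: graph_iso_iff)
  obtain g where g: "inj_on g (verts H)" "g ` verts H = verts J" "(`) g ` edges H = edges J"
    using assms by (auto simp: graph_iso_iff)
  have "(`) (g \<circ> f) ` edges G = edges J"
    unfolding g(3)[symmetric] f(3)[symmetric] by (simp add: image_comp)
  moreover have "(g \<circ> f) ` verts G = verts J" using f g by (simp only: image_comp[symmetric])
  moreover have "inj_on (g \<circ> f) (verts G)" using f g by (intro comp_inj_on) auto
  ultimately show ?thesis using assms(1,3) unfolding graph_iso_iff[OF assms(1,3)] by blast
qed

text \<open>A graph without isolated vertices is determined by its edges, so its copies are encoded by their
  edge sets alone.\<close>
definition spanned :: "'a ugraph \<Rightarrow> bool" where
  "spanned G \<longleftrightarrow> wf_graph G \<and> \<Union>(edges G) = verts G"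

definition copies :: "'a ugraph \<Rightarrow> 'b set set set" where
  "copies G = {(`) g ` edges G | g. inj_on g (verts G)}"

lemma Union_image_edges: "spanned G \<Longrightarrow> \<Union>((`) g ` edges G) = g ` verts G"
  by (auto simp: spanned_def simp flip: image_Union)

lemma spanned_iso:
  assumes "spanned G" "wf_graph H" "graph_iso H G"
  shows "\<Union>(edges H) = verts H" "edges H \<in> copies G"
proof -
  have wf: "wf_graph G" using assms by (simp add: spanned_def)
  obtain g where g: "inj_on g (verts G)" "g ` verts G = verts H" "(`) g ` edges G = edges H"
    using graph_iso_sym[OF assms(2) wf assms(3)] wf assms(2) by (auto simp: graph_iso_iff)
  show "\<Union>(edges H) = verts H" using Union_image_edges[OF assms(1), of g] g by simp
  show "edges H \<in> copies G" unfolding copies_def using g(1) g(3)[symmetric] by blast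
qed

lemma copies_graph:
  assumes "spanned G" "U \<in> copies G"
  shows "wf_graph (\<Union>U, U)" "graph_iso (\<Union>U, U) G" "graph_iso G (\<Union>U, U)"
proof -
  have wf: "wf_graph G" using assms by (simp add: spanned_def)
  obtain g where g: "inj_on g (verts G)" "U = (`) g ` edges G" using assms by (auto simp: copies_def)
  have eq: "(\<Union>U, U) = (g ` verts G, (`) g ` edges G)" using Union_image_edges[OF assms(1)] g by simp
  show "wf_graph (\<Union>U, U)" "graph_iso G (\<Union>U, U)"
    unfolding eq using wf_graph_image[OF wf g(1)] graph_iso_image[OF wf g(1)] .
  then show "graph_iso (\<Union>U, U) G" using wf by (metis graph_iso_sym)
qed

lemma copies_finite: "spanned G \<Longrightarrow> U \<in> copies G \<Longrightarrow> finite U"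
  using copies_graph(1)[of G U] by (auto simp: wf_graph_def intro: finite_UnionD)

lemma copies_card_edge: "spanned G \<Longrightarrow> U \<in> copies G \<Longrightarrow> e \<in> U \<Longrightarrow> card e = 2"
  using copies_graph(1)[of G U] by (auto simp: wf_graph_def)

lemma inj_on_image_edges:
  assumes "wf_graph G" "inj_on g (verts G)"
  shows "inj_on ((`) g) (edges G)"
proof (rule inj_onI)
  fix e e' assume "e \<in> edges G" "e' \<in> edges G" "g ` e = g ` e'"
  then show "e = e'"
    using inj_on_image_eq_iff[OF assms(2), of e e'] wf_graph_edge_subset[OF assms(1)] by simp
qed

lemma copies_card: "spanned G \<Longrightarrow> U \<in> copies G \<Longrightarrow> card U = card (edges G)"
  unfolding copies_def spanned_def using inj_on_image_edges[of G] card_image by blast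

text \<open>For the backward direction: every vertex lies on an edge, so \<open>g\<close> maps all
  vertices into \<open>range \<sigma>\<close> and can be pulled back along
  \<open>inv \<sigma>\<close>.\<close>

lemma copies_invariant:
  assumes "inj \<sigma>" "spanned G"
  shows "(`) \<sigma> ` U \<in> copies G \<longleftrightarrow> U \<in> copies G"
proof
  assume "U \<in> copies G"
  then obtain g where g: "inj_on g (verts G)" "U = (`) g ` edges G" by (auto simp: copies_def)
  have "(`) \<sigma> ` U = (`) (\<sigma> \<circ> g) ` edges G" using g by (simp add: image_comp)
  moreover have "inj_on (\<sigma> \<circ> g) (verts G)" using g assms(1) by (intro comp_inj_on) (auto intro: inj_on_subset)
  ultimately show "(`) \<sigma> ` U \<in> copies G" unfolding copies_def by blast
next
  assume "(`) \<sigma> ` U \<in> copies G"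
  then obtain g where g: "inj_on g (verts G)" "(`) \<sigma> ` U = (`) g ` edges G" by (auto simp: copies_def)
  have "g ` verts G \<subseteq> range \<sigma>"
  proof -
    have "\<Union>((`) g ` edges G) \<subseteq> range \<sigma>" unfolding g(2)[symmetric] by auto
    then show ?thesis using Union_image_edges[OF assms(2), of g] by simp
  qed
  then have \<sigma>: "\<sigma> ` (inv \<sigma> ` g ` e) = g ` e" if "e \<subseteq> verts G" for e
    using that by (intro image_inv_into_cancel[of \<sigma> UNIV]) auto
  have "(\<lambda>e. \<sigma> ` (inv \<sigma> \<circ> g) ` e) ` edges G = (`) g ` edges G"
    using assms(2) unfolding spanned_def
    by (intro image_cong refl) (simp only: image_comp[symmetric] \<sigma> wf_graph_edge_subset)
  then have "(`) \<sigma> ` ((`) (inv \<sigma> \<circ> g) ` edges G) = (`) \<sigma> ` U"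
    unfolding g(2) image_image .
  moreover have "inj ((`) \<sigma>)" using assms(1) by (simp add: inj_def inj_image_eq_iff)
  ultimately have "U = (`) (inv \<sigma> \<circ> g) ` edges G" by (simp add: inj_image_eq_iff)
  moreover have "inj_on (inv \<sigma> \<circ> g) (verts G)"
    using g(1) \<open>g ` verts G \<subseteq> range \<sigma>\<close> by (intro comp_inj_on) (auto intro: inj_on_inv_into)
  ultimately show "U \<in> copies G" unfolding copies_def by blast
qed

lemma edge_connected_graph:
  assumes G: "connected_graph G" and "edges G \<noteq> {}"
  shows "edge_connected (edges G)"
  unfolding edge_connected_def
proof (intro conjI allI impI notI)
  fix V W assume *: "edges G = V \<union> W" "V \<noteq> {}" "W \<noteq> {}" "\<Union>V \<inter> \<Union>W = {}"
  have wf: "wf_graph G" using G by (simp add: connected_graph_def)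
  have ne: "e \<noteq> {}" "e \<subseteq> verts G" if "e \<in> edges G" for e
    using wf that by (auto simp: wf_graph_def)
  obtain e e' where e: "e \<in> V" "e' \<in> W" using *(2,3) by blast
  then have ee: "e \<in> edges G" "e' \<in> edges G" using *(1) by auto
  obtain u w where "u \<in> e" "w \<in> e'" using ne(1)[OF ee(1)] ne(1)[OF ee(2)] by blast
  then have uw: "u \<in> \<Union>V" "w \<in> \<Union>W" "u \<in> verts G" "w \<in> verts G"
    using e ne(2)[OF ee(1)] ne(2)[OF ee(2)] by auto
  then have "(u, w) \<in> (adj_rel G)\<^sup>*" using G by (simp add: connected_graph_def)
  then have "w \<in> \<Union>V"
  proof induction
    case (step y z)
    then have "{y, z} \<in> V \<union> W" using * by (simp add: adj_rel_def)
    then show ?case using step.IH *(4) by blast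
  qed (rule uw)
  then show False using uw * by blast
qed (use assms in auto)

lemma connected_graph_edge_connected:
  assumes "wf_graph (\<Union>U, U)" "edge_connected U"
  shows "connected_graph (\<Union>U, U)"
  unfolding connected_graph_def
proof (intro conjI ballI)
  fix u v assume uv: "u \<in> verts (\<Union>U, U)" "v \<in> verts (\<Union>U, U)"
  define R where "R = {x. (u, x) \<in> (adj_rel (\<Union>U, U))\<^sup>*}"
  have closed: "z \<in> R" if "{y, z} \<in> U" "y \<in> R" for y z
    using that by (auto simp: R_def adj_rel_def intro: rtrancl_into_rtrancl)
  have ed: "\<exists>y z. e = {y, z}" if "e \<in> U" for e
    using wf_graph_edgeE[OF assms(1)] that by (metis edges_pair)
  have dich: "e \<subseteq> R" if e: "e \<in> U" "e \<inter> R \<noteq> {}" for e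
  proof -
    obtain y z where "e = {y, z}" using ed[OF e(1)] by blast
    then show ?thesis using e closed[of y z] closed[of z y] by (auto simp: insert_commute)
  qed
  define V where "V = {e \<in> U. e \<subseteq> R}"
  have "u \<in> R" by (simp add: R_def)
  then have "V \<noteq> {}" using uv dich by (auto simp: V_def)
  moreover have "\<Union>V \<inter> \<Union>(U - V) = {}" using dich by (auto simp: V_def)
  moreover have "U = V \<union> (U - V)" by (auto simp: V_def)
  ultimately have "U - V = {}" using assms(2) unfolding edge_connected_def by blast
  then have "v \<in> R" using uv by (auto simp: V_def)
  then show "(u, v) \<in> (adj_rel (\<Union>U, U))\<^sup>*" by (simp add: R_def)
next
  have "U \<noteq> {}" "\<forall>e\<in>U. card e = 2" using assms by (auto simp: edge_connected_def wf_graph_def)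
  then show "verts (\<Union>U, U) \<noteq> {}" by fastforce
qed (rule assms)

lemma edge_connected_image:
  assumes "edge_connected E" "inj_on g (\<Union>E)"
  shows "edge_connected ((`) g ` E)"
  unfolding edge_connected_def
proof (intro conjI allI impI notI)
  fix V W assume *: "(`) g ` E = V \<union> W" "V \<noteq> {}" "W \<noteq> {}" "\<Union>V \<inter> \<Union>W = {}"
  have "E = (E \<inter> (`) g -` V) \<union> (E \<inter> (`) g -` W)" using *(1) by blast
  moreover have "E \<inter> (`) g -` X \<noteq> {}" if X: "X \<noteq> {}" "X \<subseteq> (`) g ` E" for X
  proof -
    obtain x where "x \<in> X" using X(1) by blast
    then show ?thesis using X(2) by auto
  qed
  from this[of V] this[of W] have "E \<inter> (`) g -` V \<noteq> {}" "E \<inter> (`) g -` W \<noteq> {}" using *(1-3) by simp_all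
  moreover have "\<Union>(E \<inter> (`) g -` V) \<subseteq> g -` \<Union>V" "\<Union>(E \<inter> (`) g -` W) \<subseteq> g -` \<Union>W" by auto
  then have "\<Union>(E \<inter> (`) g -` V) \<inter> \<Union>(E \<inter> (`) g -` W) = {}" using *(4) by blast
  ultimately show False using assms(1) unfolding edge_connected_def by metis
qed (use assms in \<open>auto simp: edge_connected_def\<close>)

lemma copies_edge_connected:
  assumes "spanned G" "connected_graph G" "edges G \<noteq> {}" "U \<in> copies G"
  shows "edge_connected U"
  using assms edge_connected_image[OF edge_connected_graph[OF assms(2,3)]]
  by (auto simp: copies_def spanned_def)

lemma spanned_connected_graph:
  assumes "connected_graph G" "edges G \<noteq> {}"
  shows "spanned G"
proof -
  have wf: "wf_graph G" using assms by (simp add: connected_graph_def)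
  obtain e where "e \<in> edges G" using assms by auto
  then obtain a b where ab: "a \<noteq> b" "a \<in> verts G" "b \<in> verts G" using wf_graph_edgeE[OF wf] by metis
  have "v \<in> \<Union>(edges G)" if v: "v \<in> verts G" for v
  proof -
    obtain w where w: "w \<in> verts G" "w \<noteq> v" using ab by metis
    then have "(v, w) \<in> (adj_rel G)\<^sup>*" using assms v by (simp add: connected_graph_def)
    then obtain y where "(v, y) \<in> adj_rel G" using w by (metis converse_rtranclE)
    then show ?thesis by (auto simp: adj_rel_def)
  qed
  then show ?thesis using wf wf_graph_edge_subset[OF wf] by (auto simp: spanned_def)
qed

text \<open>Contrapositively, copies of incomparable graphs are never nested. In this form
  incomparability yields both uniqueness of the decomposition of the chain and injectivity of the
  union of disjoint copies.\<close>

lemma iso_subgraph_copies: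
  assumes "spanned G" "spanned G'" "U \<in> copies G" "U' \<in> copies G'" "U \<subseteq> U'"
  shows "iso_subgraph G G'"
proof -
  have wf: "wf_graph G" "wf_graph G'" using assms by (auto simp: spanned_def)
  let ?H = "(\<Union>U', U')"
  obtain f where f: "inj_on f (\<Union>U')" "f ` \<Union>U' = verts G'" "(`) f ` U' = edges G'"
    using copies_graph[OF assms(2,4)] wf by (auto simp: graph_iso_iff)
  have sub: "\<Union>U \<subseteq> \<Union>U'" using assms(5) by blast
  have wfU: "wf_graph (\<Union>U, U)" and iso: "graph_iso G (\<Union>U, U)" using copies_graph[OF assms(1,3)] by auto
  let ?S = "(f ` \<Union>U, (`) f ` U)"
  have inj: "inj_on f (verts (\<Union>U, U))" using f(1) sub by (auto intro: inj_on_subset)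
  have S: "wf_graph ?S" "graph_iso (\<Union>U, U) ?S"
    using wf_graph_image[OF wfU inj] graph_iso_image[OF wfU inj] by auto
  have "f ` \<Union>U \<subseteq> verts G'" unfolding f(2)[symmetric] by (rule image_mono[OF sub])
  moreover have "(`) f ` U \<subseteq> edges G'" unfolding f(3)[symmetric] by (rule image_mono[OF assms(5)])
  ultimately have "subgraph ?S G'" using S by (simp add: subgraph_def)
  moreover have "graph_iso G ?S" using graph_iso_trans[OF wf(1) wfU S(1) iso S(2)] .
  ultimately show ?thesis unfolding iso_subgraph_def by blast
qed

section \<open>Gluing along diametral pairs\<close>

definition gdist :: "'a ugraph \<Rightarrow> 'a \<Rightarrow> 'a \<Rightarrow> nat" where
  "gdist G u v = (LEAST n. (u, v) \<in> adj_rel G ^^ n)"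

definition diam :: "'a ugraph \<Rightarrow> nat" where
  "diam G = Max ((\<lambda>(u, v). gdist G u v) ` (verts G \<times> verts G))"

context
  fixes G :: "'a ugraph"
  assumes G: "connected_graph G"
begin

lemma finite_verts: "finite (verts G)"
  using G by (simp add: connected_graph_def wf_graph_def)

lemma gdist_relpow:
  assumes "u \<in> verts G" "v \<in> verts G"
  shows "(u, v) \<in> adj_rel G ^^ gdist G u v"
proof -
  have "(u, v) \<in> (adj_rel G)\<^sup>*" using G assms by (simp add: connected_graph_def)
  then have "\<exists>n. (u, v) \<in> adj_rel G ^^ n" by (rule rtrancl_imp_relpow)
  then show ?thesis unfolding gdist_def by (rule LeastI_ex)
qed

lemma gdist_le: "(u, v) \<in> adj_rel G ^^ n \<Longrightarrow> gdist G u v \<le> n"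
  unfolding gdist_def by (rule Least_le)

lemma gdist_self [simp]: "gdist G u u = 0"
  using gdist_le[of u u 0] by simp

lemma gdist_eq_0: "u \<in> verts G \<Longrightarrow> v \<in> verts G \<Longrightarrow> gdist G u v = 0 \<Longrightarrow> u = v"
  using gdist_relpow[of u v] by simp

lemma gdist_edge:
  assumes "u \<in> verts G" "{x, y} \<in> edges G"
  shows "gdist G u y \<le> gdist G u x + 1"
proof -
  have "x \<in> verts G" using G assms(2) by (auto simp: connected_graph_def wf_graph_def)
  then have "(u, x) \<in> adj_rel G ^^ gdist G u x" using assms gdist_relpow by blast
  moreover have "(x, y) \<in> adj_rel G" using assms by (simp add: adj_rel_def)
  ultimately have "(u, y) \<in> adj_rel G ^^ Suc (gdist G u x)" by (rule relpow_Suc_I)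
  then show ?thesis using gdist_le by fastforce
qed

lemma gdist_le_diam: "u \<in> verts G \<Longrightarrow> v \<in> verts G \<Longrightarrow> gdist G u v \<le> diam G"
  unfolding diam_def using finite_verts by (intro Max_ge) auto

lemma diam_attained:
  obtains a b where "a \<in> verts G" "b \<in> verts G" "gdist G a b = diam G"
proof -
  have "diam G \<in> (\<lambda>(u, v). gdist G u v) ` (verts G \<times> verts G)"
    unfolding diam_def using finite_verts G by (intro Max_in) (auto simp: connected_graph_def)
  then show ?thesis using that by auto
qed

lemma diam_pos:
  assumes "edges G \<noteq> {}"
  shows "0 < diam G"
proof -
  have "wf_graph G" using G by (simp add: connected_graph_def)
  then obtain u v where "u \<noteq> v" "u \<in> verts G" "v \<in> verts G"
    using assms wf_graph_edgeE by (metis ex_in_conv)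
  then have "gdist G u v \<noteq> 0" using gdist_eq_0 by blast
  then show ?thesis using gdist_le_diam[of u v] \<open>u \<in> verts G\<close> \<open>v \<in> verts G\<close> by simp
qed

text \<open>Without such an edge, the bound \<open>t\<close> on the distance from \<open>a\<close>
  would propagate along a walk to \<open>b\<close>.\<close>

lemma gdist_level_edge:
  assumes "a \<in> verts G" "b \<in> verts G" "t < gdist G a b"
  obtains x y where "{x, y} \<in> edges G" "gdist G a x = t" "gdist G a y = Suc t"
proof (rule ccontr)
  assume *: "\<not> thesis"
  have "(a, b) \<in> (adj_rel G)\<^sup>*" using G assms by (simp add: connected_graph_def)
  then have "gdist G a b \<le> t"
  proof induction
    case (step y z)
    then have e: "{y, z} \<in> edges G" by (simp add: adj_rel_def)
    then have "gdist G a z \<le> gdist G a y + 1" using gdist_edge assms by blast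
    moreover have "gdist G a y \<noteq> t \<or> gdist G a z \<noteq> Suc t" using * that e by blast
    ultimately show ?case using step.IH by linarith
  qed simp
  then show False using assms by simp
qed

lemma lipschitz_diam:
  fixes l :: "'a \<Rightarrow> nat"
  assumes "\<And>x y. {x, y} \<in> edges G \<Longrightarrow> l y \<le> l x + 1" "u \<in> verts G" "v \<in> verts G"
  shows "l v \<le> l u + diam G"
proof -
  have "l v \<le> l u + n" if "(u, v) \<in> adj_rel G ^^ n" for n v
    using that
  proof (induction n arbitrary: v)
    case (Suc n)
    then obtain w where w: "(u, w) \<in> adj_rel G ^^ n" "(w, v) \<in> adj_rel G" by auto
    then have "l v \<le> l w + 1" using assms(1) by (simp add: adj_rel_def)
    then show ?case using Suc.IH[OF w(1)] by simp
  qed simp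
  then show ?thesis using gdist_relpow gdist_le_diam assms by (meson add_left_mono order_trans)
qed

text \<open>This ties the unknown pieces of a decomposition to their diameters, wherever they sit in
  the chain.\<close>

lemma copies_lipschitz:
  fixes l :: "'b \<Rightarrow> nat"
  assumes "spanned G" "U \<in> copies G" "\<And>x y. {x, y} \<in> U \<Longrightarrow> l y \<le> l x + 1" "u \<in> \<Union>U" "v \<in> \<Union>U"
  shows "l v \<le> l u + diam G"
proof -
  obtain g where g: "U = (`) g ` edges G" using assms(2) by (auto simp: copies_def)
  obtain u' v' where uv: "u = g u'" "v = g v'" "u' \<in> verts G" "v' \<in> verts G"
    using assms(4,5) Union_image_edges[OF assms(1), of g] unfolding g by auto
  have "(l \<circ> g) v' \<le> (l \<circ> g) u' + diam G"
  proof (rule lipschitz_diam)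
    fix x y assume "{x, y} \<in> edges G"
    then have "g ` {x, y} \<in> U" unfolding g by (rule imageI)
    then show "(l \<circ> g) y \<le> (l \<circ> g) x + 1" using assms(3)[of "g x" "g y"] by simp
  qed (use uv in auto)
  then show ?thesis using uv by simp
qed

end

section \<open>Uniqueness of the decomposition of a chain\<close>

lemma card_UN_tight:
  fixes J :: "'i \<Rightarrow> 'x set"
  assumes "finite F" "\<And>i. i \<in> F \<Longrightarrow> finite (J i)" "\<And>i. i \<in> F \<Longrightarrow> card (J i) \<le> D i"
    and "(\<Sum>i\<in>F. D i) \<le> card (\<Union>i\<in>F. J i)" and i: "i \<in> F"
  shows "card (J i) = D i" "J i \<inter> (\<Union>j\<in>F - {i}. J j) = {}"
proof -
  let ?R = "\<Union>j\<in>F - {i}. J j"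
  have fin: "finite (J i)" "finite ?R" using assms by auto
  have "(\<Union>i\<in>F. J i) = J i \<union> ?R" using i by auto
  then have "card (\<Union>i\<in>F. J i) + card (J i \<inter> ?R) = card (J i) + card ?R"
    using card_Un_Int[OF fin] by simp
  moreover have "card ?R \<le> (\<Sum>j\<in>F - {i}. D j)"
  proof -
    have "card ?R \<le> (\<Sum>j\<in>F - {i}. card (J j))" using assms(1) by (intro card_UN_le) auto
    also have "\<dots> \<le> (\<Sum>j\<in>F - {i}. D j)" using assms(3) by (intro sum_mono) auto
    finally show ?thesis .
  qed
  moreover have "(\<Sum>i\<in>F. D i) = D i + (\<Sum>j\<in>F - {i}. D j)" using assms(1) i by (rule sum.remove)
  ultimately have "card (J i) = D i \<and> card (J i \<inter> ?R) = 0" using assms(3)[OF i] assms(4) by linarith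
  then show "card (J i) = D i" "J i \<inter> ?R = {}" using fin by auto
qed

text \<open>A chain of graphs with a level function \<open>l\<close>: the copy \<open>P i\<close> of \<open>G i\<close> occupies the levels
  between \<open>base i\<close> and \<open>base (Suc i)\<close>, and has a single vertex on its lowest level.\<close>
locale chain =
  fixes G :: "nat \<Rightarrow> 'a ugraph" and k :: nat and P :: "nat \<Rightarrow> 'b set set" and l :: "'b \<Rightarrow> nat"
    and base :: "nat \<Rightarrow> nat"
  assumes G_connected: "i < k \<Longrightarrow> connected_graph (G i)"
    and G_spanned: "i < k \<Longrightarrow> spanned (G i)"
    and G_edges: "i < k \<Longrightarrow> edges (G i) \<noteq> {}"
    and incomparable: "i < k \<Longrightarrow> j < k \<Longrightarrow> i \<noteq> j \<Longrightarrow> \<not> iso_subgraph (G i) (G j)"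
    and copy: "i < k \<Longrightarrow> P i \<in> copies (G i)"
    and base_Suc: "base (Suc i) = base i + diam (G i)"
    and level_bounds: "i < k \<Longrightarrow> x \<in> \<Union>(P i) \<Longrightarrow> base i \<le> l x \<and> l x \<le> base (Suc i)"
    and level_step: "i < k \<Longrightarrow> {x, y} \<in> P i \<Longrightarrow> l y \<le> l x + 1"
    and level_edge: "i < k \<Longrightarrow> base i \<le> t \<Longrightarrow> t < base (Suc i) \<Longrightarrow> \<exists>x y. {x, y} \<in> P i \<and> l x = t \<and> l y = Suc t"
    and bottom_unique: "i < k \<Longrightarrow> x \<in> \<Union>(P i) \<Longrightarrow> y \<in> \<Union>(P i) \<Longrightarrow> l x = base i \<Longrightarrow> l y = base i \<Longrightarrow> x = y"
    and disjoint: "i < k \<Longrightarrow> j < k \<Longrightarrow> i \<noteq> j \<Longrightarrow> P i \<inter> P j = {}"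
begin

lemma base_mono: "i \<le> j \<Longrightarrow> base i \<le> base j"
  by (rule lift_Suc_mono_le) (auto simp: base_Suc)

lemma base_sum: "m \<le> n \<Longrightarrow> base n = base m + (\<Sum>i\<in>{m..<n}. diam (G i))"
  by (induction rule: dec_induct) (auto simp: base_Suc)

lemma base_locate:
  assumes "m \<le> n" "base m \<le> t" "t < base n"
  obtains i where "m \<le> i" "i < n" "base i \<le> t" "t < base (Suc i)"
proof -
  have "\<exists>i. m \<le> i \<and> i < n \<and> base i \<le> t \<and> t < base (Suc i)"
    using assms
  proof (induction n rule: dec_induct)
    case (step n)
    then show ?case by (cases "t < base n") (auto intro: less_SucI)
  qed simp
  then show ?thesis using that by blast
qed

text \<open>Only one of the two endpoints of an edge can be the unique bottom vertex of its copy, so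
  the other one lies strictly higher.\<close>

lemma above:
  assumes "i < k" "m < i" "e \<in> P i"
  shows "\<exists>x\<in>e. base (Suc m) < l x"
proof -
  have "card e = 2" using copies_card_edge[OF G_spanned copy] assms by blast
  then obtain x y where e: "e = {x, y}" "x \<noteq> y" by (auto simp: card_2_iff)
  then have xy: "x \<in> \<Union>(P i)" "y \<in> \<Union>(P i)" using assms by auto
  then have "l x \<noteq> base i \<or> l y \<noteq> base i" using bottom_unique assms(1) e(2) by blast
  moreover have "base i \<le> l x" "base i \<le> l y" using level_bounds assms(1) xy by blast+
  moreover have "base (Suc m) \<le> base i" using assms(2) by (intro base_mono) simp
  ultimately show ?thesis using e by force
qed

text \<open>From \<open>base m\<close> to \<open>base k\<close> there are exactly as many level
  steps as the diameters add up to, so the pieces cross disjoint sets of steps of full size. The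
  piece \<open>i\<close> at the bottom occupies the lowest \<open>diam (G i)\<close> steps, and the
  others lie above it. Comparing \<open>diam (G i)\<close> with \<open>diam (G m)\<close> gives an
  inclusion between \<open>s i\<close> and \<open>P m\<close>, and incomparability forces
  \<open>i = m\<close>.\<close>

lemma peel:
  assumes s: "\<And>i. i < k \<Longrightarrow> s i \<in> copies (G i)" and m: "m < k"
    and U: "(\<Union>i\<in>{m..<k}. s i) = (\<Union>i\<in>{m..<k}. P i)"
  shows "s m = P m" "(\<Union>i\<in>{Suc m..<k}. s i) = (\<Union>i\<in>{Suc m..<k}. P i)"
proof -
  define F where "F = {m..<k}"
  define E where "E = (\<Union>i\<in>F. P i)"
  have E: "(\<Union>i\<in>F. s i) = E" using U by (simp add: F_def E_def)
  have F: "finite F" "m \<in> F" "\<And>i. i \<in> F \<Longrightarrow> i < k" using m by (auto simp: F_def)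
  have sE: "s i \<subseteq> E" if "i \<in> F" for i using E that by blast
  have lip: "l y \<le> l x + diam (G i)" if "i \<in> F" "x \<in> \<Union>(s i)" "y \<in> \<Union>(s i)" for i x y
  proof (rule copies_lipschitz[OF G_connected G_spanned s])
    fix u v assume "{u, v} \<in> s i"
    then have "{u, v} \<in> E" using sE that by blast
    then show "l v \<le> l u + 1" using level_step F by (auto simp: E_def)
  qed (use that F in auto)
  have ne: "e \<noteq> {}" if "e \<in> E" for e
    using copies_card_edge[OF G_spanned copy] F that by (fastforce simp: E_def)

  \<comment> \<open>These are the steps from level \<open>t\<close> to \<open>Suc t\<close> crossed
    by edges of \<open>s i\<close>. Counting steps rather than levels keeps neighbouring pieces
    disjoint although they share a level.\<close>
  define J where "J i = {t \<in> {base m..<base k}. \<exists>x y. {x, y} \<in> s i \<and> l x = t \<and> l y = Suc t}" for i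
  have J_le: "t' < t + diam (G i)" if "i \<in> F" "t \<in> J i" "t' \<in> J i" for i t t'
  proof -
    obtain x y x' y' where "{x, y} \<in> s i" "l x = t" "{x', y'} \<in> s i" "l y' = Suc t'"
      using \<open>t \<in> J i\<close> \<open>t' \<in> J i\<close> by (auto simp: J_def)
    then have "Suc t' \<le> t + diam (G i)" using lip[OF that(1), of x y'] by auto
    then show ?thesis by simp
  qed
  have finJ: "finite (J i)" for i by (simp add: J_def)
  have card_J: "card (J i) \<le> diam (G i)" if i: "i \<in> F" for i
  proof (cases "J i = {}")
    case False
    then have "J i \<subseteq> {Min (J i)..<Min (J i) + diam (G i)}"
      using J_le[OF i Min_in[OF finJ False]] finJ[of i] by auto
    then show ?thesis using card_mono[of "{Min (J i)..<Min (J i) + diam (G i)}" "J i"] by simp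
  qed simp
  have UJ: "(\<Union>i\<in>F. J i) = {base m..<base k}"
  proof (intro subset_antisym subsetI)
    fix t assume t: "t \<in> {base m..<base k}"
    then obtain i where i: "m \<le> i" "i < k" "base i \<le> t" "t < base (Suc i)"
      using base_locate[of m k t] m by auto
    obtain x y where xy: "{x, y} \<in> P i" "l x = t" "l y = Suc t" using level_edge[OF i(2-4)] by blast
    then have "{x, y} \<in> (\<Union>i\<in>F. s i)" unfolding E using i by (auto simp: E_def F_def)
    then show "t \<in> (\<Union>i\<in>F. J i)" using t xy by (auto simp: J_def)
  qed (auto simp: J_def)
  have tight: "(\<Sum>i\<in>F. diam (G i)) \<le> card (\<Union>i\<in>F. J i)"
    unfolding UJ using base_sum[of m k] m by (simp add: F_def)
  \<comment> \<open>The union bound holds with equality, so every \<open>J i\<close> has full size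
    and no two of them overlap.\<close>
  have J_tight: "card (J i) = diam (G i)" "J i \<inter> (\<Union>j\<in>F - {i}. J j) = {}" if "i \<in> F" for i
    using card_UN_tight[of F J "\<lambda>i. diam (G i)" i, OF F(1) finJ card_J tight that] by auto

  have D_pos: "0 < diam (G i)" if "i \<in> F" for i using diam_pos G_connected G_edges F(3) that by blast
  have "base m < base (Suc m)" using D_pos[OF F(2)] by (simp add: base_Suc)
  then have "base m \<in> (\<Union>i\<in>F. J i)" unfolding UJ using base_mono[of "Suc m" k] m by simp
  then obtain i where i: "i \<in> F" "base m \<in> J i" by blast
  obtain x0 y0 where "{x0, y0} \<in> s i" "l x0 = base m" using i(2) by (auto simp: J_def)
  then have low: "l x \<le> base m + diam (G i)" if "x \<in> \<Union>(s i)" for x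
    using lip[OF i(1) _ that, of x0] by auto
  have "J i \<subseteq> {base m..<base m + diam (G i)}"
  proof
    fix t assume t: "t \<in> J i"
    then have "base m \<le> t" by (simp add: J_def)
    then show "t \<in> {base m..<base m + diam (G i)}" using J_le[OF i t] by simp
  qed
  then have Ji: "J i = {base m..<base m + diam (G i)}"
    using J_tight(1)[OF i(1)] by (intro card_seteq) auto
  \<comment> \<open>\<open>J j\<close> has \<open>diam (G j)\<close> elements, all above the steps
    of \<open>J i\<close>, so \<open>s j\<close> reaches level
    \<open>base m + diam (G i) + diam (G j)\<close>; none of its vertices lies more than
    \<open>diam (G j)\<close> below its top.\<close>
  have high: "base m + diam (G i) \<le> l x" if j: "j \<in> F" "j \<noteq> i" and x: "x \<in> \<Union>(s j)" for j x
  proof -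
    have "J j \<inter> J i = {}" using J_tight(2)[OF j(1)] i(1) j(2) by blast
    then have Jj: "base m + diam (G i) \<le> t" if "t \<in> J j" for t
    proof -
      have "t \<notin> {base m..<base m + diam (G i)}" using that \<open>J j \<inter> J i = {}\<close> unfolding Ji by blast
      then show ?thesis using that by (simp add: J_def)
    qed
    have Jne: "J j \<noteq> {}" using J_tight(1)[OF j(1)] D_pos[OF j(1)] by auto
    have "J j \<subseteq> {base m + diam (G i)..Max (J j)}" using Jj finJ by auto
    then have "diam (G j) \<le> Suc (Max (J j)) - (base m + diam (G i))"
      using card_mono[of "{base m + diam (G i)..Max (J j)}" "J j"] J_tight(1)[OF j(1)] by simp
    moreover have "base m + diam (G i) \<le> Max (J j)" using Jj Max_in[OF finJ Jne] by blast
    ultimately have M: "base m + diam (G i) + diam (G j) \<le> Suc (Max (J j))" by linarith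
    have "Max (J j) \<in> J j" using finJ Jne by simp
    moreover have "\<exists>y\<in>\<Union>(s j). l y = Suc t" if "t \<in> J j" for t
      using that unfolding J_def by blast
    ultimately obtain y where "y \<in> \<Union>(s j)" "l y = Suc (Max (J j))" by blast
    then have "Suc (Max (J j)) \<le> l x + diam (G j)" using lip[OF j(1) x, of y] by simp
    then show ?thesis using M by simp
  qed

  have "i = m \<and> s m = P m"
  proof (cases "diam (G i) \<le> diam (G m)")
    case True
    \<comment> \<open>No vertex of \<open>s i\<close> lies above \<open>base (Suc m)\<close>, while
      by \<open>above\<close> each edge of a later \<open>P j\<close> has one that does.\<close>
    have "s i \<subseteq> P m"
    proof
      fix e assume e: "e \<in> s i"
      then obtain j where j: "j \<in> F" "e \<in> P j" using sE[OF i(1)] by (auto simp: E_def)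
      have "l x \<le> base (Suc m)" if "x \<in> e" for x
      proof -
        have "x \<in> \<Union>(s i)" using e that by blast
        from low[OF this] show ?thesis using True by (simp add: base_Suc)
      qed
      then have "\<not> m < j" using above[of j m e] j F(3) by fastforce
      then show "e \<in> P m" using j by (auto simp: F_def)
    qed
    moreover from this have "i = m"
      using incomparable[of i m] iso_subgraph_copies[OF G_spanned G_spanned s copy, of i m] F i(1) by blast
    ultimately show ?thesis
      using copies_card[OF G_spanned s] copies_card[OF G_spanned copy] copies_finite[OF G_spanned copy] m
      by (metis card_seteq order_refl)
  next
    case False
    \<comment> \<open>The strict inequality places the vertices of \<open>P m\<close> below every
      vertex of the pieces other than \<open>s i\<close>. The case is contradictory in the end,
      since \<open>i = m\<close> makes the diameters equal.\<close>
    have "P m \<subseteq> s i"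
    proof
      fix e assume e: "e \<in> P m"
      then have eE: "e \<in> E" using F(2) by (auto simp: E_def)
      then obtain j where j: "j \<in> F" "e \<in> s j" using E by blast
      obtain x where x: "x \<in> e" using ne[OF eE] by blast
      have "l x \<le> base (Suc m)" using level_bounds[OF m, of x] e x by blast
      then have "l x < base m + diam (G i)" using False by (simp add: base_Suc)
      then have "j = i" using high[OF j(1), of x] j(2) x by fastforce
      then show "e \<in> s i" using j by simp
    qed
    then have "i = m"
      using incomparable[of m i] iso_subgraph_copies[OF G_spanned G_spanned copy s, of m i] F i(1) by blast
    then show ?thesis using False by simp
  qed
  then show sm: "s m = P m" by simp

  have cards: "card (s i) = card (edges (G i))" "card (P i) = card (edges (G i))" "finite (s i)" "finite (P i)" if "i \<in> F" for i
    using F(3)[OF that] copies_card[OF G_spanned s] copies_card[OF G_spanned copy]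
      copies_finite[OF G_spanned s] copies_finite[OF G_spanned copy] by auto
  have "card E = (\<Sum>i\<in>F. card (P i))"
    unfolding E_def using F disjoint cards by (intro card_UN_disjoint) auto
  then have "(\<Sum>i\<in>F. card (edges (G i))) \<le> card (\<Union>i\<in>F. s i)" unfolding E using cards by simp
  then have disj: "s m \<inter> (\<Union>j\<in>F - {m}. s j) = {}"
    using F cards by (intro card_UN_tight(2)[where D = "\<lambda>i. card (edges (G i))"]) auto
  have Fm: "F - {m} = {Suc m..<k}" "F = insert m {Suc m..<k}" using m by (auto simp: F_def)
  have "(\<Union>i\<in>{Suc m..<k}. s i) = E - s m"
  proof -
    have "E = s m \<union> (\<Union>i\<in>{Suc m..<k}. s i)" unfolding E[symmetric] Fm(2) by simp
    moreover have "s m \<inter> (\<Union>i\<in>{Suc m..<k}. s i) = {}" using disj unfolding Fm(1) .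
    ultimately show ?thesis by blast
  qed
  also have "\<dots> = (\<Union>i\<in>{Suc m..<k}. P i)"
  proof -
    have "P m \<inter> (\<Union>i\<in>{Suc m..<k}. P i) = {}" using disjoint[of m] m by fastforce
    then show ?thesis unfolding sm E_def Fm(2) by blast
  qed
  finally show "(\<Union>i\<in>{Suc m..<k}. s i) = (\<Union>i\<in>{Suc m..<k}. P i)" .
qed

theorem unique_decomposition:
  assumes s: "\<And>i. i < k \<Longrightarrow> s i \<in> copies (G i)" and U: "(\<Union>i<k. s i) = (\<Union>i<k. P i)" and i: "i < k"
  shows "s i = P i"
proof -
  have "(\<forall>i<m. s i = P i) \<and> (\<Union>i\<in>{m..<k}. s i) = (\<Union>i\<in>{m..<k}. P i)" if "m \<le> k" for m
    using that
  proof (induction m)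
    case 0
    then show ?case using U by (simp add: atLeast0LessThan)
  next
    case (Suc m)
    then show ?case using peel[of s m] s by (auto simp: less_Suc_eq)
  qed
  then show ?thesis using i by blast
qed

end

section \<open>Construction of the chain on natural numbers\<close>

lemma chain_gluing_exists:
  fixes G :: "nat \<Rightarrow> 'a ugraph"
  assumes conn: "\<And>i. i < k \<Longrightarrow> connected_graph (G i)" and ne: "\<And>i. i < k \<Longrightarrow> edges (G i) \<noteq> {}"
    and incomp: "\<And>i j. i < k \<Longrightarrow> j < k \<Longrightarrow> i \<noteq> j \<Longrightarrow> \<not> iso_subgraph (G i) (G j)"
  shows "\<exists>P :: nat \<Rightarrow> nat set set. (\<forall>i<k. P i \<in> copies (G i)) \<and>
    (\<forall>i j. i < j \<longrightarrow> j < k \<longrightarrow> (\<Union>(P i) \<inter> \<Union>(P j) \<noteq> {} \<longleftrightarrow> j = Suc i)) \<and>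
    (\<forall>i<k. \<forall>j<k. i \<noteq> j \<longrightarrow> P i \<inter> P j = {}) \<and>
    (\<forall>s. (\<forall>i<k. s i \<in> copies (G i)) \<longrightarrow> (\<Union>i<k. s i) = (\<Union>i<k. P i) \<longrightarrow> (\<forall>i<k. s i = P i))"
proof -
  have sp: "spanned (G i)" if "i < k" for i using spanned_connected_graph conn ne that by blast
  have "\<exists>a b. i < k \<longrightarrow> a \<in> verts (G i) \<and> b \<in> verts (G i) \<and> gdist (G i) a b = diam (G i)" for i
    using diam_attained conn by metis
  then obtain a b where ab: "\<And>i. i < k \<Longrightarrow> a i \<in> verts (G i)" "\<And>i. i < k \<Longrightarrow> b i \<in> verts (G i)"
    "\<And>i. i < k \<Longrightarrow> gdist (G i) (a i) (b i) = diam (G i)" by metis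
  have ab_ne: "a i \<noteq> b i" if "i < k" for i
    using ab(3)[OF that] diam_pos[OF conn ne, OF that that] gdist_self[OF conn[OF that]] by auto
  define base where "base i = (\<Sum>j<i. diam (G j))" for i
  have "finite (\<Union>i<k. verts (G i))" using finite_verts[OF conn] by auto
  from finite_imp_inj_to_nat_seg[OF this] obtain h :: "'a \<Rightarrow> nat"
    where h: "inj_on h (\<Union>i<k. verts (G i))" by (elim exE conjE)
  define h' where "h' = inv_into (\<Union>i<k. verts (G i)) h"
  have h': "h' (h v) = v" if "i < k" "v \<in> verts (G i)" for i v
    unfolding h'_def using h that by (intro inv_into_f_f) auto
  \<comment> \<open>Vertex \<open>v\<close> of \<open>G i\<close> receives the code of the pair of
    \<open>i\<close> and \<open>h v\<close>, except that the start \<open>a i\<close> of a later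
    graph takes the code of the end \<open>b (i - 1)\<close> of its predecessor. As
    \<open>a i\<close> and \<open>b i\<close> differ, each end keeps its own code.\<close>
  define g where "g i v = (if 0 < i \<and> v = a i then prod_encode (i - 1, h (b (i - 1))) else prod_encode (i, h v))" for i v
  \<comment> \<open>The level is read off from the code; at a junction,
    \<open>base (i - 1) + diam (G (i - 1))\<close> agrees with \<open>base i\<close>.\<close>
  define l where "l x = (case prod_decode x of (i, m) \<Rightarrow> base i + gdist (G i) (a i) (h' m))" for x
  define P where "P i = (`) (g i) ` edges (G i)" for i
  have g_inj: "inj_on (g i) (verts (G i))" if "i < k" for i
  proof (rule inj_onI)
    fix u v assume "u \<in> verts (G i)" "v \<in> verts (G i)" "g i u = g i v"
    then have "u = v \<or> h u = h v" by (auto simp: g_def split: if_splits)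
    then show "u = v" using h'[OF that] \<open>u \<in> verts (G i)\<close> \<open>v \<in> verts (G i)\<close> by metis
  qed
  have UP: "\<Union>(P i) = g i ` verts (G i)" if "i < k" for i
    unfolding P_def by (rule Union_image_edges[OF sp[OF that]])
  have copy: "P i \<in> copies (G i)" if "i < k" for i using g_inj[OF that] by (auto simp: P_def copies_def)
  have base_Suc: "base (Suc i) = base i + diam (G i)" for i by (simp add: base_def)
  have l_g: "l (g i v) = base i + gdist (G i) (a i) v" if i: "i < k" and v: "v \<in> verts (G i)" for i v
  proof (cases "0 < i \<and> v = a i")
    case True
    then have "i - 1 < k" "Suc (i - 1) = i" using i by auto
    then show ?thesis
      using True base_Suc[of "i - 1"] ab gdist_self[OF conn[OF i]] by (simp add: g_def l_def h')
  qed (use h' i v in \<open>auto simp: g_def l_def\<close>)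
  have junction: "g (Suc i) (a (Suc i)) = g i (b i)" if "Suc i < k" for i
    using ab_ne[of i] that by (auto simp: g_def)
  \<comment> \<open>Codes from different graphs agree only at a junction, so a pair of pieces has at
    most one common vertex, which is too few for a common edge.\<close>
  have meet: "j = Suc i \<and> x = g i (b i)" if ij: "i < j" "j < k" and x: "x \<in> \<Union>(P i)" "x \<in> \<Union>(P j)" for i j x
  proof -
    obtain u v where uv: "x = g i u" "x = g j v" "u \<in> verts (G i)" "v \<in> verts (G j)"
      using x UP[of i] UP[of j] ij by (metis imageE less_trans)
    then have eq: "g i u = g j v" by simp
    have "j = Suc i \<and> \<not> (0 < i \<and> u = a i) \<and> h u = h (b i)"
    proof (cases "0 < i \<and> u = a i"; cases "v = a j")
      assume "0 < i \<and> u = a i" "v = a j"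
      then have "i - 1 = j - 1" "0 < i" using eq ij by (simp_all add: g_def)
      then show ?thesis using ij by linarith
    next
      assume "0 < i \<and> u = a i" "v \<noteq> a j"
      then have "i - 1 = j" using eq ij by (simp add: g_def)
      then show ?thesis using ij by linarith
    next
      assume u: "\<not> (0 < i \<and> u = a i)" and v: "v = a j"
      have "g i u = prod_encode (i, h u)" unfolding g_def using u by (rule if_not_P)
      moreover have "g j v = prod_encode (j - 1, h (b (j - 1)))" using v ij by (simp add: g_def)
      ultimately have "prod_encode (i, h u) = prod_encode (j - 1, h (b (j - 1)))" using eq by (simp only:)
      then have j: "i = j - 1" "h u = h (b (j - 1))" by (simp_all only: prod_encode_eq prod.inject)
      then have "j = Suc i" using ij by linarith
      then show ?thesis using u j by auto
    next
      assume u: "\<not> (0 < i \<and> u = a i)" and v: "v \<noteq> a j"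
      have "g i u = prod_encode (i, h u)" unfolding g_def using u by (rule if_not_P)
      moreover have "g j v = prod_encode (j, h v)" using v by (simp add: g_def)
      ultimately show ?thesis using eq ij by simp
    qed
    moreover have "h' (h u) = u" "h' (h (b i)) = b i" using h' uv(3) ab(2) ij by (meson less_trans)+
    ultimately have "j = Suc i" "u = b i" by metis+
    then show ?thesis using uv(1) by simp
  qed
  have single: "P i \<inter> P j = {}" if "i < j" "j < k" for i j
  proof (rule ccontr)
    assume "P i \<inter> P j \<noteq> {}"
    then obtain e where e: "e \<in> P i" "e \<in> P j" by blast
    then have "card e = 2" using copies_card_edge[OF sp copy] that by (meson less_trans)
    moreover have "e \<subseteq> {g i (b i)}" using meet[OF that] e by blast
    ultimately show False using card_mono[of "{g i (b i)}" e] by simp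
  qed
  have disj: "P i \<inter> P j = {}" if "i < k" "j < k" "i \<noteq> j" for i j
    using single[of i j] single[of j i] that by (cases "i < j") (auto simp: Int_commute)
  have vert: "x \<in> verts (G i) \<and> y \<in> verts (G i)" if "{x, y} \<in> edges (G i)" "i < k" for i x y
    using sp[OF that(2)] that(1) by (auto simp: spanned_def)
  interpret chain G k P l base
  proof
    show "base (Suc i) = base i + diam (G i)" for i by (rule base_Suc)
    fix i assume i: "i < k"
    show "base i \<le> l x \<and> l x \<le> base (Suc i)" if "x \<in> \<Union>(P i)" for x
      using that l_g[OF i] gdist_le_diam[OF conn[OF i] ab(1)[OF i]] by (auto simp: UP[OF i] base_Suc)
    show "l y \<le> l x + 1" if xy: "{x, y} \<in> P i" for x y
    proof -
      obtain e where e: "e \<in> edges (G i)" "{x, y} = g i ` e" using xy by (auto simp: P_def)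
      obtain u v where uv: "e = {u, v}" "u \<in> verts (G i)" "v \<in> verts (G i)"
        using wf_graph_edgeE[OF _ e(1)] sp[OF i] unfolding spanned_def by metis
      have "gdist (G i) (a i) v \<le> gdist (G i) (a i) u + 1" "gdist (G i) (a i) u \<le> gdist (G i) (a i) v + 1"
        using gdist_edge[OF conn[OF i] ab(1)[OF i]] e(1) uv(1) by (auto simp: insert_commute)
      then have "l (g i v) \<le> l (g i u) + 1" "l (g i u) \<le> l (g i v) + 1" using l_g[OF i] uv by auto
      moreover have "x = g i u \<and> y = g i v \<or> x = g i v \<and> y = g i u"
        using e(2) uv(1) by (auto simp: doubleton_eq_iff)
      ultimately show ?thesis by auto
    qed
    show "\<exists>x y. {x, y} \<in> P i \<and> l x = t \<and> l y = Suc t" if t: "base i \<le> t" "t < base (Suc i)" for t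
    proof -
      have "t - base i < gdist (G i) (a i) (b i)" using t ab(3)[OF i] by (simp add: base_Suc)
      then obtain u v where uv: "{u, v} \<in> edges (G i)" "gdist (G i) (a i) u = t - base i"
          "gdist (G i) (a i) v = Suc (t - base i)"
        using gdist_level_edge[OF conn[OF i] ab(1,2)[OF i]] by blast
      have "g i ` {u, v} \<in> P i" unfolding P_def using uv(1) by (rule imageI)
      then have "{g i u, g i v} \<in> P i" by simp
      moreover have "l (g i u) = t" "l (g i v) = Suc t"
        using l_g[OF i] vert[OF uv(1) i] uv t by auto
      ultimately show ?thesis by blast
    qed
    show "x = y" if xy: "x \<in> \<Union>(P i)" "y \<in> \<Union>(P i)" "l x = base i" "l y = base i" for x y
    proof -
      obtain u v where uv: "x = g i u" "y = g i v" "u \<in> verts (G i)" "v \<in> verts (G i)"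
        using xy UP[OF i] by auto
      then have "gdist (G i) (a i) u = 0" "gdist (G i) (a i) v = 0" using xy l_g[OF i] by auto
      then have "a i = u" "a i = v" using gdist_eq_0[OF conn[OF i] ab(1)[OF i]] uv by auto
      then show ?thesis using uv by simp
    qed
  qed (use conn sp ne incomp copy disj in auto)
  have "\<Union>(P i) \<inter> \<Union>(P j) \<noteq> {} \<longleftrightarrow> j = Suc i" if ij: "i < j" "j < k" for i j
  proof
    assume "j = Suc i"
    then have "g i (b i) = g j (a j)" using junction[of i] ij by simp
    then have "g i (b i) \<in> \<Union>(P j)" using UP[of j] ab(1)[of j] ij by simp
    moreover have "g i (b i) \<in> \<Union>(P i)" using UP[of i] ab(2)[of i] ij by auto
    ultimately show "\<Union>(P i) \<inter> \<Union>(P j) \<noteq> {}" by blast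
  qed (use meet[OF ij] in blast)
  then show ?thesis
    using copy disj unique_decomposition by (intro exI[of _ P] conjI allI impI) auto
qed

section \<open>Paths are trees\<close>

text \<open>In a cycle, both neighbours of the largest vertex would have to be the number preceding
  it.\<close>

lemma path_is_tree:
  assumes "k > 0"
  shows "is_tree ({..<k}, {{i, Suc i} | i. Suc i < k})" (is "is_tree ?T")
  unfolding is_tree_def
proof
  have wf: "wf_graph ?T" by (auto simp: wf_graph_def)
  have adj: "(i, Suc i) \<in> adj_rel ?T" "(Suc i, i) \<in> adj_rel ?T" if "Suc i < k" for i
    using that by (auto simp: adj_rel_def insert_commute)
  have from0: "(0, v) \<in> (adj_rel ?T)\<^sup>* \<and> (v, 0) \<in> (adj_rel ?T)\<^sup>*" if "v < k" for v
    using that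
  proof (induction v)
    case (Suc v)
    then have "(0, v) \<in> (adj_rel ?T)\<^sup>*" "(v, 0) \<in> (adj_rel ?T)\<^sup>*" by auto
    then show ?case using adj[OF Suc.prems]
      by (meson converse_rtrancl_into_rtrancl rtrancl_into_rtrancl)
  qed simp
  then show "connected_graph ?T"
    unfolding connected_graph_def using wf assms by (auto intro: rtrancl_trans)
  show "acyclic_graph ?T" unfolding acyclic_graph_def
  proof
    assume "\<exists>cs. length cs \<ge> 3 \<and> distinct cs \<and> set cs \<subseteq> verts ?T \<and>
      (\<forall>i < length cs. {cs ! i, cs ! ((i + 1) mod length cs)} \<in> edges ?T)"
    then obtain cs where cs: "length cs \<ge> 3" "distinct cs"
      "\<And>i. i < length cs \<Longrightarrow> {cs ! i, cs ! ((i + 1) mod length cs)} \<in> edges ?T" by blast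
    let ?L = "length cs"
    have "set cs \<noteq> {}" using cs(1) by auto
    then have "Max (set cs) \<in> set cs" by simp
    then obtain m where m: "m < ?L" "cs ! m = Max (set cs)" by (auto simp: in_set_conv_nth)
    \<comment> \<open>Cyclic successor and predecessor of position \<open>m\<close>; length at least
      3 makes them distinct.\<close>
    define m1 m0 where "m1 = (m + 1) mod ?L" and "m0 = (if m = 0 then ?L - 1 else m - 1)"
    have idx: "m1 < ?L" "m0 < ?L" "(m0 + 1) mod ?L = m" "m0 \<noteq> m1"
    proof -
      show "m1 < ?L" "m0 < ?L" using m cs(1) unfolding m1_def m0_def
        by (auto intro!: mod_less_divisor)
      show "(m0 + 1) mod ?L = m" using m cs(1) by (auto simp: m0_def)
      show "m0 \<noteq> m1"
      proof (cases "m + 1 = ?L")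
        case True
        then have "m1 = 0" "m0 = m - 1" "m \<ge> 2" using cs(1) by (auto simp: m1_def m0_def)
        then show ?thesis by simp
      next
        case False
        then have "m1 = m + 1" using m by (simp add: m1_def)
        then show ?thesis using False m cs(1) by (auto simp: m0_def)
      qed
    qed
    have "Suc x = cs ! m" if "x \<in> set cs" "{x, cs ! m} \<in> edges ?T" for x
    proof -
      have "x \<le> cs ! m" using that m by simp
      then show ?thesis using that(2) by (auto simp: doubleton_eq_iff)
    qed
    then have "Suc (cs ! m0) = cs ! m" "Suc (cs ! m1) = cs ! m"
      using cs(3)[OF m(1)] cs(3)[OF idx(2)] idx by (auto simp: m1_def insert_commute)
    then have "cs ! m0 = cs ! m1" by simp
    then show False using idx cs(2) by (simp add: nth_eq_iff_index_eq)
  qed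
qed

section \<open>Counting copies of a disjoint union\<close>

lemma verts_disj_union: "verts (disj_union k G) = (\<Union>i<k. Pair i ` verts (G i))"
  by (auto simp: disj_union_def)

lemma edges_disj_union:
  assumes "\<And>i. i < k \<Longrightarrow> wf_graph (G i)"
  shows "edges (disj_union k G) = (\<Union>i<k. (`) (Pair i) ` edges (G i))"
proof (intro subset_antisym subsetI)
  fix e assume "e \<in> edges (disj_union k G)"
  then obtain i u v where "e = Pair i ` {u, v}" "i < k" "{u, v} \<in> edges (G i)"
    by (auto simp: disj_union_def)
  then show "e \<in> (\<Union>i<k. (`) (Pair i) ` edges (G i))" by blast
next
  fix e assume "e \<in> (\<Union>i<k. (`) (Pair i) ` edges (G i))"
  then obtain i e' where e: "i < k" "e' \<in> edges (G i)" "e = Pair i ` e'" by blast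
  obtain u v where uv: "e' = {u, v}" using wf_graph_edgeE[OF assms[OF e(1)] e(2)] by metis
  then have "e = {(i, u), (i, v)}" using e(3) by simp
  then show "e \<in> edges (disj_union k G)" using e uv unfolding disj_union_def by auto
qed

lemma spanned_disj_union:
  assumes "\<And>i. i < k \<Longrightarrow> spanned (G i)"
  shows "spanned (disj_union k G)"
proof -
  have wf: "wf_graph (G i)" and U: "\<Union>(edges (G i)) = verts (G i)" if "i < k" for i
    using assms[OF that] by (auto simp: spanned_def)
  have ed: "edges (disj_union k G) = (\<Union>i<k. (`) (Pair i) ` edges (G i))"
    using wf by (rule edges_disj_union)
  have "\<Union>(edges (disj_union k G)) = (\<Union>i<k. Pair i ` \<Union>(edges (G i)))"
    unfolding ed by auto
  also have "\<dots> = verts (disj_union k G)" unfolding verts_disj_union using U by auto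
  finally have "\<Union>(edges (disj_union k G)) = verts (disj_union k G)" .
  moreover have "wf_graph (disj_union k G)"
    unfolding wf_graph_def
  proof (intro conjI ballI)
    show "finite (verts (disj_union k G))"
      unfolding verts_disj_union using wf by (auto simp: wf_graph_def)
    fix e assume e: "e \<in> edges (disj_union k G)"
    then show "e \<subseteq> verts (disj_union k G)" using calculation by blast
    obtain i e' where "i < k" "e' \<in> edges (G i)" "e = Pair i ` e'"
      using e unfolding ed by blast
    then show "card e = 2" using wf by (simp add: wf_graph_def card_image inj_on_def)
  qed
  ultimately show ?thesis by (simp add: spanned_def)
qed

lemma subgraph_count_copies:
  assumes "spanned A" "S \<subseteq> all_pairs n"
  shows "subgraph_count A ({..<n}, S) = card {U \<in> copies A. U \<subseteq> S}"
proof -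
  have "{H. subgraph H ({..<n}, S) \<and> graph_iso H A} = (\<lambda>U. (\<Union>U, U)) ` {U \<in> copies A. U \<subseteq> S}"
  proof (intro subset_antisym subsetI)
    fix H assume "H \<in> {H. subgraph H ({..<n}, S) \<and> graph_iso H A}"
    then have H: "wf_graph H" "graph_iso H A" "edges H \<subseteq> S" by (auto simp: subgraph_def)
    have "H = (\<Union>(edges H), edges H)"
      using spanned_iso(1)[OF assms(1) H(1,2)] by (simp add: verts_def edges_def prod_eq_iff)
    then show "H \<in> (\<lambda>U. (\<Union>U, U)) ` {U \<in> copies A. U \<subseteq> S}"
      using spanned_iso(2)[OF assms(1) H(1,2)] H(3) by blast
  next
    fix H assume "H \<in> (\<lambda>U. (\<Union>U, U)) ` {U \<in> copies A. U \<subseteq> S}"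
    then obtain U where U: "U \<in> copies A" "U \<subseteq> S" "H = (\<Union>U, U)" by blast
    have "\<Union>U \<subseteq> {..<n}" using U(2) assms(2) by (auto simp: all_pairs_def)
    then show "H \<in> {H. subgraph H ({..<n}, S) \<and> graph_iso H A}"
      using copies_graph[OF assms(1) U(1)] U by (simp add: subgraph_def)
  qed
  then show ?thesis unfolding subgraph_count_def by (simp add: card_image inj_on_def)
qed

lemma copies_disj_union_iff:
  assumes sp: "\<And>i. i < k \<Longrightarrow> spanned (G i)"
  shows "U \<in> copies (disj_union k G) \<longleftrightarrow>
    (\<exists>s. (\<forall>i<k. s i \<in> copies (G i)) \<and> (\<forall>i<k. \<forall>j<k. i \<noteq> j \<longrightarrow> \<Union>(s i) \<inter> \<Union>(s j) = {}) \<and> U = (\<Union>i<k. s i))"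
    (is "_ \<longleftrightarrow> (\<exists>s. ?Q s)")
proof
  have wf: "wf_graph (G i)" if "i < k" for i using sp[OF that] by (simp add: spanned_def)
  have ed: "edges (disj_union k G) = (\<Union>i<k. (`) (Pair i) ` edges (G i))"
    using wf by (rule edges_disj_union)
  {
    assume "U \<in> copies (disj_union k G)"
    then obtain g where g: "inj_on g (verts (disj_union k G))" "U = (`) g ` edges (disj_union k G)"
      by (auto simp: copies_def)
    define s where "s i = (`) (g \<circ> Pair i) ` edges (G i)" for i
    have Us: "\<Union>(s i) = g ` Pair i ` verts (G i)" if "i < k" for i
      unfolding s_def Union_image_edges[OF sp[OF that]] by (simp add: image_comp)
    have "U = (\<Union>i<k. s i)"
      unfolding g(2) ed s_def by (simp add: image_UN image_comp comp_def image_image)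
    moreover have "s i \<in> copies (G i)" if i: "i < k" for i
    proof -
      have "inj_on (g \<circ> Pair i) (verts (G i))"
        using i by (intro comp_inj_on inj_on_subset[OF g(1)]) (auto simp: inj_on_def verts_disj_union)
      then show ?thesis unfolding copies_def s_def by blast
    qed
    moreover have "\<Union>(s i) \<inter> \<Union>(s j) = {}" if "i < k" "j < k" "i \<noteq> j" for i j
    proof -
      have "g ` (Pair i ` verts (G i)) \<inter> g ` (Pair j ` verts (G j)) = g ` (Pair i ` verts (G i) \<inter> Pair j ` verts (G j))"
        using that by (intro inj_on_image_Int[OF g(1), symmetric]) (auto simp: verts_disj_union)
      also have "Pair i ` verts (G i) \<inter> Pair j ` verts (G j) = {}" using that(3) by auto
      finally show ?thesis using that Us by simp
    qed
    ultimately show "\<exists>s. ?Q s" by blast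
  next
    assume "\<exists>s. ?Q s"
    then obtain s where s: "\<And>i. i < k \<Longrightarrow> s i \<in> copies (G i)" "U = (\<Union>i<k. s i)"
      "\<And>i j. i < k \<Longrightarrow> j < k \<Longrightarrow> i \<noteq> j \<Longrightarrow> \<Union>(s i) \<inter> \<Union>(s j) = {}" by blast
    have "\<exists>g. i < k \<longrightarrow> inj_on g (verts (G i)) \<and> s i = (`) g ` edges (G i)" for i
      using s(1)[of i] by (auto simp: copies_def)
    then obtain g where g: "\<And>i. i < k \<Longrightarrow> inj_on (g i) (verts (G i))"
      "\<And>i. i < k \<Longrightarrow> s i = (`) (g i) ` edges (G i)" by metis
    have Us: "\<Union>(s i) = g i ` verts (G i)" if "i < k" for i
      unfolding g(2)[OF that] by (rule Union_image_edges[OF sp[OF that]])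
    define f where "f = (\<lambda>(i, v). g i v)"
    have "inj_on f (verts (disj_union k G))"
    proof (rule inj_onI)
      fix x y assume xy: "x \<in> verts (disj_union k G)" "y \<in> verts (disj_union k G)" "f x = f y"
      then obtain i u j v where iv: "x = (i, u)" "y = (j, v)" "i < k" "j < k" "u \<in> verts (G i)" "v \<in> verts (G j)"
        by (auto simp: verts_disj_union)
      then have eq: "g i u = g j v" using xy by (simp add: f_def)
      have "g i u \<in> \<Union>(s i)" unfolding Us[OF iv(3)] using iv(5) by (rule imageI)
      moreover have "g i u \<in> \<Union>(s j)" unfolding Us[OF iv(4)] eq using iv(6) by (rule imageI)
      ultimately have "g i u \<in> \<Union>(s i) \<inter> \<Union>(s j)" by blast
      then have "i = j" using s(3)[of i j] iv by blast
      then show "x = y" using eq iv g(1)[of i] by (simp add: inj_on_def)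
    qed
    moreover have "U = (`) f ` edges (disj_union k G)"
      unfolding ed s(2) using g(2) by (auto simp: image_UN image_image f_def)
    ultimately show "U \<in> copies (disj_union k G)" unfolding copies_def by blast
  }
qed

text \<open>The union determines the tuple, so copies are counted without multiplicity: a connected
  \<open>s i\<close> covered by vertex-disjoint pieces \<open>t j\<close> lies in a single one, and
  incomparability gives \<open>j = i\<close>.\<close>

lemma subgraph_count_disj_union:
  fixes G :: "nat \<Rightarrow> 'a ugraph"
  assumes sp: "\<And>i. i < k \<Longrightarrow> spanned (G i)" and conn: "\<And>i. i < k \<Longrightarrow> connected_graph (G i)"
    and ne: "\<And>i. i < k \<Longrightarrow> edges (G i) \<noteq> {}"
    and incomp: "\<And>i j. i < k \<Longrightarrow> j < k \<Longrightarrow> i \<noteq> j \<Longrightarrow> \<not> iso_subgraph (G i) (G j)"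
    and S: "S \<subseteq> all_pairs n"
  shows "int (subgraph_count (disj_union k G) ({..<n}, S)) = disjoint_count (\<lambda>i. copies (G i)) {..<k} S"
proof -
  let ?P = "PiE {..<k} (\<lambda>i. copies (G i) \<inter> Pow S)"
  define Q where "Q = {s \<in> ?P. \<forall>i<k. \<forall>j<k. i \<noteq> j \<longrightarrow> \<not> touching s i j}"
  have "finite S" using S by (rule finite_subset) simp
  then have fin: "finite ?P" by (intro finite_PiE) auto
  have Qs: "s i \<in> copies (G i)" "s i \<subseteq> S" if "s \<in> Q" "i < k" for s i
    using that by (auto simp: Q_def PiE_def Pi_def)
  have Qd: "\<Union>(s i) \<inter> \<Union>(s j) = {}" if "s \<in> Q" "i < k" "j < k" "i \<noteq> j" for s i j
    using that by (auto simp: Q_def touching_def)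
  have sub: "s i \<subseteq> t i" if st: "s \<in> Q" "t \<in> Q" "(\<Union>i<k. s i) = (\<Union>i<k. t i)" and i: "i < k" for s t i
  proof -
    have ec: "edge_connected (s i)" using copies_edge_connected[OF sp conn ne Qs(1)] st(1) i by blast
    obtain e where e: "e \<in> s i" using ec by (auto simp: edge_connected_def)
    then have "e \<in> (\<Union>i<k. t i)" using st(3) i by auto
    then obtain j where j: "j < k" "e \<in> t j" by blast
    have "s i = (s i \<inter> t j) \<union> (s i - t j)" by blast
    moreover have "s i \<inter> t j \<noteq> {}" using e j by blast
    moreover have "\<Union>(s i \<inter> t j) \<inter> \<Union>(s i - t j) = {}"
    proof -
      have "s i - t j \<subseteq> (\<Union>m\<in>{..<k} - {j}. t m)" using st(3) i by blast
      then have "\<Union>(s i - t j) \<subseteq> (\<Union>m\<in>{..<k} - {j}. \<Union>(t m))" by blast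
      moreover have "\<Union>(t j) \<inter> (\<Union>m\<in>{..<k} - {j}. \<Union>(t m)) = {}"
        using Qd[OF st(2) j(1)] by fastforce
      ultimately show ?thesis by blast
    qed
    ultimately have "s i - t j = {}" using ec unfolding edge_connected_def by metis
    then have sub: "s i \<subseteq> t j" by blast
    then have "iso_subgraph (G i) (G j)"
      using iso_subgraph_copies[OF sp sp Qs(1) Qs(1)] i j st by blast
    then have "i = j" using incomp i j by blast
    then show ?thesis using sub by simp
  qed
  have cp: "U \<in> copies (disj_union k G) \<longleftrightarrow> (\<exists>s. (\<forall>i<k. s i \<in> copies (G i)) \<and>
      (\<forall>i<k. \<forall>j<k. i \<noteq> j \<longrightarrow> \<Union>(s i) \<inter> \<Union>(s j) = {}) \<and> U = (\<Union>i<k. s i))" for U :: "nat set set"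
    using sp by (rule copies_disj_union_iff)
  have inj: "inj_on (\<lambda>s. \<Union>i<k. s i) Q"
  proof (rule inj_onI)
    fix s t assume st: "s \<in> Q" "t \<in> Q" "(\<Union>i<k. s i) = (\<Union>i<k. t i)"
    have "s i = t i" if "i < k" for i using sub[OF st that] sub[OF st(2,1) st(3)[symmetric] that] by blast
    moreover have "s \<in> extensional {..<k}" "t \<in> extensional {..<k}" using st by (auto simp: Q_def PiE_def)
    ultimately show "s = t" by (intro extensionalityI[of s "{..<k}" t]) auto
  qed
  have "{U \<in> copies (disj_union k G). U \<subseteq> S} = (\<lambda>s. \<Union>i<k. s i) ` Q"
  proof (intro subset_antisym subsetI)
    fix U assume "U \<in> {U \<in> copies (disj_union k G). U \<subseteq> S}"
    then obtain s where s: "\<forall>i<k. s i \<in> copies (G i)" "U = (\<Union>i<k. s i)"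
      "\<forall>i<k. \<forall>j<k. i \<noteq> j \<longrightarrow> \<Union>(s i) \<inter> \<Union>(s j) = {}" "U \<subseteq> S"
      unfolding mem_Collect_eq cp by blast
    have "restrict s {..<k} \<in> Q" using s by (auto simp: Q_def touching_def)
    moreover have "U = (\<Union>i<k. restrict s {..<k} i)" using s by simp
    ultimately show "U \<in> (\<lambda>s. \<Union>i<k. s i) ` Q" by blast
  next
    fix U assume "U \<in> (\<lambda>s. \<Union>i<k. s i) ` Q"
    then obtain s where s: "s \<in> Q" "U = (\<Union>i<k. s i)" by blast
    then show "U \<in> {U \<in> copies (disj_union k G). U \<subseteq> S}"
      unfolding mem_Collect_eq cp using Qs[OF s(1)] Qd[OF s(1)] by blast
  qed
  then have "subgraph_count (disj_union k G) ({..<n}, S) = card Q"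
    using subgraph_count_copies[OF spanned_disj_union[of k G] S] sp by (simp add: card_image[OF inj])
  moreover have "disjoint_count (\<lambda>i. copies (G i)) {..<k} S = (\<Sum>s\<in>?P. of_bool (s \<in> Q))"
    unfolding disjoint_count_def by (intro sum.cong refl) (auto simp: no_edges_def Q_def)
  moreover have "(\<Sum>s\<in>?P. of_bool (s \<in> Q)) = int (card Q)"
  proof -
    have "?P \<inter> {s. s \<in> Q} = Q" by (auto simp: Q_def)
    then show ?thesis using fin by (simp add: sum_of_bool_eq)
  qed
  ultimately show ?thesis by simp
qed

text \<open>An edgeless connected graph is a single vertex, which embeds into each of the other
  graphs. This is what allows copies to be encoded by edge sets.\<close>

lemma incomparable_edges_nonempty:
  fixes G :: "nat \<Rightarrow> 'a ugraph"
  assumes "k \<ge> 2" and conn: "\<And>i. i < k \<Longrightarrow> connected_graph (G i)"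
    and incomp: "\<And>i j. i < k \<Longrightarrow> j < k \<Longrightarrow> i \<noteq> j \<Longrightarrow> \<not> iso_subgraph (G i) (G j)"
    and i: "i < k"
  shows "edges (G i) \<noteq> {}"
proof
  assume E: "edges (G i) = {}"
  obtain j where j: "j < k" "j \<noteq> i"
    by (rule that[of "if i = 0 then 1 else 0"]) (use assms(1) in auto)
  obtain v where v: "v \<in> verts (G i)" using conn[OF i] by (auto simp: connected_graph_def)
  obtain w where w: "w \<in> verts (G j)" using conn[OF j(1)] by (auto simp: connected_graph_def)
  have "adj_rel (G i) = {}" using E by (simp add: adj_rel_def)
  then have V: "verts (G i) = {v}" using conn[OF i] v by (auto simp: connected_graph_def)
  let ?S = "({w}, {}) :: 'a ugraph"
  have "subgraph ?S (G j)" using w by (simp add: subgraph_def wf_graph_def)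
  moreover have "graph_iso (G i) ?S"
    unfolding graph_iso_def using V E by (intro exI[of _ "\<lambda>_. w"]) (auto simp: bij_betw_def)
  ultimately show False using incomp[OF i j(1)] j unfolding iso_subgraph_def by blast
qed

theorem mainTheorem11:
  fixes k :: nat and G :: "nat \<Rightarrow> 'a ugraph"
  assumes "k \<ge> 2"
    and "\<forall>i<k. connected_graph (G i)"
    and "\<forall>i<k. \<forall>j<k. i \<noteq> j \<longrightarrow> \<not> iso_subgraph (G i) (G j)"
  shows "(\<exists>H :: nat ugraph. gluing k G H \<and> tree_like k G H \<and> (\<forall>i<k. \<not> graph_iso H (G i))) \<and>
         (\<forall>(p::real) (q::nat). 0 < p \<and> p < 1 \<and> q > 1 \<longrightarrow>
            (\<exists>c>0. \<exists>n0. \<forall>n\<ge>n0.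
               tv_from_uniform (map_pmf (\<lambda>Gr. subgraph_count (disj_union k G) Gr mod q) (Gnp n p)) q
                 \<le> 2 powr (- c * real n)))"
proof -
  have k: "k > 0" using assms(1) by simp
  have conn: "connected_graph (G i)" if "i < k" for i using assms(2) that by blast
  have incomp: "\<not> iso_subgraph (G i) (G j)" if "i < k" "j < k" "i \<noteq> j" for i j using assms(3) that by blast
  have ne: "edges (G i) \<noteq> {}" if "i < k" for i
    using incomparable_edges_nonempty[where k = k and G = G] assms(1) conn incomp that by blast
  have sp: "spanned (G i)" if "i < k" for i using spanned_connected_graph[OF conn ne] that by blast
  obtain P :: "nat \<Rightarrow> nat set set" where P0: "\<forall>i<k. P i \<in> copies (G i)"
    and P_meet0: "\<forall>i j. i < j \<longrightarrow> j < k \<longrightarrow> (\<Union>(P i) \<inter> \<Union>(P j) \<noteq> {} \<longleftrightarrow> j = Suc i)"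
    and P_disj: "\<forall>i<k. \<forall>j<k. i \<noteq> j \<longrightarrow> P i \<inter> P j = {}"
    and P_unique0: "\<forall>s. (\<forall>i<k. s i \<in> copies (G i)) \<longrightarrow> (\<Union>i<k. s i) = (\<Union>i<k. P i) \<longrightarrow> (\<forall>i<k. s i = P i)"
  proof -
    have "\<exists>P :: nat \<Rightarrow> nat set set. (\<forall>i<k. P i \<in> copies (G i)) \<and>
        (\<forall>i j. i < j \<longrightarrow> j < k \<longrightarrow> (\<Union>(P i) \<inter> \<Union>(P j) \<noteq> {} \<longleftrightarrow> j = Suc i)) \<and>
        (\<forall>i<k. \<forall>j<k. i \<noteq> j \<longrightarrow> P i \<inter> P j = {}) \<and>
        (\<forall>s. (\<forall>i<k. s i \<in> copies (G i)) \<longrightarrow> (\<Union>i<k. s i) = (\<Union>i<k. P i) \<longrightarrow> (\<forall>i<k. s i = P i))"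
      using conn ne incomp by (rule chain_gluing_exists)
    then show ?thesis by (elim exE conjE) (rule that)
  qed
  have P: "P i \<in> copies (G i)" if "i < k" for i using P0 that by blast
  have P_meet: "\<Union>(P i) \<inter> \<Union>(P j) \<noteq> {} \<longleftrightarrow> j = Suc i" if "i < j" "j < k" for i j using P_meet0 that by blast
  have P_unique: "s i = P i"
    if "\<And>i. i < k \<Longrightarrow> s i \<in> copies (G i)" "(\<Union>i<k. s i) = (\<Union>i<k. P i)" "i < k" for s i
    using P_unique0[rule_format, of s i] that by simp
  define U where "U = (\<Union>i<k. P i)"
  let ?C = "\<lambda>i. copies (G i) :: nat set set set"
  interpret edge_families ?C "\<lambda>i. card (edges (G i))" k
  proof
    fix i and V :: "nat set set" assume i: "i < k"
    show "(`) \<sigma> ` V \<in> copies (G i) \<longleftrightarrow> V \<in> copies (G i)" if "inj \<sigma>" for \<sigma> :: "nat \<Rightarrow> nat"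
      using copies_invariant[OF that sp[OF i]] .
    assume V: "V \<in> copies (G i)"
    show "edge_connected V" using copies_edge_connected[OF sp conn ne V] i by blast
    show "finite V" "card V = card (edges (G i))" "\<And>e. e \<in> V \<Longrightarrow> card e = 2"
      using copies_finite[OF sp[OF i] V] copies_card[OF sp[OF i] V] copies_card_edge[OF sp[OF i] V] .
  qed
  have card_U: "card U = (\<Sum>i<k. card (edges (G i)))"
  proof -
    have "card U = (\<Sum>i<k. card (P i))"
      unfolding U_def using P_disj finite P by (intro card_UN_disjoint) auto
    then show ?thesis using card P by simp
  qed
  \<comment> \<open>Uniqueness of the decomposition leaves a single tuple in the sum, and its
    touching graph is a path on \<open>k\<close> vertices.\<close>
  have weight_U: "cluster_weight ?C {..<k} U = (- 1) ^ (k - 1)"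
  proof -
    have "{s \<in> PiE {..<k} ?C. (\<Union>i<k. s i) = U} = {restrict P {..<k}}"
    proof (intro subset_antisym subsetI)
      fix s assume s: "s \<in> {s \<in> PiE {..<k} ?C. (\<Union>i<k. s i) = U}"
      then have "s i = P i" if "i < k" for i using that by (intro P_unique) (auto simp: U_def)
      then have "s = restrict P {..<k}"
        using s by (intro extensionalityI[of s "{..<k}"]) (auto simp: PiE_def)
      then show "s \<in> {restrict P {..<k}}" by simp
    qed (use P in \<open>auto simp: U_def\<close>)
    then have "cluster_weight ?C {..<k} U = ursell (touching (restrict P {..<k})) {..<Suc (k - 1)}"
      using k by (simp add: cluster_weight_def)
    also have "\<dots> = (- 1) ^ (k - 1)"
      using P_meet by (intro ursell_path) (auto simp: touching_def Int_commute)
    finally show ?thesis .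
  qed
  \<comment> \<open>Connectedness of the glued graph is read off from its nonzero weight, without
    walking along the chain.\<close>
  have wfU: "wf_graph (\<Union>U, U)" and connU: "connected_graph (\<Union>U, U)"
  proof -
    have "cluster_weight ?C {..<k} U \<noteq> 0" using weight_U by simp
    then have "edge_connected U \<and> finite U \<and> (\<forall>e\<in>U. card e = 2)"
      using conn_weight_cluster_weight[of "{..<k}"] unfolding conn_weight_def by blast
    moreover from this have "finite (\<Union>U)" by (metis card.infinite finite_Union zero_neq_numeral)
    ultimately show "wf_graph (\<Union>U, U)" "connected_graph (\<Union>U, U)"
      using connected_graph_edge_connected by (auto simp: wf_graph_def)
  qed
  define H where "H = (\<Union>U, U)"
  define Hs where "Hs i = (\<Union>(P i), P i)" for i
  have PU: "P i \<subseteq> U" if "i < k" for i using that by (auto simp: U_def)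
  have dec: "decomposition k G H Hs"
    unfolding decomposition_def
  proof (intro conjI allI impI)
    fix i assume i: "i < k"
    show "subgraph (Hs i) H" "graph_iso (Hs i) (G i)"
      using copies_graph[OF sp[OF i] P[OF i]] PU[OF i] by (auto simp: Hs_def H_def subgraph_def)
  qed (auto simp: Hs_def H_def U_def)
  have uniq: "Hs' i = Hs i" if Hs': "decomposition k G H Hs'" and i: "i < k" for Hs' i
  proof -
    have wf': "wf_graph (Hs' i)" "graph_iso (Hs' i) (G i)" if "i < k" for i
      using Hs' that by (auto simp: decomposition_def subgraph_def)
    have "edges (Hs' i) = P i"
    proof (rule P_unique[OF _ _ i])
      show "edges (Hs' i) \<in> copies (G i)" if "i < k" for i using spanned_iso(2)[OF sp wf'] that by blast
      show "(\<Union>i<k. edges (Hs' i)) = (\<Union>i<k. P i)" using Hs' by (simp add: decomposition_def H_def U_def)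
    qed
    moreover have "verts (Hs' i) = \<Union>(edges (Hs' i))" using spanned_iso(1)[OF sp wf'] i by blast
    ultimately show ?thesis by (simp add: Hs_def verts_def edges_def prod_eq_iff)
  qed
  have "tree_like k G H"
    unfolding tree_like_def uniquely_decomposable_def
  proof (intro conjI allI impI exI[of _ Hs])
    fix Hs' assume Hs': "decomposition k G H Hs'"
    have meets: "verts (Hs' i) \<inter> verts (Hs' j) \<noteq> {} \<longleftrightarrow> j = Suc i" if "i < j" "j < k" for i j
      using P_meet[OF that] uniq[OF Hs'] that by (simp add: Hs_def)
    have "{{i, j} | i j. i < k \<and> j < k \<and> i \<noteq> j \<and> verts (Hs' i) \<inter> verts (Hs' j) \<noteq> {}}
      = {{i, Suc i} | i. Suc i < k}" (is "?L = ?R")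
    proof (intro subset_antisym subsetI)
      fix e assume "e \<in> ?L"
      then obtain i j where ij: "e = {i, j}" "i < k" "j < k" "i \<noteq> j" "verts (Hs' i) \<inter> verts (Hs' j) \<noteq> {}" by blast
      show "e \<in> ?R"
      proof (cases "i < j")
        case True
        then show ?thesis using ij meets[of i j] by auto
      next
        case False
        then show ?thesis using ij meets[of j i] by (auto simp: Int_commute insert_commute)
      qed
    next
      fix e assume "e \<in> ?R"
      then obtain i where i: "e = {i, Suc i}" "Suc i < k" by blast
      then have "verts (Hs' i) \<inter> verts (Hs' (Suc i)) \<noteq> {}" using meets[of i "Suc i"] by simp
      then show "e \<in> ?L" using i by (intro CollectI exI[of _ i] exI[of _ "Suc i"]) auto
    qed
    then show "is_tree (structure_graph k Hs')" unfolding structure_graph_def using path_is_tree[OF k] by simp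
  qed (use dec uniq in auto)
  moreover have "gluing k G H" unfolding gluing_def using dec connU by (auto simp: H_def)
  \<comment> \<open>Otherwise the piece of another \<open>G j\<close> would lie inside a copy of
    \<open>G i\<close>.\<close>
  moreover have "\<not> graph_iso H (G i)" if i: "i < k" for i
  proof
    assume "graph_iso H (G i)"
    then have "U \<in> copies (G i)" using spanned_iso(2)[OF sp[OF i], of H] wfU by (simp add: H_def)
    moreover obtain j where j: "j < k" "j \<noteq> i"
      by (rule that[of "if i = 0 then 1 else 0"]) (use assms(1) in auto)
    ultimately have "iso_subgraph (G j) (G i)"
      using iso_subgraph_copies[OF sp sp P] PU i by blast
    then show False using incomp i j by blast
  qed
  moreover have "\<exists>c>0. \<exists>n0. \<forall>n\<ge>n0.
      tv_from_uniform (map_pmf (\<lambda>Gr. subgraph_count (disj_union k G) Gr mod q) (Gnp n p)) q \<le> 2 powr (- c * real n)"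
    if p: "0 < p" "p < 1" and q: "q > 1" for p :: real and q :: nat
    unfolding exp_small_def[symmetric]
  proof (rule tv_exp_small[OF p q])
    fix a assume a: "0 < a" "a < q"
    \<comment> \<open>The weight is a unit, so \<open>a\<close> stays nonzero modulo
      \<open>q\<close> for composite \<open>q\<close> too.\<close>
    have "\<not> int q dvd int a * cluster_weight ?C {..<k} U"
    proof
      assume "int q dvd int a * cluster_weight ?C {..<k} U"
      then have "int q dvd int a" unfolding weight_U by (cases "even (k - 1)") auto
      then show False using a by (auto dest: dvd_imp_le)
    qed
    moreover have "0 < card (edges (G i))" if "i < k" for i
      using copies_finite[OF sp P] copies_card[OF sp P] ne that copies_edge_connected[OF sp conn ne P]
      by (metis card_gt_0_iff edge_connected_def)
    ultimately have "exp_small (\<lambda>n. norm (avg p (all_pairs n) (\<lambda>S. zchar q (int a * disjoint_count ?C {..<k} S))))"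
      using q by (intro disjoint_count_bias[OF p _ k _ card_U]) auto
    moreover have "avg p (all_pairs n) (\<lambda>S. zchar q (int a * disjoint_count ?C {..<k} S))
      = avg p (all_pairs n) (\<lambda>S. zchar q (int a * int (subgraph_count (disj_union k G) ({..<n}, S))))" for n
      using subgraph_count_disj_union[OF sp conn ne incomp] by (intro avg_cong) simp
    ultimately show "exp_small (\<lambda>n. norm (avg p (all_pairs n)
        (\<lambda>S. zchar q (int a * int (subgraph_count (disj_union k G) ({..<n}, S))))))"
      by simp
  qed
  ultimately show ?thesis by blast
qed

end
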